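(* Let $\mathcal{A}$ be an irreducible commutative associative algebra over $\mathbb{R}$ of dimension $d$ with nilradical $\mathcal{N}$, and let $a_2,\ldots,a_d$ be a Jordan-Hölder basis of $\mathcal{N}$. Let $a_1=1_{\mathcal{A}}$, and let $\psi:\mathbb{R}^d\to\mathcal{A}$ be the linear isomorphism $\psi((x_1,\ldots,x_d)^T)=\sum_{i=1}^d x_ia_i$. Let $\Psi:\mathcal{A}\to\mathfrak{gl}(d,\mathbb{R})$ be the linear map satisfying $\psi^{-1}(\tilde a\cdot\psi(x))=\Psi(\tilde a)\cdot x$ for all $\tilde a\in\mathcal{A}$ and all $x\in\mathbb{R}^d$. Then: (a) The set $S=\{I_d+\Psi(a)^T: a\in\mathcal{N}\}$ is a shearing subgroup, with associated Lie algebra $\mathfrak{s}=\{\Psi(a)^T:a\in\mathcal{N}\}$. (b) Defining $X_i=\Psi(a_i)^T$ for $i=1,\ldots,d$, the matrix $X_1$ is the identity matrix, and $X_2,\ldots,X_d$ is the canonical basis of $\mathfrak{s}$. (c) Let $(d_{i,j,k})_{1\le i,j,k\le d}$ be the structure constants defined by $a_ia_j=\sum_{k=1}^d d_{i,j,k}a_k$ for all $1\le i,j\le d$. Then the $(j,k)$ entry of $X_i$ is $d_{i,j,k}$, for all $1\le i,j,k\le d$. (d) For all $1\le i,j,k\le d$: $d_{i,j,k}=d_{j,i,k}$ and $d_{1,j,k}=\delta_{j,k}$; and for all $2\le i,j\le d$ and $1\le k\le d$: $d_{i,j,k}=0$ whenever $k\le\max(i,j)$. In particular, for $2\le i\le d$,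 $$X_i=E_{1,i}+\sum_{j=2}^d\sum_{k=j+1}^d d_{i,j,k}E_{j,k}.$$
   Context: Algebras. For a finite-dimensional commutative associative real algebra $\mathcal{A}$, the nilradical $\mathcal{N}$ is the ideal of all nilpotent elements. $\mathcal{A}$ is called irreducible (over $\mathbb{R}$) if it has a unit element $1_{\mathcal{A}}$ and $\mathcal{A}=\mathbb{R}\cdot 1_{\mathcal{A}}\oplus\mathcal{N}$. A basis $a_2,\ldots,a_d$ of $\mathcal{N}$ is a Jordan-Hölder basis if, with $a_1=1_{\mathcal{A}}$ and $\mathcal{I}_k=\mathrm{span}(a_k,\ldots,a_d)$, one has $\mathcal{N}\mathcal{I}_k\subset\mathcal{I}_{k+1}$ for $1\le k<d$. $E_{i,j}$ is the $d\times d$ matrix with entry one in row $i$, column $j$, and zeros elsewhere. $\mathfrak{gl}(d,\mathbb{R})$ is the space of real $d\times d$ matrices. Shearing subgroups. For a closed subgroup $H<\mathrm{GL}(d,\mathbb{R})$ let $G=\mathbb{R}^d\rtimes H$ with product $(x,h)(y,g)=(x+hy,hg)$ and quasi-regular representation $[\pi(x,h)f](y)=|\det h|^{-1/2}f(h^{-1}(y-x))$ on $L^2(\mathbb{R}^d)$. $H$ is irreducibly admissible if $\pi$ is an irreducible square-integrable representation; equivalently, the dual action $(\xi,h)\mapsto h^T\xi$ has a single open orbit, of full measure, with compact stabilizers. Let $T(d,\mathbb{R})$ be the group of upper triangular real $d\times d$ matrices with ones on the diagonal. An irreducibly admissible $H$ is a generalized shearlet dilation group if there are closed subgroups $S,D<H$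 such that: (i) $S$ is a connected abelian Lie subgroup of $T(d,\mathbb{R})$; (ii) $D=\{\exp(rY):r\in\mathbb{R}\}$ with $Y$ a diagonal matrix; (iii) every $h\in H$ can be written uniquely as $h=\pm ds$ with $d\in D$, $s\in S$. A group $S$ is a shearing subgroup if it occurs in this way for some generalized shearlet dilation group. Canonical basis. The Lie algebra $\mathfrak{s}$ of a shearing subgroup has a unique basis $X_2,\ldots,X_d$ with $X_i^Te_1=e_i$ for $i=2,\ldots,d$ ($e_1,\ldots,e_d$ the canonical basis of $\mathbb{R}^d$), called the canonical basis of $\mathfrak{s}$. (Known fact: a connected abelian subgroup of $T(d,\mathbb{R})$ of dimension $d-1$ is a shearing subgroup if and only if its Lie algebra has such a basis.) *)

theory Defs
  imports "HOL-Analysis.Analysis"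
begin

text \<open>
  Coordinates are indexed by an arbitrary finite linearly ordered type \<open>'n\<close>; its elements in
  increasing order play the role of \<open>1, ..., d\<close>, where \<open>d = CARD('n)\<close>.
\<close>

text \<open>
  The type \<open>real^'n^'n\<close> without the implicit constraint \<open>'n::finite\<close>, so that it can be used
  together with the sort \<open>{finite,linorder}\<close>.
\<close>

type_synonym 'n sqmat = "((real, 'n) vec, 'n) vec"

definition first_index :: "'n::{finite,linorder}" where
  "first_index = Min UNIV"

definition family_basis :: "'i set \<Rightarrow> ('i \<Rightarrow> 'v::real_vector) \<Rightarrow> 'v set \<Rightarrow> bool" where
  "family_basis I v V \<longleftrightarrow> inj_on v I \<and> independent (v ` I) \<and> span (v ` I) = V"

definition matrix_unit :: "'n \<Rightarrow> 'n \<Rightarrow> real^'n^'n" where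
  "matrix_unit i j = (\<chi> r c. if r = i \<and> c = j then 1 else 0)"


section \<open>Algebras\<close>

definition nilradical :: "'a::comm_ring_1 set" where
  "nilradical = {x. \<exists>m::nat. x ^ m = 0}"

definition irreducible_algebra :: "'a::{real_algebra_1,comm_ring_1} itself \<Rightarrow> bool" where
  "irreducible_algebra _ \<longleftrightarrow>
     (\<forall>x::'a. \<exists>u\<in>span {1}. \<exists>n\<in>nilradical. x = u + n) \<and> span {1::'a} \<inter> nilradical = {0}"

text \<open>
  The unit element is stored as the first member of the family, so that the ideals spanned by the
  tails of \<open>a\<close> include the whole algebra.
\<close>

definition Jordan_Hoelder_basis ::
    "('n::{finite,linorder} \<Rightarrow> 'a::{real_algebra_1,comm_ring_1}) \<Rightarrow> bool" where
  "Jordan_Hoelder_basis a \<longleftrightarrow>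
     a first_index = 1 \<and>
     family_basis (- {first_index}) a nilradical \<and>
     (\<forall>k. (\<exists>l. k < l) \<longrightarrow>
        (\<forall>n\<in>nilradical. \<forall>y\<in>span (a ` {k..}). n * y \<in> span (a ` {k<..})))"


section \<open>Matrix groups\<close>

primrec mat_pow :: "real^'n^'n \<Rightarrow> nat \<Rightarrow> real^'n^'n" where
  "mat_pow A 0 = mat 1"
| "mat_pow A (Suc m) = A ** mat_pow A m"

definition mat_exp :: "real^'n^'n \<Rightarrow> real^'n^'n" where
  "mat_exp A = (\<Sum>m. (1 / fact m) *\<^sub>R mat_pow A m)"

definition GL :: "(real^'n^'n) set" where
  "GL = {A. invertible A}"

definition closed_matrix_group :: "(real^'n^'n) set \<Rightarrow> bool" where
  "closed_matrix_group H \<longleftrightarrow>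
     H \<subseteq> GL \<and> mat 1 \<in> H \<and> (\<forall>g\<in>H. \<forall>h\<in>H. g ** h \<in> H) \<and> (\<forall>h\<in>H. matrix_inv h \<in> H) \<and>
     closedin (top_of_set GL) H"

definition matrix_lie_algebra :: "(real^'n^'n) set \<Rightarrow> (real^'n^'n) set" where
  "matrix_lie_algebra H = {X. \<forall>t::real. mat_exp (t *\<^sub>R X) \<in> H}"

definition unitriangular :: "('n::{finite,linorder}) sqmat set" where
  "unitriangular = {A. (\<forall>i. A $ i $ i = 1) \<and> (\<forall>i j. j < i \<longrightarrow> A $ i $ j = 0)}"


section \<open>The quasi-regular representation\<close>

text \<open>
  The space \<open>L\<^sup>2\<close> is represented by square-integrable functions rather than by their classes
  modulo null sets. A subspace closed in the \<open>L\<^sup>2\<close>-seminorm is automatically a union of such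
  classes.
\<close>

definition L2 :: "((real^'n) \<Rightarrow> complex) set" where
  "L2 = {f \<in> borel_measurable lborel. integrable lborel (\<lambda>x. (norm (f x))\<^sup>2)}"

definition L2_inner :: "((real^'n) \<Rightarrow> complex) \<Rightarrow> ((real^'n) \<Rightarrow> complex) \<Rightarrow> complex" where
  "L2_inner f g = (\<integral>x. f x * cnj (g x) \<partial>lborel)"

definition L2_seminorm :: "((real^'n) \<Rightarrow> complex) \<Rightarrow> real" where
  "L2_seminorm f = sqrt (\<integral>x. (norm (f x))\<^sup>2 \<partial>lborel)"

definition L2_null :: "((real^'n) \<Rightarrow> complex) set" where
  "L2_null = {f \<in> L2. AE x in lborel. f x = 0}"

definition closed_L2_subspace :: "((real^'n) \<Rightarrow> complex) set \<Rightarrow> bool" where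
  "closed_L2_subspace V \<longleftrightarrow>
     V \<subseteq> L2 \<and> (\<lambda>_. 0) \<in> V \<and>
     (\<forall>f\<in>V. \<forall>g\<in>V. (\<lambda>x. f x + g x) \<in> V) \<and>
     (\<forall>f\<in>V. \<forall>c. (\<lambda>x. c * f x) \<in> V) \<and>
     (\<forall>f\<in>L2. (\<forall>\<epsilon>>0. \<exists>g\<in>V. L2_seminorm (\<lambda>x. f x - g x) < \<epsilon>) \<longrightarrow> f \<in> V)"

definition affine_mult ::
    "(real^'n) \<times> (real^'n^'n) \<Rightarrow> (real^'n) \<times> (real^'n^'n) \<Rightarrow> (real^'n) \<times> (real^'n^'n)" where
  "affine_mult p q = (fst p + snd p *v fst q, snd p ** snd q)"

definition quasi_regular ::
    "(real^'n) \<times> (real^'n^'n) \<Rightarrow> ((real^'n) \<Rightarrow> complex) \<Rightarrow> (real^'n) \<Rightarrow> complex" where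
  "quasi_regular p f =
     (\<lambda>y. of_real (\<bar>det (snd p)\<bar> powr (- 1 / 2)) * f (matrix_inv (snd p) *v (y - fst p)))"

definition quasi_regular_irreducible :: "(real^'n^'n) set \<Rightarrow> bool" where
  "quasi_regular_irreducible H \<longleftrightarrow>
     (\<forall>V. closed_L2_subspace V \<and> (\<forall>p\<in>UNIV \<times> H. \<forall>f\<in>V. quasi_regular p f \<in> V) \<longrightarrow>
          V = L2_null \<or> V = L2)"

text \<open>
  Left Haar measures on the semidirect product of the translations and \<open>H\<close>. This group is a
  second countable locally compact space, so regularity of the measure is automatic.
\<close>

definition left_Haar_measure ::
    "(real^'n^'n) set \<Rightarrow> ((real^'n) \<times> (real^'n^'n)) measure \<Rightarrow> bool" where
  "left_Haar_measure H \<mu> \<longleftrightarrow>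
     space \<mu> = UNIV \<times> H \<and>
     sets \<mu> = sets (restrict_space borel (UNIV \<times> H)) \<and>
     emeasure \<mu> (space \<mu>) \<noteq> 0 \<and>
     (\<forall>K\<subseteq>UNIV \<times> H. compact K \<longrightarrow> emeasure \<mu> K < \<infinity>) \<and>
     (\<forall>p\<in>UNIV \<times> H. \<forall>A\<in>sets \<mu>. emeasure \<mu> (affine_mult p ` A) = emeasure \<mu> A)"

text \<open>
  A left Haar measure exists and is unique up to a positive factor, so it does not matter which one
  is used here.
\<close>

definition quasi_regular_square_integrable :: "(real^'n^'n) set \<Rightarrow> bool" where
  "quasi_regular_square_integrable H \<longleftrightarrow>
     (\<exists>\<mu>. left_Haar_measure H \<mu> \<and>
        (\<exists>f\<in>L2 - L2_null. integrable \<mu> (\<lambda>p. (norm (L2_inner f (quasi_regular p f)))\<^sup>2)))"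

definition irreducibly_admissible :: "(real^'n^'n) set \<Rightarrow> bool" where
  "irreducibly_admissible H \<longleftrightarrow>
     closed_matrix_group H \<and> quasi_regular_irreducible H \<and> quasi_regular_square_integrable H"


section \<open>Shearing subgroups\<close>

text \<open>
  Being closed in \<open>GL\<close>, the group \<open>S\<close> is automatically a Lie subgroup, and its Lie group topology
  is the subspace topology.
\<close>

definition generalized_shearlet_dilation_group ::
    "('n::{finite,linorder}) sqmat set \<Rightarrow> 'n sqmat set \<Rightarrow> 'n sqmat set \<Rightarrow> bool" where
  "generalized_shearlet_dilation_group H S D \<longleftrightarrow>
     irreducibly_admissible H \<and>
     closed_matrix_group S \<and> S \<subseteq> H \<and> closed_matrix_group D \<and> D \<subseteq> H \<and>
     S \<subseteq> unitriangular \<and> connected S \<and> (\<forall>g\<in>S. \<forall>h\<in>S. g ** h = h ** g) \<and>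
     (\<exists>Y. (\<forall>i j. i \<noteq> j \<longrightarrow> Y $ i $ j = 0) \<and> D = range (\<lambda>r::real. mat_exp (r *\<^sub>R Y))) \<and>
     (\<forall>h\<in>H. \<exists>!(\<epsilon>, g, s). \<epsilon> \<in> {1, - 1 :: real} \<and> g \<in> D \<and> s \<in> S \<and> h = \<epsilon> *\<^sub>R (g ** s))"

definition shearing_subgroup :: "('n::{finite,linorder}) sqmat set \<Rightarrow> bool" where
  "shearing_subgroup S \<longleftrightarrow> (\<exists>H D. generalized_shearlet_dilation_group H S D)"

text \<open>
  Only the members of the family at indices other than the first one matter. They are determined
  by \<open>\<ss>\<close>: if \<open>\<ss>\<close> has such a basis, then \<open>X \<mapsto> X\<^sup>T e\<^sub>1\<close> is injective on \<open>\<ss>\<close>.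
\<close>

definition canonical_basis ::
    "('n::{finite,linorder}) sqmat set \<Rightarrow> ('n \<Rightarrow> 'n sqmat) \<Rightarrow> bool" where
  "canonical_basis \<ss> X \<longleftrightarrow>
     family_basis (- {first_index}) X \<ss> \<and>
     (\<forall>i. i \<noteq> first_index \<longrightarrow> transpose (X i) *v axis first_index 1 = axis i 1)"

end

theory Submission
  imports Defs "HOL-Probability.Characteristic_Functions"
begin

text \<open>
  The algebra acts on itself by multiplication, and \<open>\<Psi>\<close> is the matrix of this regular
  representation in the basis \<open>a\<close>. The assertions about the \<open>X i\<close> and the structure constants are
  obtained by comparing coordinates. The one point that needs an argument is that multiplication by
  a nilpotent element is strictly triangular also at the last basis vector, where the defining
  condition of a Jordan-Hoelder basis is silent: there \<open>n * a j\<close> is a multiple of \<open>a j\<close>, and the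
  factor vanishes because \<open>n\<close> is nilpotent (\<open>nilpotent_strictly_lower\<close>).

  To see that \<open>S\<close> is a shearing subgroup, take for the diagonal matrix the identity. Then \<open>D\<close>
  consists of the positive scalars, and the dilation group \<open>H\<close> of the transposed matrices of all
  units of the algebra. In the coordinates \<open>\<psi>\<close> the dual action of \<open>H\<close> is the multiplication of
  algebra elements by units. So there is one open orbit, the units themselves, it is the complement
  of the hyperplane where the first coordinate vanishes, and \<open>H\<close> acts freely on it.

  Irreducibility and square integrability of the quasi-regular representation follow on the Fourier
  side, where \<open>(x, h)\<close> sends \<open>\<phi>\<close> to a multiple of
  \<open>\<lambda>\<xi>. cis (- 2 * pi * (x \<bullet> \<xi>)) * \<phi> (transpose h *v \<xi>)\<close> (\<open>plancherel_pair_quasi_regular\<close>). If \<open>f\<close>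
  lies in an invariant subspace and \<open>g\<close> is orthogonal to it, with transforms \<open>\<phi>\<close> and \<open>\<gamma>\<close>, then for each
  \<open>h\<close> the integrable function \<open>\<lambda>\<xi>. \<gamma> \<xi> * cnj (\<phi> (transpose h *v \<xi>))\<close> has vanishing Fourier transform, so it
  is zero almost everywhere. Since \<open>h\<close> moves almost every \<open>\<xi>\<close> over the whole orbit, Fubini leaves only
  \<open>\<phi> = 0\<close> or \<open>\<gamma> = 0\<close> (\<open>quasi_regular_irreducible_unit_group\<close>). With the Plancherel identity in place
  of uniqueness, the same computation gives for a function \<open>f\<close> with transform \<open>u\<close> that the integral
  of \<open>\<lambda>p. (norm (L2_inner f (quasi_regular p f)))\<^sup>2\<close> against Haar measure is the squared norm of \<open>u\<close> times
  the integral of \<open>\<lambda>\<eta>. (norm (u \<eta>))\<^sup>2 / \<bar>det (M \<eta>)\<bar>\<close>, where \<open>M \<eta>\<close> is the element of \<open>H\<close> with coordinates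
  \<open>\<eta>\<close>. It is finite for a high order difference of a Gaussian, because \<open>u\<close> then vanishes to high order
  on the hyperplane (\<open>quasi_regular_square_integrable_unit_group\<close>).

  The analysis behind this rests on Gaussian regularisation. Cutting off Fourier transforms by
  Gaussians gives the injectivity of the Fourier transform on integrable functions and the
  Plancherel identity on bounded integrable functions; completeness carries the latter over to all
  square-integrable functions. Jacobians of linear maps come from the uniqueness of translation
  invariant measures.
\<close>

section \<open>Linear changes of variables\<close>

text \<open>
  Both sides are the integral of \<open>indicator E (x + y) * indicator U y\<close>: integrating over \<open>x\<close> first and
  using the invariance of \<open>\<mu>\<close> gives the left one. Substituting \<open>y - x\<close> for \<open>y\<close> first gives the right one,
  by the invariance of both measures and the symmetry of \<open>U\<close>. Taking for \<open>U\<close> a ball shows that \<open>\<mu>\<close> is a multiple of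
  Lebesgue measure.
\<close>

lemma translation_invariant_measure:
  fixes \<mu> :: "'a::euclidean_space measure"
  assumes sets [measurable_cong]: "sets \<mu> = sets borel"
    and sf: "sigma_finite_measure \<mu>"
    and inv: "\<And>y. distr \<mu> borel (\<lambda>x. x + y) = \<mu>"
    and E [measurable]: "E \<in> sets borel" and U [measurable]: "U \<in> sets borel"
    and neg: "\<And>x. - x \<in> U \<longleftrightarrow> x \<in> U"
  shows "emeasure \<mu> E * emeasure lborel U = emeasure lborel E * emeasure \<mu> U"
proof -
  interpret \<mu>: sigma_finite_measure \<mu> by (rule sf)
  interpret P: pair_sigma_finite lborel \<mu> ..
  have shift: "(\<integral>\<^sup>+x. f (x + y) \<partial>\<mu>) = (\<integral>\<^sup>+x. f x \<partial>\<mu>)"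
    if [measurable]: "f \<in> borel_measurable borel" for f :: "'a \<Rightarrow> ennreal" and y
    by (subst (2) inv [of y, symmetric]) (simp add: nn_integral_distr)
  have shiftl: "(\<integral>\<^sup>+x. f (y + x) \<partial>lborel) = (\<integral>\<^sup>+x. f x \<partial>lborel)"
    if [measurable]: "f \<in> borel_measurable borel" for f :: "'a \<Rightarrow> ennreal" and y
    by (subst (2) lborel_distr_plus [of y, symmetric]) (simp add: nn_integral_distr)
  have "emeasure \<mu> E * emeasure lborel U = (\<integral>\<^sup>+y. \<integral>\<^sup>+x. indicator U y * indicator E x \<partial>\<mu> \<partial>lborel)"
    by (simp add: nn_integral_cmult nn_integral_multc mult.commute)
  also have "\<dots> = (\<integral>\<^sup>+y. \<integral>\<^sup>+x. indicator U y * indicator E (x + y) \<partial>\<mu> \<partial>lborel)"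
    by (intro nn_integral_cong shift [symmetric, of "\<lambda>x. indicator U y * indicator E x" for y]) simp
  also have "\<dots> = (\<integral>\<^sup>+x. \<integral>\<^sup>+y. indicator U y * indicator E (x + y) \<partial>lborel \<partial>\<mu>)"
    by (rule P.Fubini'[symmetric]) measurable
  also have "\<dots> = (\<integral>\<^sup>+x. \<integral>\<^sup>+y. indicator U (y - x) * indicator E y \<partial>lborel \<partial>\<mu>)"
  proof (rule nn_integral_cong)
    fix x
    show "(\<integral>\<^sup>+y. indicator U y * indicator E (x + y) \<partial>lborel) = (\<integral>\<^sup>+y. indicator U (y - x) * indicator E y \<partial>lborel)"
      using shiftl [of "\<lambda>y. indicator U (y - x) * indicator E y" x] by simp
  qed
  also have "\<dots> = (\<integral>\<^sup>+y. \<integral>\<^sup>+x. indicator U (y - x) * indicator E y \<partial>\<mu> \<partial>lborel)"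
    by (rule P.Fubini') measurable
  also have "\<dots> = (\<integral>\<^sup>+y. \<integral>\<^sup>+x. indicator U (- x) * indicator E y \<partial>\<mu> \<partial>lborel)"
  proof (rule nn_integral_cong)
    fix y
    show "(\<integral>\<^sup>+x. indicator U (y - x) * indicator E y \<partial>\<mu>) = (\<integral>\<^sup>+x. indicator U (- x) * indicator E y \<partial>\<mu>)"
      using shift [of "\<lambda>x. indicator U (y - x) * indicator E y" y] by simp
  qed
  also have "\<dots> = (\<integral>\<^sup>+y. \<integral>\<^sup>+x. indicator U x * indicator E y \<partial>\<mu> \<partial>lborel)"
    by (intro nn_integral_cong) (auto simp: neg indicator_def)
  also have "\<dots> = emeasure lborel E * emeasure \<mu> U"
    by (simp add: nn_integral_cmult nn_integral_multc mult.commute)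
  finally show ?thesis .
qed

lemma measurable_matrix_vector_mult [measurable]:
  "(\<lambda>x. A *v x) \<in> borel_measurable (borel :: (real^'n) measure)" for A :: "real^'n^'m"
  by (intro borel_measurable_continuous_onI linear_continuous_on matrix_vector_mul_bounded_linear)

lemma matrix_vimage_borel: "(*v) A -` E \<in> sets borel"
  if "E \<in> sets borel" for A :: "real^'n^'m"
  using measurable_sets[OF measurable_matrix_vector_mult that, of A] by (simp only: space_borel Int_UNIV_right)

definition volume_factor :: "real^'n^'n \<Rightarrow> real" where
  "volume_factor A = measure lborel ((*v) A -` ball 0 1) / measure lborel (ball (0::real^'n) 1)"

lemma volume_factor_nonneg: "0 \<le> volume_factor A"
  by (simp add: volume_factor_def)

text \<open>
  The image of Lebesgue measure under \<open>A\<close> is again translation invariant, hence a multiple of Lebesgue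
  measure. The factor is measured on the unit ball, which is symmetric.
\<close>

lemma emeasure_matrix_vimage:
  fixes A :: "real^'n^'n"
  assumes A: "invertible A" and E [measurable]: "E \<in> sets borel"
  shows "emeasure lborel ((*v) A -` E) = ennreal (volume_factor A) * emeasure lborel E"
proof -
  obtain B where AB: "A ** B = mat 1" "B ** A = mat 1"
    using A by (auto simp: invertible_def)
  have inv1 [simp]: "A *v (B *v x) = x" "B *v (A *v x) = x" for x
    by (simp_all add: matrix_vector_mul_assoc AB)
  define \<mu> where "\<mu> = distr lborel borel ((*v) A)"
  have em: "emeasure \<mu> E = emeasure lborel ((*v) A -` E)" if "E \<in> sets borel" for E
    using that by (simp add: \<mu>_def emeasure_distr)
  have vim: "(*v) A -` ball 0 r = (*v) B ` ball 0 r" for r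
    by (force simp: image_iff)
  have bdd: "bounded ((*v) A -` ball 0 r)" for r
    unfolding vim by (intro bounded_linear_image) (auto simp: matrix_vector_mul_bounded_linear)
  have "sigma_finite_measure \<mu>"
  proof (rule sigma_finite_measure.intro, intro exI conjI)
    let ?F = "(\<lambda>n::nat. ball (0::real^'n) (real n))"
    show "countable (range ?F)" "range ?F \<subseteq> sets \<mu>" "\<Union>(range ?F) = space \<mu>"
      by (auto simp: \<mu>_def reals_Archimedean2)
    show "\<forall>a\<in>range ?F. emeasure \<mu> a \<noteq> \<infinity>"
      using emeasure_bounded_finite[OF bdd] by (auto simp: em less_top)
  qed
  moreover have "distr \<mu> borel (\<lambda>x. x + y) = \<mu>" for y
  proof -
    have "distr \<mu> borel (\<lambda>x. x + y) = distr (distr lborel borel ((+) (B *v y))) borel ((*v) A)"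
      unfolding \<mu>_def by (simp add: distr_distr comp_def matrix_vector_right_distrib add.commute)
    then show ?thesis by (simp add: lborel_distr_plus \<mu>_def)
  qed
  ultimately have *: "emeasure \<mu> E * emeasure lborel (ball (0::real^'n) 1) =
      emeasure lborel E * emeasure \<mu> (ball 0 1)"
    by (intro translation_invariant_measure) (auto simp: \<mu>_def)
  have "emeasure \<mu> (ball 0 1) < \<infinity>"
    using emeasure_bounded_finite[OF bdd] by (simp add: em)
  then have fin: "emeasure \<mu> (ball 0 1) = ennreal (measure \<mu> (ball 0 1))"
    by (simp add: emeasure_eq_ennreal_measure less_top)
  have mu: "measure \<mu> (ball 0 1) = measure lborel ((*v) A -` ball 0 1)"
    by (simp add: measure_def em)
  define v where "v = measure lborel (ball (0::real^'n) 1)"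
  have v: "0 < v"
    by (simp add: content_ball_pos v_def)
  have emv: "emeasure lborel (ball (0::real^'n) 1) = ennreal v"
    unfolding v_def using emeasure_lborel_ball_finite[of "0::real^'n" 1] by (intro emeasure_eq_ennreal_measure) auto
  have "emeasure \<mu> E = emeasure \<mu> E * ennreal v / ennreal v"
    using v by (simp add: ennreal_mult_divide_eq)
  also have "\<dots> = emeasure lborel E * ennreal (volume_factor A)"
  proof -
    have "ennreal (volume_factor A) = ennreal (measure lborel ((*v) A -` ball 0 1)) / ennreal v"
      using v by (simp add: divide_ennreal volume_factor_def v_def)
    then show ?thesis
      using * by (simp add: emv fin mu ennreal_times_divide)
  qed
  finally have "emeasure \<mu> E = emeasure lborel E * ennreal (volume_factor A)" .
  then show ?thesis
    by (simp add: em mult.commute)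
qed

lemma volume_factor_mult:
  fixes A B :: "real^'n^'n"
  assumes "invertible A" "invertible B"
  shows "volume_factor (A ** B) = volume_factor A * volume_factor B"
proof -
  have "(*v) (A ** B) -` S = (*v) B -` ((*v) A -` S)" for S
    by (auto simp: matrix_vector_mul_assoc)
  moreover have "(*v) A -` ball 0 1 \<in> sets borel"
    by (simp add: matrix_vimage_borel)
  ultimately have "emeasure lborel ((*v) (A ** B) -` ball 0 1)
      = ennreal (volume_factor B) * emeasure lborel ((*v) A -` ball 0 1)"
    using emeasure_matrix_vimage[OF assms(2)] by simp
  then have "measure lborel ((*v) (A ** B) -` ball 0 1)
      = volume_factor B * measure lborel ((*v) A -` ball 0 1)"
    using volume_factor_nonneg[of B] by (simp add: measure_def enn2real_mult)
  then show ?thesis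
    by (simp add: volume_factor_def[of A] volume_factor_def[of "A ** B"])
qed

lemma volume_factor_one: "volume_factor (mat 1 :: real^'n^'n) = 1"
proof -
  have "(*v) (mat 1 :: real^'n^'n) -` S = S" for S by auto
  then show ?thesis
    using content_ball_pos[of 1 "0::real^'n"] by (simp add: volume_factor_def)
qed

lemma volume_factor_diagonal:
  fixes A :: "real^'n^'n"
  assumes A: "invertible A" and diag: "\<And>i j. i \<noteq> j \<Longrightarrow> A $ i $ j = 0"
  shows "volume_factor A * \<bar>det A\<bar> = 1"
proof -
  have nz: "A $ i $ i \<noteq> 0" for i
    using A det_diagonal[OF diag] by (auto simp: invertible_det_nz)
  have Av: "A *v x = (\<chi> k. A $ k $ k * x $ k)" for x
  proof -
    have "(\<Sum>j\<in>UNIV. A $ i $ j * x $ j) = (\<Sum>j\<in>UNIV. if j = i then A $ i $ i * x $ i else 0)" for i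
      by (intro sum.cong) (auto simp: diag)
    then show ?thesis by (simp add: matrix_vector_mult_def vec_eq_iff)
  qed
  let ?g = "\<lambda>x. \<chi> k. inverse (A $ k $ k) * x $ k"
  have "(*v) A -` ball 0 1 = ?g ` ball (0::real^'n) 1"
  proof (intro set_eqI iffI)
    fix x assume "x \<in> (*v) A -` ball 0 1"
    then show "x \<in> ?g ` ball 0 1"
      using nz by (intro image_eqI[of _ _ "A *v x"]) (auto simp: Av vec_eq_iff)
  qed (use nz in \<open>auto simp: Av mult.assoc[symmetric]\<close>)
  moreover have "(*v) A -` ball 0 1 \<in> sets borel"
    by (simp add: matrix_vimage_borel)
  ultimately have "measure lborel ((*v) A -` ball 0 1)
      = \<bar>\<Prod>k\<in>UNIV. inverse (A $ k $ k)\<bar> * measure lborel (ball (0::real^'n) 1)"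
    using measure_stretch[of "ball (0::real^'n) 1" "\<lambda>k. inverse (A $ k $ k)"] by simp
  then show ?thesis
    using content_ball_pos[of 1 "0::real^'n"] nz det_diagonal[OF diag]
    by (simp add: volume_factor_def abs_mult[symmetric] prod.distrib[symmetric])
qed

text \<open>
  The product of the two factors is nonnegative and multiplicative in \<open>A\<close>, so elementary matrices suffice. It is \<open>1\<close> on
  diagonal matrices by direct computation, and on transpositions because they square to the identity.
  A shear is conjugate under a diagonal matrix to its own square, and a multiplicative function with
  commuting nonzero values can only be \<open>1\<close> there.
\<close>

lemma volume_factor_det:
  fixes A :: "real^'n^'n"
  assumes "invertible A"
  shows "volume_factor A * \<bar>det A\<bar> = 1"
proof -
  define \<eta> where "\<eta> A = volume_factor A * \<bar>det A\<bar>" for A :: "real^'n^'n"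
  have nonneg: "0 \<le> \<eta> A" for A
    by (simp add: \<eta>_def volume_factor_def)
  have \<eta>_mult: "\<eta> (A ** B) = \<eta> A * \<eta> B" if "invertible A" "invertible B" for A B
    using that by (simp add: \<eta>_def volume_factor_mult det_mul abs_mult)
  have \<eta>_one: "\<eta> (mat 1) = 1"
    by (simp add: \<eta>_def volume_factor_one)
  have \<eta>_nz: "\<eta> A \<noteq> 0" if A: "invertible A" for A
  proof -
    obtain B where "A ** B = mat 1" "B ** A = mat 1"
      using A by (auto simp: invertible_def)
    then have "\<eta> A * \<eta> B = 1"
      using \<eta>_mult[of A B] A by (metis \<eta>_one invertible_def)
    then show ?thesis by auto
  qed
  have "invertible A \<longrightarrow> \<eta> A = 1"
  proof (induction A rule: induct_matrix_elementary)
    case (1 A B)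
    have "invertible A \<and> invertible B" if "invertible (A ** B)"
      using that by (simp add: invertible_det_nz det_mul)
    with 1 \<eta>_mult show ?case by simp
  next
    case (2 A i)
    then show ?case
      by (simp add: invertible_det_nz det_zero_row)
  next
    case (3 A)
    then show ?case
      using volume_factor_diagonal by (auto simp: \<eta>_def)
  next
    case (4 m n)
    let ?T = "(\<chi> i j. mat 1 $ i $ Transposition.transpose m n j) :: real^'n^'n"
    have "?T ** ?T = mat 1"
    proof -
      have Tv: "(?T *v x) $ i = x $ Transposition.transpose m n i" for x i
      proof -
        have "(\<Sum>j\<in>UNIV. ?T $ i $ j * x $ j)
            = (\<Sum>j\<in>UNIV. if j = Transposition.transpose m n i then x $ j else 0)"
          by (intro sum.cong) (auto simp: mat_def)
        then show ?thesis by (simp add: matrix_vector_mult_def)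
      qed
      show ?thesis
        by (simp add: matrix_eq matrix_vector_mul_assoc[symmetric] vec_eq_iff Tv)
    qed
    then have "\<eta> ?T * \<eta> ?T = 1"
      using \<eta>_mult[of ?T ?T] by (metis \<eta>_one invertible_def)
    then show ?case
      using nonneg[of ?T] by (simp add: square_eq_1_iff)
  next
    case (5 m n c)
    define T where "T c = ((\<chi> i j. if i = m \<and> j = n then c else of_bool (i = j)) :: real^'n^'n)" for c
    define D where "D = ((\<chi> i j. if i = j then if i = m then 2 else 1 else 0) :: real^'n^'n)"
    have Tv: "(T c *v x) $ i = x $ i + (if i = m then c * x $ n else 0)" for c x i
    proof -
      have "(\<Sum>j\<in>UNIV. T c $ i $ j * x $ j)
          = (\<Sum>j\<in>UNIV. (if j = i then x $ j else 0) + (if j = n then (if i = m then c * x $ n else 0) else 0))"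
        using 5 by (intro sum.cong) (auto simp: T_def)
      then show ?thesis by (simp add: matrix_vector_mult_def sum.distrib)
    qed
    have Dv: "(D *v x) $ i = (if i = m then 2 else 1) * x $ i" for x i
    proof -
      have "(\<Sum>j\<in>UNIV. D $ i $ j * x $ j) = (\<Sum>j\<in>UNIV. if j = i then (if i = m then 2 else 1) * x $ i else 0)"
        by (intro sum.cong) (auto simp: D_def)
      then show ?thesis by (simp add: matrix_vector_mult_def)
    qed
    have TT: "T a ** T b = T (a + b)" for a b
      using 5 by (simp add: matrix_eq matrix_vector_mul_assoc[symmetric] vec_eq_iff Tv algebra_simps)
    have DT: "D ** T c = T (2 * c) ** D"
      using 5 by (simp add: matrix_eq matrix_vector_mul_assoc[symmetric] vec_eq_iff Tv Dv algebra_simps)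
    have T0: "T 0 = mat 1"
      by (simp add: matrix_eq vec_eq_iff Tv)
    have T: "invertible (T a)" for a
      using TT[of a "- a"] TT[of "- a" a] T0 by (auto simp: invertible_def)
    have D: "invertible D"
    proof -
      have "det D = (\<Prod>i\<in>UNIV. D $ i $ i)"
        by (rule det_diagonal) (simp add: D_def)
      then show ?thesis by (simp add: invertible_det_nz D_def)
    qed
    \<comment> \<open>\<open>T (2 * c)\<close> is both the square of \<open>T c\<close> and its conjugate under \<open>D\<close>\<close>
    have "\<eta> D * \<eta> (T c) = \<eta> (T c) * \<eta> (T c) * \<eta> D"
      using \<eta>_mult T D DT TT[of c c] by (metis mult_2)
    then have "\<eta> (T c) = 1"
      using \<eta>_nz[OF T] \<eta>_nz[OF D] by simp
    then show ?case by (simp add: T_def)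
  qed
  then show ?thesis using assms by (simp add: \<eta>_def)
qed

lemma lborel_distr_matrix:
  fixes A :: "real^'n^'n"
  assumes "invertible A"
  shows "distr lborel borel ((*v) A) = density lborel (\<lambda>_. ennreal (1 / \<bar>det A\<bar>))"
proof (rule measure_eqI)
  fix E assume "E \<in> sets (distr lborel borel ((*v) A))"
  then have [measurable]: "E \<in> sets borel" by simp
  have "volume_factor A = 1 / \<bar>det A\<bar>"
    using volume_factor_det[OF assms] by (metis div_by_0 mult_zero_right nonzero_eq_divide_eq zero_neq_one)
  then show "emeasure (distr lborel borel ((*v) A)) E = emeasure (density lborel (\<lambda>_. ennreal (1 / \<bar>det A\<bar>))) E"
    using assms by (simp add: emeasure_distr emeasure_matrix_vimage emeasure_density nn_integral_cmult)
qed simp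

lemma nn_integral_matrix:
  fixes A :: "real^'n^'n" and f :: "real^'n \<Rightarrow> ennreal"
  assumes A: "invertible A" and [measurable]: "f \<in> borel_measurable borel"
  shows "(\<integral>\<^sup>+x. f (A *v x) \<partial>lborel) = ennreal (1 / \<bar>det A\<bar>) * (\<integral>\<^sup>+x. f x \<partial>lborel)"
proof -
  have "(\<integral>\<^sup>+x. f (A *v x) \<partial>lborel) = (\<integral>\<^sup>+x. f x \<partial>distr lborel borel ((*v) A))"
    by (simp add: nn_integral_distr)
  then show ?thesis
    by (simp add: lborel_distr_matrix[OF A] nn_integral_density nn_integral_cmult)
qed

lemma integral_matrix:
  fixes A :: "real^'n^'n" and f :: "real^'n \<Rightarrow> 'b::{banach, second_countable_topology}"
  assumes A: "invertible A" and [measurable]: "f \<in> borel_measurable borel"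
  shows "(\<integral>x. f (A *v x) \<partial>lborel) = (1 / \<bar>det A\<bar>) *\<^sub>R (\<integral>x. f x \<partial>lborel)"
    and "integrable lborel (\<lambda>x. f (A *v x)) \<longleftrightarrow> integrable lborel f"
proof -
  have "(\<integral>x. f (A *v x) \<partial>lborel) = (\<integral>x. f x \<partial>distr lborel borel ((*v) A))"
    by (simp add: integral_distr)
  then show "(\<integral>x. f (A *v x) \<partial>lborel) = (1 / \<bar>det A\<bar>) *\<^sub>R (\<integral>x. f x \<partial>lborel)"
    by (simp add: lborel_distr_matrix[OF A] integral_density)
  have "integrable lborel (\<lambda>x. f (A *v x)) \<longleftrightarrow> integrable (distr lborel borel ((*v) A)) f"
    by (simp add: integrable_distr_eq)
  also have "\<dots> \<longleftrightarrow> integrable lborel (\<lambda>x. (1 / \<bar>det A\<bar>) *\<^sub>R f x)"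
    by (simp add: lborel_distr_matrix[OF A] integrable_density)
  also have "\<dots> \<longleftrightarrow> integrable lborel f"
  proof
    have eq: "(\<lambda>x. \<bar>det A\<bar> *\<^sub>R ((1 / \<bar>det A\<bar>) *\<^sub>R f x)) = f"
      using A by (simp add: invertible_det_nz)
    assume "integrable lborel (\<lambda>x. (1 / \<bar>det A\<bar>) *\<^sub>R f x)"
    then have "integrable lborel (\<lambda>x. \<bar>det A\<bar> *\<^sub>R ((1 / \<bar>det A\<bar>) *\<^sub>R f x))"
      by (rule integrable_scaleR_right)
    then show "integrable lborel f"
      by (simp only: eq)
  qed simp
  finally show "integrable lborel (\<lambda>x. f (A *v x)) \<longleftrightarrow> integrable lborel f" .
qed

lemma AE_matrix:
  fixes A :: "real^'n^'n"
  assumes A: "invertible A" and [measurable]: "Measurable.pred borel P"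
  shows "(AE x in lborel. P (A *v x)) \<longleftrightarrow> (AE x in lborel. P x)"
proof -
  have "(AE x in lborel. P (A *v x)) \<longleftrightarrow> (AE x in distr lborel borel ((*v) A). P x)"
    by (simp add: AE_distr_iff)
  also have "\<dots> \<longleftrightarrow> (AE x in density lborel (\<lambda>_. ennreal (1 / \<bar>det A\<bar>)). P x)"
    by (simp only: lborel_distr_matrix[OF A])
  also have "\<dots> \<longleftrightarrow> (AE x in lborel. P x)"
    using A by (subst AE_density) (auto simp: invertible_det_nz)
  finally show ?thesis .
qed

text \<open>
  The largest index that is moved would be sent to a fixed point.
\<close>

lemma permutes_increasing_eq_id:
  fixes p :: "'n::{finite,linorder} \<Rightarrow> 'n"
  assumes p: "p permutes UNIV" and ge: "\<And>i. i \<le> p i"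
  shows "p = id"
proof (rule ccontr)
  assume "p \<noteq> id"
  then have ne: "{i. p i \<noteq> i} \<noteq> {}" by auto
  define i where "i = Max {i. p i \<noteq> i}"
  have i: "p i \<noteq> i"
    using Max_in[OF _ ne] by (simp add: i_def)
  have "p j = j" if "i < j" for j
  proof (rule ccontr)
    assume "p j \<noteq> j"
    then have "j \<le> i" unfolding i_def by (intro Max_ge) auto
    with that show False by simp
  qed
  then have "p (p i) = p i"
    using ge[of i] i by (metis le_less)
  then show False
    using i permutes_inj[OF p] by (auto dest: injD)
qed

lemma det_upper_triangular:
  fixes A :: "('n::{finite,linorder}) sqmat"
  assumes "\<And>i j. j < i \<Longrightarrow> A $ i $ j = 0"
  shows "det A = (\<Prod>i\<in>UNIV. A $ i $ i)"
proof -
  have "of_int (sign p) * (\<Prod>i\<in>UNIV. A $ i $ p i) = 0" if p: "p \<in> {p. p permutes UNIV} - {id}" for p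
  proof -
    obtain i where "p i < i"
      using permutes_increasing_eq_id[of p] p by (auto simp: not_le[symmetric])
    then show ?thesis
      using assms by (auto intro!: prod_zero)
  qed
  then have "det A = (\<Sum>p\<in>{id}. of_int (sign p) * (\<Prod>i\<in>UNIV. A $ i $ p i))"
    unfolding det_def by (intro sum.mono_neutral_right) (auto simp: finite_permutations permutes_id)
  then show ?thesis by simp
qed

section \<open>Gaussians and translations\<close>

text \<open>
  Normalised so as to be its own Fourier transform.
\<close>

definition gauss :: "'a::euclidean_space \<Rightarrow> real" where
  "gauss x = exp (- pi * (norm x)\<^sup>2)"

lemma gauss_pos: "0 < gauss x" and gauss_le_one: "gauss x \<le> 1" and gauss_zero [simp]: "gauss 0 = 1"
  and gauss_minus [simp]: "gauss (- x) = gauss x"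
  by (simp_all add: gauss_def)

lemma borel_measurable_gauss [measurable]: "gauss \<in> borel_measurable borel"
  unfolding gauss_def[abs_def] by measurable

lemma gauss_mono: "norm x \<le> norm y \<Longrightarrow> gauss y \<le> gauss x"
  by (auto simp: gauss_def intro!: power_mono)

text \<open>
  This is the characteristic function of the standard normal distribution, rescaled by \<open>sqrt (2 * pi)\<close>.
\<close>

lemma gauss_fourier_real:
  "has_bochner_integral lborel (\<lambda>x::real. of_real (exp (- pi * x\<^sup>2)) * cis (2 * pi * x * t)) (of_real (exp (- pi * t\<^sup>2)))"
proof -
  define c where "c = sqrt (2 * pi)"
  have c: "c > 0" "c\<^sup>2 = 2 * pi" by (auto simp: c_def)
  define F where "F x = std_normal_density x *\<^sub>R iexp (c * t * x)" for x
  have F [measurable]: "F \<in> borel_measurable borel"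
    unfolding F_def[abs_def] std_normal_density_def
    by (intro borel_measurable_continuous_onI) (auto intro!: continuous_intros)
  have int: "integrable lborel F"
  proof (rule Bochner_Integration.integrable_bound)
    show "integrable lborel std_normal_density" by simp
  qed (auto simp: F_def)
  have "(\<integral>x. F x \<partial>lborel) = char std_normal_distribution (c * t)"
    unfolding char_def F_def by (subst integral_density) (auto simp: mult.assoc)
  also have "\<dots> = of_real (exp (- (c * t)\<^sup>2 / 2))"
    by (simp add: char_std_normal_distribution)
  also have "\<dots> = of_real (exp (- pi * t\<^sup>2))"
    by (simp add: power_mult_distrib c)
  finally have val: "(\<integral>x. F x \<partial>lborel) = of_real (exp (- pi * t\<^sup>2))" .
  have eq: "c *\<^sub>R F (0 + c * x) = of_real (exp (- pi * x\<^sup>2)) * cis (2 * pi * x * t)" for x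
  proof -
    have "c * std_normal_density (c * x) = exp (- pi * x\<^sup>2)"
      using c by (simp add: std_normal_density_def power_mult_distrib c_def[symmetric])
    moreover have "iexp (c * t * (c * x)) = cis (2 * pi * x * t)"
    proof -
      have "c * t * (c * x) = 2 * pi * x * t"
        using c by (simp add: power2_eq_square algebra_simps)
      then show ?thesis by (simp only: cis_conv_exp mult.commute)
    qed
    ultimately show ?thesis
      by (simp only: F_def add_0 scaleR_scaleR) (simp add: scaleR_conv_of_real)
  qed
  have "integrable lborel (\<lambda>x. c *\<^sub>R F (0 + c * x))"
    using c int by (intro integrable_scaleR_right lborel_integrable_real_affine) auto
  moreover have "(\<integral>x. c *\<^sub>R F (0 + c * x) \<partial>lborel) = (\<integral>x. F x \<partial>lborel)"
    using c by (subst lborel_integral_real_affine[of c F 0]) auto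
  ultimately show ?thesis
    unfolding eq val by (simp add: has_bochner_integral_iff)
qed

lemma has_bochner_integral_lborel_prod:
  fixes f :: "'a::euclidean_space \<Rightarrow> real \<Rightarrow> complex"
  assumes f: "\<And>b. b \<in> Basis \<Longrightarrow> has_bochner_integral lborel (f b) (c b)"
  shows "has_bochner_integral lborel (\<lambda>x. \<Prod>b\<in>Basis. f b (x \<bullet> b)) (\<Prod>b\<in>Basis. c b)"
proof -
  interpret product_sigma_finite "\<lambda>_::'a. lborel :: real measure" ..
  have fm: "f b \<in> borel_measurable borel" if "b \<in> Basis" for b
    using borel_measurable_has_bochner_integral[OF f[OF that]] by simp
  have "integrable (Pi\<^sub>M Basis (\<lambda>_. lborel)) (\<lambda>x. \<Prod>b\<in>Basis. f b (x b))"
    using f by (intro product_integrable_prod) (auto simp: has_bochner_integral_iff)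
  moreover have "(\<integral>x. (\<Prod>b\<in>Basis. f b (x b)) \<partial>Pi\<^sub>M Basis (\<lambda>_. lborel)) = (\<Prod>b\<in>Basis. c b)"
    using f by (subst product_integral_prod) (auto simp: has_bochner_integral_iff)
  moreover have "(\<Prod>b\<in>Basis. f b ((\<Sum>d\<in>Basis. x d *\<^sub>R d) \<bullet> b)) = (\<Prod>b\<in>Basis. f b (x b))" for x
    by (intro prod.cong) auto
  ultimately have "has_bochner_integral (Pi\<^sub>M Basis (\<lambda>_. lborel))
      (\<lambda>x. \<Prod>b\<in>Basis. f b ((\<Sum>d\<in>Basis. x d *\<^sub>R d) \<bullet> b)) (\<Prod>b\<in>Basis. c b)"
    by (simp add: has_bochner_integral_iff)
  note PiM = this
  have "(\<lambda>x. f b (x \<bullet> b)) \<in> borel_measurable borel" if "b \<in> Basis" for b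
    by (rule measurable_compose[OF _ fm[OF that]]) simp
  then have "(\<lambda>x. \<Prod>b\<in>Basis. f b (x \<bullet> b)) \<in> borel_measurable borel"
    by (intro borel_measurable_prod)
  moreover have "(\<lambda>f. \<Sum>b\<in>Basis. f b *\<^sub>R b) \<in> Pi\<^sub>M Basis (\<lambda>_. lborel) \<rightarrow>\<^sub>M (borel :: 'a measure)"
    by (intro borel_measurable_sum borel_measurable_scaleR) auto
  ultimately have "has_bochner_integral (distr (Pi\<^sub>M Basis (\<lambda>_. lborel)) borel (\<lambda>f. \<Sum>b\<in>Basis. f b *\<^sub>R b))
      (\<lambda>x. \<Prod>b\<in>Basis. f b (x \<bullet> b)) (\<Prod>b\<in>Basis. c b)"
    using PiM by (rule has_bochner_integral_distr)
  then show ?thesis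
    by (simp only: lborel_eq[symmetric])
qed

lemma gauss_fourier:
  "has_bochner_integral lborel (\<lambda>x::'a::euclidean_space. of_real (gauss x) * cis (2 * pi * (x \<bullet> t))) (of_real (gauss t))"
proof -
  have g: "of_real (gauss x) * cis (2 * pi * (x \<bullet> t))
      = (\<Prod>b\<in>Basis. of_real (exp (- pi * (x \<bullet> b)\<^sup>2)) * cis (2 * pi * (x \<bullet> b) * (t \<bullet> b)))" for x t :: 'a
  proof -
    have "of_real (gauss x) = (\<Prod>b\<in>Basis. complex_of_real (exp (- pi * (x \<bullet> b)\<^sup>2)))"
      unfolding gauss_def norm_eq_sqrt_inner
      by (subst euclidean_inner) (simp add: sum_nonneg power2_eq_square sum_distrib_left exp_sum sum_negf[symmetric] flip: of_real_prod)
    moreover have "cis (2 * pi * (x \<bullet> t)) = (\<Prod>b\<in>Basis. cis (2 * pi * (x \<bullet> b) * (t \<bullet> b)))"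
      by (subst euclidean_inner) (simp add: cis_conv_exp sum_distrib_left exp_sum[symmetric] mult.assoc)
    ultimately show ?thesis by (simp add: prod.distrib)
  qed
  have gt: "of_real (gauss t) = (\<Prod>b\<in>Basis. complex_of_real (exp (- pi * (t \<bullet> b)\<^sup>2)))"
    using g[of t 0] by simp
  show ?thesis
    unfolding g gt by (intro has_bochner_integral_lborel_prod gauss_fourier_real)
qed

lemma integrable_gauss: "integrable lborel (gauss :: 'a::euclidean_space \<Rightarrow> real)"
  and integral_gauss: "(\<integral>x. gauss (x::'a) \<partial>lborel) = 1"
proof -
  have "has_bochner_integral lborel (\<lambda>x::'a. complex_of_real (gauss x)) 1"
    using gauss_fourier[of "0::'a"] by simp
  then show "integrable lborel (gauss :: 'a \<Rightarrow> real)" "(\<integral>x. gauss (x::'a) \<partial>lborel) = 1"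
    by (simp_all add: has_bochner_integral_iff complex_of_real_integrable_eq)
qed

lemma has_bochner_integral_lborel_affine:
  fixes f :: "'a::euclidean_space \<Rightarrow> 'b::{banach, second_countable_topology}"
  assumes f: "has_bochner_integral lborel f i" and c: "c \<noteq> 0"
  shows "has_bochner_integral lborel (\<lambda>x. \<bar>c\<bar> ^ DIM('a) *\<^sub>R f (t + c *\<^sub>R x)) i"
proof -
  have [measurable]: "f \<in> borel_measurable borel"
    using borel_measurable_has_bochner_integral[OF f] by simp
  have "has_bochner_integral (density (distr lborel borel (\<lambda>x. t + c *\<^sub>R x)) (\<lambda>_. ennreal (\<bar>c\<bar> ^ DIM('a)))) f i"
    using f by (subst lborel_affine[OF c, of t, symmetric])
  then have "has_bochner_integral (distr lborel borel (\<lambda>x. t + c *\<^sub>R x)) (\<lambda>x. \<bar>c\<bar> ^ DIM('a) *\<^sub>R f x) i"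
    by (simp add: has_bochner_integral_iff integrable_density integral_density)
  then show ?thesis
    by (simp add: has_bochner_integral_iff integrable_distr_eq integral_distr)
qed

lemma integrable_translate:
  fixes f :: "'a::euclidean_space \<Rightarrow> 'b::{banach, second_countable_topology}"
  assumes "integrable lborel f"
  shows "integrable lborel (\<lambda>x. f (x + w))"
  using has_bochner_integral_lborel_affine[OF has_bochner_integral_integrable[OF assms], of 1 w]
  by (simp add: add.commute has_bochner_integral_iff)

lemma integral_translate:
  fixes f :: "'a::euclidean_space \<Rightarrow> 'b::{banach, second_countable_topology}"
  shows "(\<integral>x. f (x + w) \<partial>lborel) = (\<integral>x. f x \<partial>lborel)"
proof (cases "integrable lborel f")
  case True
  then show ?thesis
    using has_bochner_integral_lborel_affine[OF has_bochner_integral_integrable[OF True], of 1 w]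
    by (simp add: add.commute has_bochner_integral_iff)
next
  case False
  then have "\<not> integrable lborel (\<lambda>x. f (x + w))"
    using integrable_translate[of "\<lambda>x. f (x + w)" "- w"] by auto
  with False show ?thesis by (simp add: not_integrable_integral_eq)
qed

text \<open>
  Regularity encloses \<open>A\<close> between a compact set \<open>K\<close> and an open set \<open>U\<close> of nearly the same measure. A
  shift shorter than the distance from \<open>K\<close> to the complement of \<open>U\<close> changes the indicator of \<open>A\<close> at \<open>x\<close>
  only if \<open>x\<close> or its translate lies in \<open>U - K\<close>.
\<close>

lemma tendsto_integral_norm_translate_indicator:
  fixes A :: "'a::euclidean_space set"
  assumes A [measurable]: "A \<in> sets borel" and fin: "emeasure lborel A < \<infinity>"
  shows "((\<lambda>w. \<integral>x. \<bar>indicator A (x + w) - indicator A x\<bar> \<partial>lborel) \<longlongrightarrow> (0::real)) (at 0)"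
proof (rule tendstoI)
  fix \<epsilon> :: real assume "0 < \<epsilon>"
  define e where "e = \<epsilon> / 4"
  have e: "0 < e" using \<open>0 < \<epsilon>\<close> by (simp add: e_def)
  obtain U where U: "open U" "A \<subseteq> U" "emeasure lborel (U - A) < e"
    using outer_regular_lborel[OF A e] by blast
  obtain K where K: "compact K" "K \<subseteq> A" "emeasure lborel (A - K) < e"
  proof -
    define M where "M = density lborel (indicator A)"
    have M: "emeasure M B = emeasure lborel (A \<inter> B)" if "B \<in> sets borel" for B
      using that by (simp add: M_def emeasure_density Int_commute nn_integral_indicator indicator_inter_arith[symmetric])
    have "emeasure M (space M) \<noteq> \<infinity>"
      using fin M[of UNIV] by (simp add: M_def)
    then have sup: "emeasure M A = (SUP K\<in>{K. K \<subseteq> A \<and> compact K}. emeasure M K)"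
      by (intro inner_regular) (auto simp: M_def)
    have "emeasure M A < \<infinity>" using fin M[of A] by simp
    then have "\<exists>K\<in>{K. K \<subseteq> A \<and> compact K}. emeasure M A < emeasure M K + e"
      using e by (intro SUP_approx_ennreal[OF _ _ sup]) (auto intro!: exI[of _ "{}"])
    then obtain K where K: "K \<subseteq> A" "compact K" "emeasure M A < emeasure M K + e"
      by blast
    have [measurable]: "K \<in> sets borel" using K by (simp add: compact_imp_closed)
    have "A \<inter> K = K" using K by auto
    then have "emeasure lborel A < emeasure lborel K + e"
      using K M[of A] M[of K] by simp
    moreover have "emeasure lborel A = emeasure lborel K + emeasure lborel (A - K)"
      using K by (subst plus_emeasure) (auto simp: Un_absorb1)
    ultimately have "emeasure lborel (A - K) < e"
      by (metis add_left_mono not_less)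
    then show ?thesis using that K by blast
  qed
  have [measurable]: "K \<in> sets borel" "U \<in> sets borel" using K U by (auto simp: compact_imp_closed)
  have "K \<inter> - U = {}" using K U by auto
  moreover have "closed (- U)" using U by (simp add: closed_Compl)
  ultimately obtain d where d: "0 < d" "\<And>x y. x \<in> K \<Longrightarrow> y \<in> - U \<Longrightarrow> d \<le> dist x y"
    using separate_compact_closed[of K "- U"] K by blast
  have intUA: "integrable lborel (indicator (U - A) :: 'a \<Rightarrow> real)"
    and intAK: "integrable lborel (indicator (A - K) :: 'a \<Rightarrow> real)"
    using U K by (auto simp: integrable_indicator_iff less_top intro: less_trans)
  have mUA: "measure lborel (U - A) < e" and mAK: "measure lborel (A - K) < e"
    using less_trans[OF U(3) ennreal_less_top] less_trans[OF K(3) ennreal_less_top] U(3) K(3)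
    unfolding measure_def by simp_all
  have "\<bar>\<integral>x. \<bar>indicator A (x + w) - indicator A x\<bar> \<partial>lborel\<bar> < (\<epsilon>::real)" if w: "norm w < d" for w
  proof -
    have "(\<integral>x. \<bar>indicator A (x + w) - indicator A x :: real\<bar> \<partial>lborel)
        \<le> (\<integral>x. (indicator (A - K) (x + w) + indicator (U - A) (x + w)) + (indicator (A - K) x + indicator (U - A) x) \<partial>lborel)"
    proof (rule Bochner_Integration.integral_mono')
      show "integrable lborel (\<lambda>x. indicator (A - K) (x + w) + indicator (U - A) (x + w) + (indicator (A - K) x + indicator (U - A) x) :: real)"
        using intUA intAK by (intro Bochner_Integration.integrable_add integrable_translate)
      fix x
      have 1: "x \<in> U" if "x + w \<in> K"
        using d(2)[OF that, of x] w by (force simp: dist_norm)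
      have 2: "x + w \<in> U" if "x \<in> K"
        using d(2)[OF that, of "x + w"] w by (force simp: dist_norm)
      show "\<bar>indicator A (x + w) - indicator A x\<bar> \<le> indicator (A - K) (x + w) + indicator (U - A) (x + w) + (indicator (A - K) x + indicator (U - A) x :: real)"
        using 1 2 K(2) U(2) by (auto simp: indicator_def)
    qed auto
    also have "\<dots> = 2 * (measure lborel (A - K) + measure lborel (U - A))"
      using intUA intAK integrable_translate[OF intUA, of w] integrable_translate[OF intAK, of w]
      by (simp add: integral_translate[of "indicator (A - K)"] integral_translate[of "indicator (U - A)"])
    also have "\<dots> < \<epsilon>" using mUA mAK by (simp add: e_def)
    finally show ?thesis by simp
  qed
  then show "\<forall>\<^sub>F w in at 0. dist (\<integral>x. \<bar>indicator A (x + w) - indicator A x\<bar> \<partial>lborel) (0::real) < \<epsilon>"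
    unfolding eventually_at using d(1) by (intro exI[of _ d]) auto
qed

text \<open>
  Continuity of translation in the mean, from indicators by linearity and approximation.
\<close>

lemma tendsto_integral_norm_translate:
  fixes f :: "'a::euclidean_space \<Rightarrow> complex"
  assumes "integrable lborel f"
  shows "((\<lambda>w. \<integral>x. norm (f (x + w) - f x) \<partial>lborel) \<longlongrightarrow> 0) (at 0)"
  using assms
proof induction
  case (base A c)
  have "norm (indicator A (x + w) *\<^sub>R c - indicator A x *\<^sub>R c) = \<bar>indicator A (x + w) - indicator A x\<bar> * norm c" for x w
    by (simp add: scaleR_left_diff_distrib[symmetric])
  moreover have "((\<lambda>w. (\<integral>x. \<bar>indicator A (x + w) - indicator A x\<bar> \<partial>lborel) * norm c) \<longlongrightarrow> 0) (at 0)"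
    using base by (intro tendsto_mult_left_zero tendsto_integral_norm_translate_indicator) auto
  ultimately show ?case by simp
next
  case (add f g)
  have le: "(\<integral>x. norm ((f (x + w) + g (x + w)) - (f x + g x)) \<partial>lborel)
      \<le> (\<integral>x. norm (f (x + w) - f x) \<partial>lborel) + (\<integral>x. norm (g (x + w) - g x) \<partial>lborel)" for w
  proof -
    have i: "integrable lborel (\<lambda>x. norm (f (x + w) - f x))" "integrable lborel (\<lambda>x. norm (g (x + w) - g x))"
      using add.hyps by (auto intro!: integrable_norm Bochner_Integration.integrable_diff integrable_translate)
    show ?thesis
      unfolding Bochner_Integration.integral_add[OF i, symmetric]
    proof (rule Bochner_Integration.integral_mono')
      show "norm (f (x + w) + g (x + w) - (f x + g x)) \<le> norm (f (x + w) - f x) + norm (g (x + w) - g x)" for x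
        by (metis add_diff_add norm_triangle_ineq)
    qed (use i in auto)
  qed
  have lim: "((\<lambda>w. (\<integral>x. norm (f (x + w) - f x) \<partial>lborel) + (\<integral>x. norm (g (x + w) - g x) \<partial>lborel)) \<longlongrightarrow> 0) (at 0)"
    using tendsto_add[OF add.IH] by simp
  show ?case
    by (rule tendsto_sandwich[OF always_eventually always_eventually tendsto_const lim])
      (use le in \<open>simp_all add: integral_nonneg_AE\<close>)
next
  case (lim f s)
  have fm [measurable]: "f \<in> borel_measurable lborel" using lim by auto
  have sm [measurable]: "s i \<in> borel_measurable lborel" for i using lim by auto
  define D where "D i = (\<integral>x. norm (s i x - f x) \<partial>lborel)" for i
  have D: "D \<longlonglongrightarrow> 0"
  proof -
    have "D \<longlonglongrightarrow> (\<integral>x. 0 \<partial>(lborel :: 'a measure))"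
      unfolding D_def
    proof (rule integral_dominated_convergence[where w="\<lambda>x. 3 * norm (f x)"])
      show "AE x in lborel. (\<lambda>i. norm (s i x - f x)) \<longlonglongrightarrow> 0"
        using lim by (auto intro!: tendsto_norm_zero LIM_zero)
      show "AE x in lborel. norm (norm (s i x - f x)) \<le> 3 * norm (f x)" for i
      proof (intro AE_I2)
        fix x
        have "norm (s i x - f x) \<le> norm (s i x) + norm (f x)" by (rule norm_triangle_ineq4)
        then show "norm (norm (s i x - f x)) \<le> 3 * norm (f x)"
          using lim(3)[of x i] by simp
      qed
    qed (use lim in auto)
    then show ?thesis by simp
  qed
  show ?case
  proof (rule tendstoI)
    fix \<epsilon> :: real assume e: "0 < \<epsilon>"
    then have "\<forall>\<^sub>F i in sequentially. dist (D i) 0 < \<epsilon> / 3"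
      by (intro tendstoD[OF D]) auto
    then obtain i where "dist (D i) 0 < \<epsilon> / 3"
      using eventually_happens'[OF sequentially_bot] by blast
    then have i: "D i < \<epsilon> / 3" by (simp add: dist_real_def)
    have "\<forall>\<^sub>F w in at 0. dist (\<integral>x. norm (s i (x + w) - s i x) \<partial>lborel) 0 < \<epsilon> / 3"
      using e by (intro tendstoD[OF lim.IH]) auto
    then show "\<forall>\<^sub>F w in at 0. dist (\<integral>x. norm (f (x + w) - f x) \<partial>lborel) 0 < \<epsilon>"
    proof eventually_elim
      case (elim w)
      have i1: "integrable lborel (\<lambda>x. norm (s i x - f x))"
        using lim by auto
      have i2: "integrable lborel (\<lambda>x. norm (s i (x + w) - f (x + w)))"
        using integrable_translate[OF i1] by simp
      have i3: "integrable lborel (\<lambda>x. norm (s i (x + w) - s i x))"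
        using lim by (auto intro!: integrable_norm Bochner_Integration.integrable_diff integrable_translate)
      have "(\<integral>x. norm (f (x + w) - f x) \<partial>lborel)
          \<le> (\<integral>x. norm (s i (x + w) - f (x + w)) + norm (s i (x + w) - s i x) + norm (s i x - f x) \<partial>lborel)"
      proof (rule Bochner_Integration.integral_mono')
        show "norm (f (x + w) - f x) \<le> norm (s i (x + w) - f (x + w)) + norm (s i (x + w) - s i x) + norm (s i x - f x)" for x
          by norm
      qed (use i1 i2 i3 in auto)
      also have "\<dots> = D i + (\<integral>x. norm (s i (x + w) - s i x) \<partial>lborel) + D i"
        using i1 i2 i3 by (simp add: D_def integral_translate[of "\<lambda>x. norm (s i x - f x)"])
      finally show ?case using i elim by simp
    qed
  qed
qed

section \<open>The Fourier transform\<close>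

lemma borel_measurable_cis [measurable]: "cis \<in> borel_measurable borel"
  by (intro borel_measurable_continuous_onI continuous_intros)

lemma borel_measurable_cnj [measurable]: "cnj \<in> borel_measurable borel"
  by (intro borel_measurable_continuous_onI continuous_intros)

lemma integrable_affine:
  fixes f :: "'a::euclidean_space \<Rightarrow> 'b::{banach, second_countable_topology}"
  assumes "integrable lborel f" and c: "c \<noteq> 0"
  shows "integrable lborel (\<lambda>x. f (t + c *\<^sub>R x))"
proof -
  have "integrable lborel (\<lambda>x. \<bar>c\<bar> ^ DIM('a) *\<^sub>R f (t + c *\<^sub>R x))"
    using has_bochner_integral_lborel_affine[OF has_bochner_integral_integrable[OF assms(1)] c]
    by (simp add: has_bochner_integral_iff)
  then have "integrable lborel (\<lambda>x. (1 / \<bar>c\<bar> ^ DIM('a)) *\<^sub>R (\<bar>c\<bar> ^ DIM('a) *\<^sub>R f (t + c *\<^sub>R x)))"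
    by (rule integrable_scaleR_right)
  then show ?thesis using c by simp
qed

definition fourier :: "('a::euclidean_space \<Rightarrow> complex) \<Rightarrow> 'a \<Rightarrow> complex" where
  "fourier f \<xi> = (\<integral>x. f x * cis (- 2 * pi * (x \<bullet> \<xi>)) \<partial>lborel)"

lemma integrable_bounded_mult:
  fixes f g :: "'a \<Rightarrow> complex"
  assumes f: "integrable M f" and g [measurable]: "g \<in> borel_measurable M" and B: "\<And>x. norm (g x) \<le> B"
  shows "integrable M (\<lambda>x. g x * f x)" "integrable M (\<lambda>x. f x * g x)"
proof -
  have [measurable]: "f \<in> borel_measurable M" using f by auto
  show "integrable M (\<lambda>x. g x * f x)"
  proof (rule Bochner_Integration.integrable_bound)
    show "integrable M (\<lambda>x. B * norm (f x))" using f by auto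
    show "AE x in M. norm (g x * f x) \<le> norm (B * norm (f x))"
    proof (intro AE_I2)
      fix x
      have "norm (g x * f x) \<le> B * norm (f x)"
        by (simp add: norm_mult B mult_right_mono)
      then show "norm (g x * f x) \<le> norm (B * norm (f x))" by simp
    qed
  qed measurable
  then show "integrable M (\<lambda>x. f x * g x)" by (simp add: mult.commute)
qed

lemma integrable_mult_cis:
  assumes "integrable lborel f"
  shows "integrable lborel (\<lambda>x. f x * cis (c * (x \<bullet> \<xi>)))"
  using assms by (intro integrable_bounded_mult[where B=1]) (auto simp: )

lemma fourier_measurable [measurable]:
  assumes [measurable]: "f \<in> borel_measurable borel"
  shows "fourier f \<in> borel_measurable borel"
  unfolding fourier_def[abs_def] by measurable

lemma norm_fourier_le: "norm (fourier f \<xi>) \<le> (\<integral>x. norm (f x) \<partial>lborel)"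
proof -
  have "norm (fourier f \<xi>) \<le> (\<integral>x. norm (f x * cis (- 2 * pi * (x \<bullet> \<xi>))) \<partial>lborel)"
    unfolding fourier_def by (rule integral_norm_bound)
  then show ?thesis by (simp add: norm_mult)
qed

text \<open>
  The multiplication formula. The frequency scale \<open>c\<close> is left free because both signs of the exponent
  occur, in the Fourier transform and in its inverse.
\<close>

lemma integral_kernel_commute:
  fixes u v :: "'a::euclidean_space \<Rightarrow> complex"
  assumes u: "integrable lborel u" and v: "integrable lborel v"
  shows "(\<integral>\<xi>. v \<xi> * (\<integral>y. u y * cis (c * (y \<bullet> \<xi>)) \<partial>lborel) \<partial>lborel)
    = (\<integral>y. u y * (\<integral>\<xi>. v \<xi> * cis (c * (y \<bullet> \<xi>)) \<partial>lborel) \<partial>lborel)"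
proof -
  have [measurable]: "u \<in> borel_measurable borel" "v \<in> borel_measurable borel" using u v by auto
  define F where "F y \<xi> = v \<xi> * (u y * cis (c * (y \<bullet> \<xi>)))" for y \<xi>
  have "integrable (lborel \<Otimes>\<^sub>M lborel) (case_prod F)"
  proof (rule lborel_pair.Fubini_integrable)
    show "case_prod F \<in> borel_measurable (lborel \<Otimes>\<^sub>M lborel)"
      unfolding F_def by measurable
    have "(\<integral>\<xi>. norm (case (y, \<xi>) of (y, \<xi>) \<Rightarrow> F y \<xi>) \<partial>lborel) = (\<integral>\<xi>. norm (v \<xi>) \<partial>lborel) * norm (u y)" for y
      using v by (simp add: F_def norm_mult)
    then show "integrable lborel (\<lambda>y. \<integral>\<xi>. norm (case (y, \<xi>) of (y, \<xi>) \<Rightarrow> F y \<xi>) \<partial>lborel)"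
      using u by simp
    have "integrable lborel (\<lambda>\<xi>. v \<xi> * (u y * cis (c * (y \<bullet> \<xi>))))" for y
      using v by (intro integrable_bounded_mult[where B="norm (u y)"]) (auto simp: norm_mult)
    then show "AE y in lborel. integrable lborel (\<lambda>\<xi>. case (y, \<xi>) of (y, \<xi>) \<Rightarrow> F y \<xi>)"
      by (simp add: F_def)
  qed
  then have "(\<integral>\<xi>. (\<integral>y. F y \<xi> \<partial>lborel) \<partial>lborel) = (\<integral>y. (\<integral>\<xi>. F y \<xi> \<partial>lborel) \<partial>lborel)"
    by (rule lborel_pair.Fubini_integral)
  moreover have "(\<integral>y. F y \<xi> \<partial>lborel) = v \<xi> * (\<integral>y. u y * cis (c * (y \<bullet> \<xi>)) \<partial>lborel)" for \<xi>
    by (simp add: F_def)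
  moreover have "(\<integral>\<xi>. F y \<xi> \<partial>lborel) = u y * (\<integral>\<xi>. v \<xi> * cis (c * (y \<bullet> \<xi>)) \<partial>lborel)" for y
    by (simp add: F_def mult.left_commute[of _ "u y"] flip: integral_mult_right_zero)
  ultimately show ?thesis by simp
qed

text \<open>
  Convolution with a Gaussian of width \<open>1 / k\<close>. Writing it as an average of translates makes continuity
  of translation applicable.
\<close>

definition smooth :: "real \<Rightarrow> ('a::euclidean_space \<Rightarrow> complex) \<Rightarrow> 'a \<Rightarrow> complex" where
  "smooth k f y = (\<integral>z. of_real (gauss z) * f (y + z /\<^sub>R k) \<partial>lborel)"

lemma integrable_gauss_scaled:
  assumes "k > 0"
  shows "integrable lborel (\<lambda>\<xi>::'a::euclidean_space. complex_of_real (gauss (\<xi> /\<^sub>R k)))"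
proof -
  have "integrable lborel (\<lambda>x::'a. complex_of_real (gauss x))"
    using integrable_gauss[where 'a='a] by (simp add: complex_of_real_integrable_eq)
  from integrable_affine[OF this, of "1/k" 0] assms show ?thesis
    by (simp add: divide_inverse_commute)
qed

text \<open>
  Fourier inversion with a Gaussian cut-off: the cut-off on the frequency side turns into its own
  Fourier transform, which is the kernel of the smoothing.
\<close>

lemma fourier_smooth_inversion:
  fixes f :: "'a::euclidean_space \<Rightarrow> complex"
  assumes f: "integrable lborel f" and k: "k > 0"
  shows "(\<integral>\<xi>. fourier f \<xi> * of_real (gauss (\<xi> /\<^sub>R k)) * cis (2 * pi * (y \<bullet> \<xi>)) \<partial>lborel) = smooth k f y"
proof -
  have [measurable]: "f \<in> borel_measurable borel" using f by auto
  define v where "v \<xi> = of_real (gauss (\<xi> /\<^sub>R k)) * cis (2 * pi * (y \<bullet> \<xi>))" for \<xi>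
  have v: "integrable lborel v"
    unfolding v_def using integrable_gauss_scaled[OF k]
    by (intro integrable_bounded_mult[where B=1]) auto
  have inner: "(\<integral>\<xi>. v \<xi> * cis (- 2 * pi * (x \<bullet> \<xi>)) \<partial>lborel) = of_real (k ^ DIM('a) * gauss (k *\<^sub>R (x - y)))" for x
  proof -
    have eq: "complex_of_real (gauss (\<xi> /\<^sub>R k)) * cis (2 * pi * ((\<xi> /\<^sub>R k) \<bullet> (k *\<^sub>R (y - x)))) = v \<xi> * cis (- 2 * pi * (x \<bullet> \<xi>))" for \<xi>
    proof -
      have "2 * pi * ((\<xi> /\<^sub>R k) \<bullet> (k *\<^sub>R (y - x))) = 2 * pi * (y \<bullet> \<xi>) + - 2 * pi * (x \<bullet> \<xi>)"
      proof -
        have *: "(\<xi> /\<^sub>R k) \<bullet> (k *\<^sub>R (y - x)) = \<xi> \<bullet> (y - x)" using k by simp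
        show ?thesis unfolding * by (simp add: inner_diff_right inner_commute algebra_simps)
      qed
      then show ?thesis by (simp only: v_def mult.assoc cis_mult)
    qed
    have "has_bochner_integral lborel (\<lambda>\<xi>. \<bar>1/k\<bar> ^ DIM('a) *\<^sub>R (v \<xi> * cis (- 2 * pi * (x \<bullet> \<xi>)))) (of_real (gauss (k *\<^sub>R (y - x))))"
    proof -
      have *: "0 + (1/k) *\<^sub>R \<xi> = \<xi> /\<^sub>R k" for \<xi> :: 'a by (simp add: divide_inverse)
      have "1 / k \<noteq> 0" using k by simp
      from has_bochner_integral_lborel_affine[OF gauss_fourier[of "k *\<^sub>R (y - x)"] this, of 0]
      show ?thesis unfolding * eq .
    qed
    then have "k ^ DIM('a) *\<^sub>R (\<integral>\<xi>. \<bar>1/k\<bar> ^ DIM('a) *\<^sub>R (v \<xi> * cis (- 2 * pi * (x \<bullet> \<xi>))) \<partial>lborel) = k ^ DIM('a) *\<^sub>R of_real (gauss (k *\<^sub>R (y - x)))"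
      by (simp add: has_bochner_integral_iff)
    moreover have "gauss (k *\<^sub>R (y - x)) = gauss (k *\<^sub>R (x - y))"
      by (simp add: gauss_def norm_minus_commute)
    ultimately show ?thesis using k by (simp add: power_divide scaleR_conv_of_real)
  qed
  define F where "F x = f x * of_real (k ^ DIM('a) * gauss (k *\<^sub>R (x - y)))" for x
  have F: "integrable lborel F"
    unfolding F_def using k
    by (intro integrable_bounded_mult(2)[OF f, where B="k ^ DIM('a)"])
       (auto simp: norm_mult norm_power gauss_le_one less_imp_le[OF gauss_pos] intro!: mult_left_le)
  have "(\<integral>\<xi>. fourier f \<xi> * of_real (gauss (\<xi> /\<^sub>R k)) * cis (2 * pi * (y \<bullet> \<xi>)) \<partial>lborel)
      = (\<integral>\<xi>. v \<xi> * (\<integral>x. f x * cis (- 2 * pi * (x \<bullet> \<xi>)) \<partial>lborel) \<partial>lborel)"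
    by (simp add: v_def fourier_def mult_ac)
  also have "\<dots> = (\<integral>x. F x \<partial>lborel)"
    unfolding integral_kernel_commute[OF f v] inner F_def ..
  also have "\<dots> = (\<integral>z. \<bar>1/k\<bar> ^ DIM('a) *\<^sub>R F (y + (1/k) *\<^sub>R z) \<partial>lborel)"
    using has_bochner_integral_lborel_affine[OF has_bochner_integral_integrable[OF F], of "1/k" y] k
    by (simp add: has_bochner_integral_iff)
  also have "\<dots> = smooth k f y"
    unfolding smooth_def
  proof (rule Bochner_Integration.integral_cong)
    fix z :: 'a
    have "k *\<^sub>R (y + (1 / k) *\<^sub>R z - y) = z" using k by simp
    then show "\<bar>1/k\<bar> ^ DIM('a) *\<^sub>R F (y + (1/k) *\<^sub>R z) = of_real (gauss z) * f (y + z /\<^sub>R k)"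
      using k by (simp add: F_def power_divide scaleR_conv_of_real divide_inverse_commute flip: power_mult_distrib)
  qed simp
  finally show ?thesis .
qed

lemma tendsto_integral_gauss_scaled:
  fixes C :: "'a::euclidean_space \<Rightarrow> complex"
  assumes [measurable]: "C \<in> borel_measurable borel" and B: "\<And>w. norm (C w) \<le> B" and C: "C \<midarrow>0\<rightarrow> C 0"
  shows "(\<lambda>k. \<integral>z. of_real (gauss z) * C (z /\<^sub>R real (Suc k)) \<partial>lborel) \<longlonglongrightarrow> C 0"
proof -
  have lim: "(\<lambda>k. C (z /\<^sub>R real (Suc k))) \<longlonglongrightarrow> C 0" for z
  proof -
    have "(\<lambda>k. inverse (real (Suc k)) *\<^sub>R z) \<longlonglongrightarrow> 0 *\<^sub>R z"
      by (intro tendsto_scaleR LIMSEQ_inverse_real_of_nat tendsto_const)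
    moreover have "isCont C 0" using C by (simp add: isCont_def)
    ultimately show ?thesis
      using isCont_tendsto_compose[of 0 C "\<lambda>k. inverse (real (Suc k)) *\<^sub>R z"] by simp
  qed
  have "(\<lambda>k. \<integral>z. of_real (gauss z) * C (z /\<^sub>R real (Suc k)) \<partial>lborel) \<longlonglongrightarrow> (\<integral>z. of_real (gauss z) * C 0 \<partial>(lborel :: 'a measure))"
  proof (rule integral_dominated_convergence[where w="\<lambda>z. gauss z * B"])
    show "integrable lborel (\<lambda>z::'a. gauss z * B)" using integrable_gauss[where 'a='a] by simp
    show "AE z in lborel. (\<lambda>k. of_real (gauss z) * C (z /\<^sub>R real (Suc k))) \<longlonglongrightarrow> of_real (gauss z) * C 0"
      by (intro AE_I2 tendsto_mult tendsto_const lim)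
    show "AE z in lborel. norm (of_real (gauss z) * C (z /\<^sub>R real (Suc k))) \<le> gauss z * B" for k
      by (intro AE_I2) (simp add: norm_mult B mult_left_mono less_imp_le[OF gauss_pos])
  qed measurable
  moreover have "(\<integral>z. of_real (gauss z) * C 0 \<partial>(lborel :: 'a measure)) = C 0"
    using integral_gauss[where 'a='a] by simp
  ultimately show ?thesis by (simp only:)
qed

text \<open>
  Fubini turns the left side into a Gaussian average of the correlation of \<open>\<psi>\<close> and \<open>f\<close>, and continuity
  of translation makes this correlation continuous at \<open>0\<close>. Convergence against bounded test functions
  is enough for both applications: \<open>\<psi>\<close> is the conjugate phase of \<open>f\<close> when uniqueness is proved and the
  conjugate of a second function in the Parseval identity.
\<close>

lemma tendsto_integral_smooth:
  fixes f \<psi> :: "'a::euclidean_space \<Rightarrow> complex"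
  assumes f: "integrable lborel f" and \<psi> [measurable]: "\<psi> \<in> borel_measurable borel" and B: "\<And>x. norm (\<psi> x) \<le> B"
  shows "(\<lambda>k. \<integral>y. \<psi> y * smooth (real (Suc k)) f y \<partial>lborel) \<longlonglongrightarrow> (\<integral>y. \<psi> y * f y \<partial>lborel)"
proof -
  have [measurable]: "f \<in> borel_measurable borel" using f by auto
  define C where "C w = (\<integral>y. \<psi> y * f (y + w) \<partial>lborel)" for w
  have int: "integrable lborel (\<lambda>y. \<psi> y * f (y + w))" for w
    using integrable_translate[OF f, of w] B by (intro integrable_bounded_mult) auto
  have B0: "0 \<le> B" using B[of 0] norm_ge_zero order_trans by blast
  have bound: "norm (C w) \<le> B * (\<integral>y. norm (f y) \<partial>lborel)" for w
  proof -
    have "norm (C w) \<le> (\<integral>y. B * norm (f (y + w)) \<partial>lborel)"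
      unfolding C_def
    proof (rule order_trans[OF integral_norm_bound Bochner_Integration.integral_mono'])
      show "integrable lborel (\<lambda>y. B * norm (f (y + w)))" using integrable_translate[OF f] by simp
    qed (auto simp: norm_mult B mult_right_mono B0)
    then show ?thesis using integral_translate[of "\<lambda>y. norm (f y)" w] by simp
  qed
  have cont: "C \<midarrow>0\<rightarrow> C 0"
  proof (rule LIM_zero_cancel, rule Lim_null_comparison)
    show "\<forall>\<^sub>F w in at 0. norm (C w - C 0) \<le> B * (\<integral>y. norm (f (y + w) - f y) \<partial>lborel)"
    proof (intro always_eventually allI)
      fix w
      have i: "integrable lborel (\<lambda>y. f (y + w) - f y)"
        using integrable_translate[OF f] f by (rule Bochner_Integration.integrable_diff)
      have "C w - C 0 = (\<integral>y. \<psi> y * (f (y + w) - f y) \<partial>lborel)"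
        unfolding C_def using int[of w] int[of 0]
        by (simp add: right_diff_distrib Bochner_Integration.integral_diff)
      also have "norm \<dots> \<le> (\<integral>y. B * norm (f (y + w) - f y) \<partial>lborel)"
      proof (rule order_trans[OF integral_norm_bound Bochner_Integration.integral_mono'])
        show "integrable lborel (\<lambda>y. B * norm (f (y + w) - f y))" using i by simp
      qed (auto simp: norm_mult B mult_right_mono B0)
      finally show "norm (C w - C 0) \<le> B * (\<integral>y. norm (f (y + w) - f y) \<partial>lborel)" by simp
    qed
    show "((\<lambda>w. B * (\<integral>y. norm (f (y + w) - f y) \<partial>lborel)) \<longlongrightarrow> 0) (at 0)"
      by (intro tendsto_mult_right_zero tendsto_integral_norm_translate f)
  qed
  have Cm: "C \<in> borel_measurable borel" unfolding C_def[abs_def] by measurable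
  have fub: "(\<integral>y. \<psi> y * smooth k f y \<partial>lborel) = (\<integral>z. of_real (gauss z) * C (z /\<^sub>R k) \<partial>lborel)" for k
  proof -
    define F where "F z y = complex_of_real (gauss z) * (\<psi> y * f (y + z /\<^sub>R k))" for z y
    have "integrable (lborel \<Otimes>\<^sub>M lborel) (case_prod F)"
    proof (rule lborel_pair.Fubini_integrable)
      show meas: "case_prod F \<in> borel_measurable (lborel \<Otimes>\<^sub>M lborel)"
        unfolding F_def by measurable
      show "AE z in lborel. integrable lborel (\<lambda>y. case (z, y) of (z, y) \<Rightarrow> F z y)"
        using int by (simp add: F_def)
      have "(\<integral>y. norm (F z y) \<partial>lborel) \<le> gauss z * (B * (\<integral>y. norm (f y) \<partial>lborel))" for z
      proof -
        have "(\<integral>y. norm (F z y) \<partial>lborel) \<le> (\<integral>y. gauss z * (B * norm (f (y + z /\<^sub>R k))) \<partial>lborel)"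
        proof (rule Bochner_Integration.integral_mono')
          show "integrable lborel (\<lambda>y. gauss z * (B * norm (f (y + z /\<^sub>R k))))"
            using integrable_translate[OF f] by simp
          show "norm (F z y) \<le> gauss z * (B * norm (f (y + z /\<^sub>R k)))" for y
            unfolding F_def norm_mult norm_of_real abs_of_pos[OF gauss_pos]
            by (intro mult_left_mono mult_right_mono B) (auto simp: less_imp_le[OF gauss_pos])
        qed (auto simp: B0 less_imp_le[OF gauss_pos])
        then show ?thesis using integral_translate[of "\<lambda>y. norm (f y)" "z /\<^sub>R k"] by simp
      qed
      note le = this
      have "integrable lborel (\<lambda>z. \<integral>y. norm (F z y) \<partial>lborel)"
      proof (rule Bochner_Integration.integrable_bound)
        show "integrable lborel (\<lambda>z::'a. gauss z * (B * (\<integral>y. norm (f y) \<partial>lborel)))"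
          by (rule integrable_mult_left) (rule integrable_gauss)
        show "(\<lambda>z. \<integral>y. norm (F z y) \<partial>lborel) \<in> borel_measurable lborel"
          unfolding F_def by measurable
        show "AE z in lborel. norm (\<integral>y. norm (F z y) \<partial>lborel) \<le> norm (gauss z * (B * (\<integral>y. norm (f y) \<partial>lborel)))"
        proof (rule AE_I2)
          fix z
          have "0 \<le> (\<integral>y. norm (F z y) \<partial>lborel)" by (rule integral_nonneg_AE) simp
          with le[of z] show "norm (\<integral>y. norm (F z y) \<partial>lborel) \<le> norm (gauss z * (B * (\<integral>y. norm (f y) \<partial>lborel)))"
            unfolding real_norm_def by linarith
        qed
      qed
      then show "integrable lborel (\<lambda>z. \<integral>y. norm (case (z, y) of (z, y) \<Rightarrow> F z y) \<partial>lborel)" by simp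
    qed
    then have "(\<integral>y. (\<integral>z. F z y \<partial>lborel) \<partial>lborel) = (\<integral>z. (\<integral>y. F z y \<partial>lborel) \<partial>lborel)"
      by (rule lborel_pair.Fubini_integral)
    moreover have "(\<integral>z. F z y \<partial>lborel) = \<psi> y * smooth k f y" for y
      by (simp add: F_def smooth_def mult.left_commute[of _ "\<psi> y"] flip: integral_mult_right_zero)
    ultimately show ?thesis by (simp add: F_def C_def)
  qed
  show ?thesis
    unfolding fub using tendsto_integral_gauss_scaled[OF Cm bound cont] by (simp add: C_def)
qed

theorem fourier_eq_zero_imp_AE:
  fixes w :: "'a::euclidean_space \<Rightarrow> complex"
  assumes w: "integrable lborel w" and zero: "\<And>\<xi>. fourier w \<xi> = 0"
  shows "AE x in lborel. w x = 0"
proof -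
  have [measurable]: "w \<in> borel_measurable borel" using w by auto
  define \<psi> where "\<psi> x = cnj (sgn (w x))" for x
  have [measurable]: "\<psi> \<in> borel_measurable borel"
    unfolding \<psi>_def[abs_def] sgn_div_norm by measurable
  have "smooth (real (Suc k)) w y = 0" for k y
    using fourier_smooth_inversion[OF w, of "real (Suc k)" y] by (simp add: zero)
  then have "(\<lambda>k. 0) \<longlonglongrightarrow> (\<integral>y. \<psi> y * w y \<partial>lborel)"
    using tendsto_integral_smooth[OF w, of \<psi> 1] by (simp add: \<psi>_def norm_sgn)
  then have "(\<integral>y. \<psi> y * w y \<partial>lborel) = 0"
    using LIMSEQ_unique tendsto_const by blast
  moreover have "\<psi> y * w y = of_real (norm (w y))" for y
  proof -
    have "\<psi> y * w y = (w y * cnj (w y)) /\<^sub>R norm (w y)"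
      by (simp add: \<psi>_def sgn_div_norm mult.commute)
    then show ?thesis
      by (cases "w y = 0") (simp_all add: complex_norm_square[symmetric] scaleR_conv_of_real power2_eq_square)
  qed
  ultimately have "(\<integral>y. norm (w y) \<partial>lborel) = 0" by simp
  then show ?thesis
    using w by (subst (asm) integral_nonneg_eq_0_iff_AE) auto
qed

text \<open>
  A dense class of square-integrable functions for which the Fourier integral converges; boundedness
  makes them admissible as test functions in \<open>tendsto_integral_smooth\<close>.
\<close>

definition bounded_integrable :: "('a::euclidean_space \<Rightarrow> complex) \<Rightarrow> bool" where
  "bounded_integrable f \<longleftrightarrow> integrable lborel f \<and> bounded (range f)"

text \<open>
  Parseval's identity with a Gaussian cut-off, from the multiplication formula and inversion.
\<close>

lemma tendsto_fourier_product:
  fixes f g :: "'a::euclidean_space \<Rightarrow> complex"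
  assumes f: "integrable lborel f" and g: "bounded_integrable g"
  shows "(\<lambda>k. \<integral>\<xi>. fourier f \<xi> * cnj (fourier g \<xi>) * of_real (gauss (\<xi> /\<^sub>R real (Suc k))) \<partial>lborel)
    \<longlonglongrightarrow> (\<integral>x. f x * cnj (g x) \<partial>lborel)"
proof -
  have gi: "integrable lborel g" using g by (simp add: bounded_integrable_def)
  have [measurable]: "f \<in> borel_measurable borel" "g \<in> borel_measurable borel" using f gi by auto
  obtain B where B: "\<And>x. norm (g x) \<le> B"
    using g by (auto simp: bounded_integrable_def bounded_iff)
  have cg: "integrable lborel (\<lambda>x. cnj (g x))" using gi by simp
  have eq: "(\<integral>\<xi>. fourier f \<xi> * cnj (fourier g \<xi>) * of_real (gauss (\<xi> /\<^sub>R k)) \<partial>lborel)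
      = (\<integral>y. cnj (g y) * smooth k f y \<partial>lborel)" if k: "k > 0" for k
  proof -
    define v where "v \<xi> = fourier f \<xi> * of_real (gauss (\<xi> /\<^sub>R k))" for \<xi>
    have v: "integrable lborel v"
      unfolding v_def using integrable_gauss_scaled[OF k] norm_fourier_le
      by (intro integrable_bounded_mult) auto
    have cf: "cnj (fourier g \<xi>) = (\<integral>y. cnj (g y) * cis (2 * pi * (y \<bullet> \<xi>)) \<partial>lborel)" for \<xi>
      unfolding fourier_def by (simp add: cis_cnj flip: Bochner_Integration.integral_cnj)
    have "(\<integral>\<xi>. fourier f \<xi> * cnj (fourier g \<xi>) * of_real (gauss (\<xi> /\<^sub>R k)) \<partial>lborel)
        = (\<integral>\<xi>. v \<xi> * (\<integral>y. cnj (g y) * cis (2 * pi * (y \<bullet> \<xi>)) \<partial>lborel) \<partial>lborel)"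
      by (simp add: v_def cf mult_ac)
    also have "\<dots> = (\<integral>y. cnj (g y) * (\<integral>\<xi>. v \<xi> * cis (2 * pi * (y \<bullet> \<xi>)) \<partial>lborel) \<partial>lborel)"
      by (rule integral_kernel_commute[OF cg v])
    finally show ?thesis
      unfolding v_def fourier_smooth_inversion[OF f k] .
  qed
  have *: "(\<integral>x. f x * cnj (g x) \<partial>lborel) = (\<integral>x. cnj (g x) * f x \<partial>lborel)"
    by (simp only: mult.commute)
  show ?thesis
    unfolding eq[OF of_nat_0_less_iff[THEN iffD2, OF zero_less_Suc]] *
    by (rule tendsto_integral_smooth[OF f, where B=B]) (auto simp: B)
qed

text \<open>
  For \<open>g = f\<close> the integrands in \<open>tendsto_fourier_product\<close> increase to the square of the Fourier
  transform, so monotone convergence removes the cut-off.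
\<close>

theorem plancherel_bounded:
  fixes f :: "'a::euclidean_space \<Rightarrow> complex"
  assumes f: "bounded_integrable f"
  shows "integrable lborel (\<lambda>\<xi>. (norm (fourier f \<xi>))\<^sup>2)"
    and "(\<integral>\<xi>. (norm (fourier f \<xi>))\<^sup>2 \<partial>lborel) = (\<integral>x. (norm (f x))\<^sup>2 \<partial>lborel)"
proof -
  have fi: "integrable lborel f" using f by (simp add: bounded_integrable_def)
  have [measurable]: "f \<in> borel_measurable borel" using fi by auto
  define h where "h k \<xi> = (norm (fourier f \<xi>))\<^sup>2 * gauss (\<xi> /\<^sub>R real (Suc k))" for k \<xi>
  have hc: "fourier f \<xi> * cnj (fourier f \<xi>) * of_real (gauss (\<xi> /\<^sub>R real (Suc k))) = of_real (h k \<xi>)" for k \<xi>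
    by (simp add: h_def complex_norm_square[symmetric])
  have "(\<lambda>k. of_real (\<integral>\<xi>. h k \<xi> \<partial>lborel)) \<longlonglongrightarrow> complex_of_real (\<integral>x. (norm (f x))\<^sup>2 \<partial>lborel)"
    using tendsto_fourier_product[OF fi f, unfolded hc]
    by (simp only: complex_norm_square[symmetric] integral_complex_of_real)
  then have lim: "(\<lambda>k. \<integral>\<xi>. h k \<xi> \<partial>lborel) \<longlonglongrightarrow> (\<integral>x. (norm (f x))\<^sup>2 \<partial>lborel)"
    by (simp only: tendsto_of_real_iff)
  have hi: "integrable lborel (h k)" for k
  proof -
    have "integrable lborel (\<lambda>\<xi>. (fourier f \<xi> * cnj (fourier f \<xi>)) * complex_of_real (gauss (\<xi> /\<^sub>R real (Suc k))))"
    proof (rule integrable_bounded_mult(1)[OF integrable_gauss_scaled])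
      show "norm (fourier f \<xi> * cnj (fourier f \<xi>)) \<le> (\<integral>x. norm (f x) \<partial>lborel) * (\<integral>x. norm (f x) \<partial>lborel)" for \<xi>
        unfolding norm_mult complex_mod_cnj by (intro mult_mono norm_fourier_le) auto
    qed auto
    then show ?thesis by (simp only: hc complex_of_real_integrable_eq)
  qed
  have mono: "mono (\<lambda>k. h k \<xi>)" for \<xi>
  proof (intro monoI)
    fix m n :: nat assume "m \<le> n"
    then have "norm (\<xi> /\<^sub>R real (Suc n)) \<le> norm (\<xi> /\<^sub>R real (Suc m))"
      by (simp add: mult_right_mono le_imp_inverse_le)
    then show "h m \<xi> \<le> h n \<xi>"
      unfolding h_def by (intro mult_left_mono gauss_mono) auto
  qed
  have hl: "(\<lambda>k. h k \<xi>) \<longlonglongrightarrow> (norm (fourier f \<xi>))\<^sup>2" for \<xi>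
  proof -
    have sc: "(\<lambda>k. inverse (real (Suc k)) *\<^sub>R \<xi>) \<longlonglongrightarrow> 0 *\<^sub>R \<xi>"
      by (intro tendsto_scaleR LIMSEQ_inverse_real_of_nat tendsto_const)
    have "(\<lambda>k. (norm (fourier f \<xi>))\<^sup>2 * exp (- pi * (norm (inverse (real (Suc k)) *\<^sub>R \<xi>))\<^sup>2)) \<longlonglongrightarrow> (norm (fourier f \<xi>))\<^sup>2 * exp (- pi * (norm (0 *\<^sub>R \<xi>))\<^sup>2)"
      by (intro tendsto_mult tendsto_exp tendsto_power tendsto_norm tendsto_const sc)
    then show ?thesis by (simp add: h_def gauss_def)
  qed
  show "integrable lborel (\<lambda>\<xi>. (norm (fourier f \<xi>))\<^sup>2)"
    and "(\<integral>\<xi>. (norm (fourier f \<xi>))\<^sup>2 \<partial>lborel) = (\<integral>x. (norm (f x))\<^sup>2 \<partial>lborel)"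
    using integrable_monotone_convergence[OF hi AE_I2[OF mono] AE_I2[OF hl] lim]
      integral_monotone_convergence[OF hi AE_I2[OF mono] AE_I2[OF hl] lim] by simp_all
qed

section \<open>Square-integrable functions\<close>

lemma L2_measurable: "f \<in> L2 \<Longrightarrow> f \<in> borel_measurable borel"
  by (simp add: L2_def)

lemma L2_integrable: "f \<in> L2 \<Longrightarrow> integrable lborel (\<lambda>x. (norm (f x))\<^sup>2)"
  by (simp add: L2_def)

lemma L2I: "f \<in> borel_measurable borel \<Longrightarrow> integrable lborel (\<lambda>x. (norm (f x))\<^sup>2) \<Longrightarrow> f \<in> L2"
  by (simp add: L2_def)

lemma L2_bound:
  assumes g: "integrable lborel g" and f: "f \<in> borel_measurable borel" and le: "\<And>x. (norm (f x))\<^sup>2 \<le> g x"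
  shows "f \<in> L2"
proof (rule L2I[OF f], rule Bochner_Integration.integrable_bound[OF g])
  show "AE x in lborel. norm ((norm (f x))\<^sup>2) \<le> norm (g x)"
    using le by (intro AE_I2) (simp add: abs_if, meson le order_trans zero_le_power2 not_less)
qed (use f in measurable)

lemma norm_add_squared_le: "(norm (a + b))\<^sup>2 \<le> 2 * (norm a)\<^sup>2 + 2 * (norm b)\<^sup>2"
  for a b :: "'a::real_normed_vector"
proof -
  have "(norm (a + b))\<^sup>2 \<le> (norm a + norm b)\<^sup>2"
    by (intro power_mono norm_triangle_ineq) auto
  also have "\<dots> \<le> 2 * (norm a)\<^sup>2 + 2 * (norm b)\<^sup>2"
    using sum_squares_bound[of "norm a" "norm b"] by (simp add: power2_sum)
  finally show ?thesis .
qed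

lemma L2_add:
  assumes "f \<in> L2" "g \<in> L2"
  shows "(\<lambda>x. f x + g x) \<in> L2"
proof (rule L2_bound)
  show "integrable lborel (\<lambda>x. 2 * (norm (f x))\<^sup>2 + 2 * (norm (g x))\<^sup>2)"
    using assms by (intro Bochner_Integration.integrable_add integrable_mult_right) (auto simp: L2_integrable)
  show "(\<lambda>x. f x + g x) \<in> borel_measurable borel"
    using assms by (intro borel_measurable_add L2_measurable)
qed (rule norm_add_squared_le)

lemma L2_scale:
  assumes "f \<in> L2"
  shows "(\<lambda>x. c * f x) \<in> L2"
proof (rule L2I)
  show "integrable lborel (\<lambda>x. (norm (c * f x))\<^sup>2)"
    unfolding norm_mult power_mult_distrib using L2_integrable[OF assms] by (intro integrable_mult_right)
qed (use L2_measurable[OF assms] in measurable)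

lemma L2_diff:
  assumes "f \<in> L2" "g \<in> L2"
  shows "(\<lambda>x. f x - g x) \<in> L2"
  using L2_add[OF assms(1) L2_scale[OF assms(2), of "- 1"]] by simp

lemma L2_inner_integrable:
  assumes "f \<in> L2" "g \<in> L2"
  shows "integrable lborel (\<lambda>x. f x * cnj (g x))"
proof (rule Bochner_Integration.integrable_bound)
  show "integrable lborel (\<lambda>x. (norm (f x))\<^sup>2 + (norm (g x))\<^sup>2)"
    using assms by (intro Bochner_Integration.integrable_add) (auto simp: L2_integrable)
  have [measurable]: "f \<in> borel_measurable borel" "g \<in> borel_measurable borel"
    using assms by (auto simp: L2_measurable)
  show "(\<lambda>x. f x * cnj (g x)) \<in> borel_measurable lborel" by measurable
  show "AE x in lborel. norm (f x * cnj (g x)) \<le> norm ((norm (f x))\<^sup>2 + (norm (g x))\<^sup>2)"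
  proof (rule AE_I2)
    fix x
    have "2 * (norm (f x) * norm (g x)) \<le> (norm (f x))\<^sup>2 + (norm (g x))\<^sup>2"
      using sum_squares_bound[of "norm (f x)" "norm (g x)"] by simp
    moreover have "0 \<le> norm (f x) * norm (g x)" by simp
    ultimately have "norm (f x) * norm (g x) \<le> (norm (f x))\<^sup>2 + (norm (g x))\<^sup>2" by linarith
    then show "norm (f x * cnj (g x)) \<le> norm ((norm (f x))\<^sup>2 + (norm (g x))\<^sup>2)"
      by (simp add: norm_mult)
  qed
qed

lemma L2_seminorm_nonneg: "0 \<le> L2_seminorm f"
  by (simp add: L2_seminorm_def integral_nonneg_AE)

lemma L2_seminorm_power2: "(L2_seminorm f)\<^sup>2 = (\<integral>x. (norm (f x))\<^sup>2 \<partial>lborel)"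
  by (simp add: L2_seminorm_def integral_nonneg_AE)

lemma L2_seminorm_add_power2:
  assumes f: "f \<in> L2" and g: "g \<in> L2"
  shows "(L2_seminorm (\<lambda>x. f x + g x))\<^sup>2 = (L2_seminorm f)\<^sup>2 + 2 * Re (L2_inner f g) + (L2_seminorm g)\<^sup>2"
proof -
  define r where "r x = Re (f x * cnj (g x))" for x
  have "(norm (f x + g x))\<^sup>2 = (norm (f x))\<^sup>2 + 2 * r x + (norm (g x))\<^sup>2" for x
    unfolding cmod_power2 r_def by (simp add: power2_eq_square algebra_simps)
  moreover have "integrable lborel r"
    unfolding r_def using L2_inner_integrable[OF f g] by (rule integrable_Re)
  moreover have "Re (L2_inner f g) = (\<integral>x. r x \<partial>lborel)"
    unfolding L2_inner_def r_def using L2_inner_integrable[OF f g] by (rule integral_Re[symmetric])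
  ultimately show ?thesis
    using L2_integrable[OF f] L2_integrable[OF g]
    by (simp add: L2_seminorm_power2)
qed

lemma L2_seminorm_scale: "L2_seminorm (\<lambda>x. c * f x) = norm c * L2_seminorm f"
  by (simp add: L2_seminorm_def norm_mult power_mult_distrib real_sqrt_mult)

lemma L2_inner_scale: "L2_inner f (\<lambda>x. c * g x) = cnj c * L2_inner f g"
  by (simp add: L2_inner_def mult.left_commute)

lemma quadratic_nonneg_imp_le:
  fixes a b c :: real
  assumes "\<And>t. 0 \<le> a + 2 * t * c + t\<^sup>2 * b" "0 \<le> b"
  shows "c\<^sup>2 \<le> a * b"
proof (cases "b = 0")
  case True
  have "c = 0"
  proof (rule ccontr)
    assume "c \<noteq> 0"
    then show False using assms(1)[of "- (a + 1) / (2 * c)"] True by (simp add: field_simps)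
  qed
  with True show ?thesis by simp
next
  case False
  with assms have b: "0 < b" by simp
  have "0 \<le> a + 2 * (- c / b) * c + (- c / b)\<^sup>2 * b" by (rule assms(1))
  also have "\<dots> = a - c\<^sup>2 / b" using b by (simp add: power2_eq_square field_simps)
  finally show ?thesis using b by (simp add: field_simps)
qed

text \<open>
  With \<open>c\<close> the phase of the inner product, the squared norm of \<open>f + t * c * g\<close> is a nonnegative
  quadratic polynomial in the real variable \<open>t\<close>.
\<close>

lemma L2_Cauchy_Schwarz:
  assumes f: "f \<in> L2" and g: "g \<in> L2"
  shows "norm (L2_inner f g) \<le> L2_seminorm f * L2_seminorm g"
proof -
  define c where "c = sgn (L2_inner f g)"
  have "(norm (L2_inner f g))\<^sup>2 \<le> (L2_seminorm f)\<^sup>2 * (L2_seminorm g)\<^sup>2"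
  proof (cases "L2_inner f g = 0")
    case False
    then have c: "norm c = 1" "cnj c * L2_inner f g = of_real (norm (L2_inner f g))"
    proof -
      show "norm c = 1" using False by (simp add: c_def norm_sgn)
      have "cnj c * L2_inner f g = (L2_inner f g * cnj (L2_inner f g)) /\<^sub>R norm (L2_inner f g)"
        by (simp add: c_def sgn_div_norm mult.commute)
      then show "cnj c * L2_inner f g = of_real (norm (L2_inner f g))"
        using False by (simp add: complex_norm_square[symmetric] scaleR_conv_of_real power2_eq_square)
    qed
    have "0 \<le> (L2_seminorm f)\<^sup>2 + 2 * t * norm (L2_inner f g) + t\<^sup>2 * (L2_seminorm g)\<^sup>2" for t
    proof -
      have "L2_inner f (\<lambda>x. (of_real t * c) * g x) = of_real t * (cnj c * L2_inner f g)"
        by (subst L2_inner_scale) simp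
      then have "Re (L2_inner f (\<lambda>x. (of_real t * c) * g x)) = t * norm (L2_inner f g)"
        by (simp add: c)
      moreover have "(L2_seminorm (\<lambda>x. (of_real t * c) * g x))\<^sup>2 = t\<^sup>2 * (L2_seminorm g)\<^sup>2"
        by (subst L2_seminorm_scale) (simp add: norm_mult c power_mult_distrib)
      ultimately have "(L2_seminorm (\<lambda>x. f x + (of_real t * c) * g x))\<^sup>2
          = (L2_seminorm f)\<^sup>2 + 2 * t * norm (L2_inner f g) + t\<^sup>2 * (L2_seminorm g)\<^sup>2"
        using L2_seminorm_add_power2[OF f L2_scale[OF g], of "of_real t * c"] by simp
      then show ?thesis by (metis zero_le_power2)
    qed
    then show ?thesis by (rule quadratic_nonneg_imp_le) simp
  qed simp
  then show ?thesis
    by (metis L2_seminorm_nonneg mult_nonneg_nonneg power2_le_imp_le power_mult_distrib)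
qed

lemma L2_seminorm_triangle:
  assumes f: "f \<in> L2" and g: "g \<in> L2"
  shows "L2_seminorm (\<lambda>x. f x + g x) \<le> L2_seminorm f + L2_seminorm g"
proof (rule power2_le_imp_le)
  have "Re (L2_inner f g) \<le> L2_seminorm f * L2_seminorm g"
    using L2_Cauchy_Schwarz[OF f g] complex_Re_le_cmod order_trans by blast
  then show "(L2_seminorm (\<lambda>x. f x + g x))\<^sup>2 \<le> (L2_seminorm f + L2_seminorm g)\<^sup>2"
    unfolding L2_seminorm_add_power2[OF f g] by (simp add: power2_sum)
qed (simp add: L2_seminorm_nonneg)

lemma L2_seminorm_minus_commute: "L2_seminorm (\<lambda>x. f x - g x) = L2_seminorm (\<lambda>x. g x - f x)"
  by (simp add: L2_seminorm_def norm_minus_commute)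

lemma L2_seminorm_diff_triangle:
  assumes "f \<in> L2" "g \<in> L2" "h \<in> L2"
  shows "L2_seminorm (\<lambda>x. f x - h x) \<le> L2_seminorm (\<lambda>x. f x - g x) + L2_seminorm (\<lambda>x. g x - h x)"
  using L2_seminorm_triangle[OF L2_diff[OF assms(1,2)] L2_diff[OF assms(2,3)]] by simp

lemma tendsto_L2_seminorm:
  assumes s: "\<And>i. s i \<in> L2" and f: "f \<in> L2" and lim: "(\<lambda>i. L2_seminorm (\<lambda>x. s i x - f x)) \<longlonglongrightarrow> 0"
  shows "(\<lambda>i. L2_seminorm (s i)) \<longlonglongrightarrow> L2_seminorm f"
proof (rule LIM_zero_cancel, rule Lim_null_comparison[OF always_eventually lim], rule allI)
  fix i
  have "L2_seminorm (s i) \<le> L2_seminorm (\<lambda>x. s i x - f x) + L2_seminorm f"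
    using L2_seminorm_triangle[OF L2_diff[OF s f] f, of i] by simp
  moreover have "L2_seminorm f \<le> L2_seminorm (\<lambda>x. f x - s i x) + L2_seminorm (s i)"
    using L2_seminorm_triangle[OF L2_diff[OF f s] s, of i i] by simp
  ultimately show "norm (L2_seminorm (s i) - L2_seminorm f) \<le> L2_seminorm (\<lambda>x. s i x - f x)"
    using L2_seminorm_minus_commute[of f "s i"] by simp
qed

lemma L2_null_iff: "f \<in> L2 \<Longrightarrow> f \<in> L2_null \<longleftrightarrow> L2_seminorm f = 0"
  using integral_nonneg_eq_0_iff_AE[OF L2_integrable, of f]
  by (simp add: L2_null_def L2_seminorm_def)

lemma nn_integral_L2:
  assumes "f \<in> L2"
  shows "(\<integral>\<^sup>+x. ennreal ((norm (f x))\<^sup>2) \<partial>lborel) = ennreal ((L2_seminorm f)\<^sup>2)"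
  unfolding L2_seminorm_power2 using L2_integrable[OF assms] by (rule nn_integral_eq_integral) simp

lemma L2_nn_integralI:
  assumes f [measurable]: "f \<in> borel_measurable borel" and e: "0 \<le> e"
    and le: "(\<integral>\<^sup>+x. ennreal ((norm (f x))\<^sup>2) \<partial>lborel) \<le> ennreal (e\<^sup>2)"
  shows "f \<in> L2" and "L2_seminorm f \<le> e"
proof -
  have "(\<integral>\<^sup>+x. ennreal (norm ((norm (f x))\<^sup>2)) \<partial>lborel) < \<infinity>"
    using le_less_trans[OF le ennreal_less_top] by simp
  then show L2: "f \<in> L2"
    by (intro L2I f integrableI_bounded) auto
  have "(L2_seminorm f)\<^sup>2 \<le> e\<^sup>2"
    using le unfolding nn_integral_L2[OF L2] by (subst (asm) ennreal_le_iff) auto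
  then show "L2_seminorm f \<le> e" using e by (rule power2_le_imp_le)
qed

subsection \<open>Completeness\<close>

text \<open>
  The weights grow geometrically, so the terms decay geometrically.
\<close>

lemma summable_of_weighted_squares:
  fixes d :: "nat \<Rightarrow> 'a::banach"
  assumes "\<And>k. 2 ^ k * (norm (d k))\<^sup>2 \<le> C"
  shows "summable d"
proof (rule summable_comparison_test)
  have C: "0 \<le> C" using assms[of 0] by (simp, meson order_trans zero_le_power2)
  have "norm (d k) \<le> sqrt C * (1 / sqrt 2) ^ k" for k
  proof (rule power2_le_imp_le)
    have "((1 / sqrt 2) ^ k)\<^sup>2 = ((1 / sqrt 2)\<^sup>2) ^ k"
      by (simp only: power_mult[symmetric] mult.commute)
    then have "((1 / sqrt 2) ^ k)\<^sup>2 = (1 / 2 :: real) ^ k"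
      by (simp add: power_divide)
    then show "(norm (d k))\<^sup>2 \<le> (sqrt C * (1 / sqrt 2) ^ k)\<^sup>2"
      using assms[of k] C by (simp add: power_mult_distrib field_simps power_one_over)
  qed (use C in simp)
  then show "\<exists>N. \<forall>n\<ge>N. norm (d n) \<le> sqrt C * (1 / sqrt 2) ^ n" by blast
  show "summable (\<lambda>n. sqrt C * (1 / sqrt 2) ^ n)"
    by (intro summable_mult summable_geometric) simp
qed

text \<open>
  Along a subsequence with increments of norm at most \<open>(1 / 2) ^ k\<close>, the sum of the squared increments
  with weights \<open>2 ^ k\<close> has finite integral. Hence the subsequence converges almost everywhere, and
  Fatou's lemma transfers the Cauchy estimates to the limit.
\<close>

theorem L2_complete:
  fixes s :: "nat \<Rightarrow> real^'n \<Rightarrow> complex"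
  assumes s: "\<And>i. s i \<in> L2"
    and cauchy: "\<And>\<epsilon>. 0 < \<epsilon> \<Longrightarrow> \<exists>N. \<forall>m\<ge>N. \<forall>n\<ge>N. L2_seminorm (\<lambda>x. s m x - s n x) < \<epsilon>"
  shows "\<exists>f\<in>L2. (\<lambda>n. L2_seminorm (\<lambda>x. s n x - f x)) \<longlonglongrightarrow> 0"
proof -
  have sm [measurable]: "s i \<in> borel_measurable borel" for i using s by (rule L2_measurable)
  have "\<exists>N. \<forall>k. \<forall>m\<ge>N k. \<forall>n\<ge>N k. L2_seminorm (\<lambda>x. s m x - s n x) < (1 / 2) ^ k"
    by (intro choice allI cauchy) simp
  then obtain N where N: "\<And>k m n. N k \<le> m \<Longrightarrow> N k \<le> n \<Longrightarrow> L2_seminorm (\<lambda>x. s m x - s n x) < (1 / 2) ^ k"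
    by blast
  \<comment> \<open>partial sums, to have increasing indices that are at least \<open>N k\<close>\<close>
  define M where "M k = (\<Sum>i\<le>k. N i)" for k
  have NM: "N k \<le> M k" for k unfolding M_def by (rule member_le_sum) auto
  have MM: "M k \<le> M l" if "k \<le> l" for k l unfolding M_def using that by (intro sum_mono2) auto
  define t where "t k = s (M k)" for k
  have tm [measurable]: "t k \<in> borel_measurable borel" for k by (simp add: t_def)
  define D where "D k x = t (Suc k) x - t k x" for k x
  have Dm [measurable]: "D k \<in> borel_measurable borel" for k unfolding D_def by measurable
  have DL: "D k \<in> L2" for k unfolding D_def t_def by (intro L2_diff s)
  have Dn: "L2_seminorm (D k) \<le> (1 / 2) ^ k" for k
    unfolding D_def t_def using N[of k "M (Suc k)" "M k"] NM[of k] MM[of k "Suc k"] by simp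
  have "(\<integral>\<^sup>+x. (\<Sum>k. ennreal (2 ^ k * (norm (D k x))\<^sup>2)) \<partial>lborel) = (\<Sum>k. \<integral>\<^sup>+x. ennreal (2 ^ k * (norm (D k x))\<^sup>2) \<partial>lborel)"
    by (rule nn_integral_suminf) measurable
  also have "\<dots> \<le> (\<Sum>k. ennreal ((1 / 2) ^ k))"
  proof (intro suminf_le allI)
    fix k
    have "(\<integral>\<^sup>+x. ennreal (2 ^ k * (norm (D k x))\<^sup>2) \<partial>lborel) = ennreal (2 ^ k) * ennreal ((L2_seminorm (D k))\<^sup>2)"
      unfolding nn_integral_L2[OF DL, symmetric]
      by (subst nn_integral_cmult[symmetric]) (auto simp: ennreal_mult)
    also have "\<dots> \<le> ennreal (2 ^ k) * ennreal (((1 / 2) ^ k)\<^sup>2)"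
      using Dn[of k] by (intro mult_left_mono ennreal_leI power_mono L2_seminorm_nonneg) auto
    also have "\<dots> = ennreal ((1 / 2) ^ k)"
    proof -
      have "2 ^ k * ((1 / 2) ^ k)\<^sup>2 = (1 / 2 :: real) ^ k"
        by (simp add: power2_eq_square power_divide)
      then show ?thesis by (subst ennreal_mult[symmetric]) auto
    qed
    finally show "(\<integral>\<^sup>+x. ennreal (2 ^ k * (norm (D k x))\<^sup>2) \<partial>lborel) \<le> ennreal ((1 / 2) ^ k)" .
  qed auto
  also have "\<dots> < \<infinity>"
    by (subst suminf_ennreal2) (auto intro!: summable_geometric)
  finally have "AE x in lborel. (\<Sum>k. ennreal (2 ^ k * (norm (D k x))\<^sup>2)) \<noteq> \<infinity>"
    by (intro nn_integral_PInf_AE) auto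
  define f where "f x = lim (\<lambda>k. t k x)" for x
  have fm [measurable]: "f \<in> borel_measurable borel"
    unfolding f_def by (rule borel_measurable_lim_metric) measurable
  have lim: "AE x in lborel. (\<lambda>k. t k x) \<longlonglongrightarrow> f x"
    using \<open>AE x in lborel. (\<Sum>k. ennreal (2 ^ k * (norm (D k x))\<^sup>2)) \<noteq> \<infinity>\<close>
  proof eventually_elim
    case (elim x)
    define C where "C = enn2real (\<Sum>k. ennreal (2 ^ k * (norm (D k x))\<^sup>2))"
    have C: "0 \<le> C" "(\<Sum>k. ennreal (2 ^ k * (norm (D k x))\<^sup>2)) = ennreal C"
      unfolding C_def using elim by (auto intro!: ennreal_enn2real[symmetric] simp: less_top)
    have "2 ^ k * (norm (D k x))\<^sup>2 \<le> C" for k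
    proof -
      have "sum (\<lambda>k. ennreal (2 ^ k * (norm (D k x))\<^sup>2)) {k} \<le> ennreal C"
        unfolding C(2)[symmetric] by (rule sum_le_suminf) auto
      then show ?thesis using C(1) by (simp only: sum.insert_if finite.emptyI sum.empty ennreal_le_iff) simp
    qed
    then have "summable (\<lambda>k. D k x)" by (rule summable_of_weighted_squares)
    then have "convergent (\<lambda>k. \<Sum>i<k. D i x)" by (simp add: summable_iff_convergent)
    moreover have "(\<Sum>i<k. D i x) = t k x - t 0 x" for k
      unfolding D_def by (rule sum_lessThan_telescope)
    ultimately obtain L where "(\<lambda>k. t k x - t 0 x) \<longlonglongrightarrow> L"
      by (auto simp: convergent_def)
    then have "(\<lambda>k. (t k x - t 0 x) + t 0 x) \<longlonglongrightarrow> L + t 0 x"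
      by (intro tendsto_add tendsto_const)
    then have "convergent (\<lambda>k. t k x)"
      by (auto simp: convergent_def)
    then show ?case by (simp add: f_def convergent_LIMSEQ_iff)
  qed
  have close: "(\<lambda>x. s n x - f x) \<in> L2 \<and> L2_seminorm (\<lambda>x. s n x - f x) \<le> (1 / 2) ^ k" if n: "N k \<le> n" for k n
  proof -
    have "(\<integral>\<^sup>+x. ennreal ((norm (s n x - f x))\<^sup>2) \<partial>lborel) = (\<integral>\<^sup>+x. liminf (\<lambda>j. ennreal ((norm (s n x - t j x))\<^sup>2)) \<partial>lborel)"
    proof (rule nn_integral_cong_AE)
      show "AE x in lborel. ennreal ((norm (s n x - f x))\<^sup>2) = liminf (\<lambda>j. ennreal ((norm (s n x - t j x))\<^sup>2))"
        using lim
      proof eventually_elim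
        case (elim x)
        then have "(\<lambda>j. ennreal ((norm (s n x - t j x))\<^sup>2)) \<longlonglongrightarrow> ennreal ((norm (s n x - f x))\<^sup>2)"
          by (intro tendsto_intros)
        then show ?case by (intro lim_imp_Liminf[symmetric]) auto
      qed
    qed
    also have "\<dots> \<le> liminf (\<lambda>j. \<integral>\<^sup>+x. ennreal ((norm (s n x - t j x))\<^sup>2) \<partial>lborel)"
      by (rule nn_integral_liminf) measurable
    also have "\<dots> \<le> limsup (\<lambda>j. \<integral>\<^sup>+x. ennreal ((norm (s n x - t j x))\<^sup>2) \<partial>lborel)"
      by (rule Liminf_le_Limsup) simp
    also have "\<dots> \<le> ennreal (((1 / 2) ^ k)\<^sup>2)"
    proof (rule Limsup_bounded, rule eventually_sequentiallyI[of k])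
      fix j assume "k \<le> j"
      then have "N k \<le> M j" using NM[of k] MM[of k j] by simp
      then have "L2_seminorm (\<lambda>x. s n x - t j x) \<le> (1 / 2) ^ k"
        unfolding t_def using N[OF n] less_imp_le by blast
      then have "(L2_seminorm (\<lambda>x. s n x - t j x))\<^sup>2 \<le> ((1 / 2) ^ k)\<^sup>2"
        by (intro power_mono L2_seminorm_nonneg)
      then show "(\<integral>\<^sup>+x. ennreal ((norm (s n x - t j x))\<^sup>2) \<partial>lborel) \<le> ennreal (((1 / 2) ^ k)\<^sup>2)"
        by (subst nn_integral_L2) (auto simp: t_def intro!: L2_diff s ennreal_leI)
    qed
    finally have le: "(\<integral>\<^sup>+x. ennreal ((norm (s n x - f x))\<^sup>2) \<partial>lborel) \<le> ennreal (((1 / 2) ^ k)\<^sup>2)" .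
    show ?thesis
      using L2_nn_integralI[OF _ _ le] by auto
  qed
  have "f \<in> L2"
    using L2_diff[OF s[of "N 0"] conjunct1[OF close[OF order_refl, of 0]]] by simp
  moreover have "(\<lambda>n. L2_seminorm (\<lambda>x. s n x - f x)) \<longlonglongrightarrow> 0"
  proof (rule LIMSEQ_I)
    fix e :: real assume "0 < e"
    then obtain k where k: "(1 / 2) ^ k < e"
      using real_arch_pow_inv[of e "1/2"] by auto
    have "norm (L2_seminorm (\<lambda>x. s n x - f x) - 0) < e" if "N k \<le> n" for n
      using close[OF that] k L2_seminorm_nonneg[of "\<lambda>x. s n x - f x"] by simp
    then show "\<exists>no. \<forall>n\<ge>no. norm (L2_seminorm (\<lambda>x. s n x - f x) - 0) < e" by blast
  qed
  ultimately show ?thesis by blast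
qed

subsection \<open>Orthogonal complements\<close>

lemma L2_parallelogram:
  assumes f: "f \<in> L2" and g: "g \<in> L2"
  shows "(L2_seminorm (\<lambda>x. f x - g x))\<^sup>2 = 2 * (L2_seminorm f)\<^sup>2 + 2 * (L2_seminorm g)\<^sup>2 - (L2_seminorm (\<lambda>x. f x + g x))\<^sup>2"
proof -
  have "L2_inner f (\<lambda>x. (- 1) * g x) = - L2_inner f g"
    by (subst L2_inner_scale) simp
  moreover have "L2_seminorm (\<lambda>x. (- 1) * g x) = L2_seminorm g"
    by (subst L2_seminorm_scale) simp
  ultimately show ?thesis
    using L2_seminorm_add_power2[OF f g] L2_seminorm_add_power2[OF f L2_scale[OF g, of "- 1"]] by simp
qed

lemma closed_L2_subspace_scale: "closed_L2_subspace V \<Longrightarrow> f \<in> V \<Longrightarrow> (\<lambda>x. c * f x) \<in> V"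
  by (simp add: closed_L2_subspace_def)

lemma closed_L2_subspace_add: "closed_L2_subspace V \<Longrightarrow> f \<in> V \<Longrightarrow> g \<in> V \<Longrightarrow> (\<lambda>x. f x + g x) \<in> V"
  by (simp add: closed_L2_subspace_def)

text \<open>
  The parallelogram identity, applied with midpoints in \<open>V\<close>, makes every minimising sequence Cauchy.
\<close>

theorem L2_nearest_point:
  assumes V: "closed_L2_subspace V" and h: "h \<in> L2"
  shows "\<exists>p\<in>V. \<forall>v\<in>V. L2_seminorm (\<lambda>x. h x - p x) \<le> L2_seminorm (\<lambda>x. h x - v x)"
proof -
  have VL: "v \<in> L2" if "v \<in> V" for v using V that by (auto simp: closed_L2_subspace_def)
  define Q where "Q v = (L2_seminorm (\<lambda>x. h x - v x))\<^sup>2" for v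
  define \<delta> where "\<delta> = Inf (Q ` V)"
  have V0: "(\<lambda>_. 0) \<in> V" using V by (simp add: closed_L2_subspace_def)
  have bdd: "bdd_below (Q ` V)" by (rule bdd_belowI[of _ 0]) (auto simp: Q_def)
  have \<delta>_le: "\<delta> \<le> Q v" if "v \<in> V" for v
    unfolding \<delta>_def using that bdd by (intro cInf_lower) auto
  have "\<exists>v\<in>V. Q v < \<delta> + e" if "0 < e" for e
  proof -
    have "Inf (Q ` V) < \<delta> + e" using that by (simp add: \<delta>_def)
    then show ?thesis using V0 bdd by (subst (asm) cInf_less_iff) auto
  qed
  then have "\<forall>n. \<exists>v. v \<in> V \<and> Q v < \<delta> + inverse (real (Suc n))" by (meson inverse_positive_iff_positive of_nat_0_less_iff zero_less_Suc)
  then obtain v where v: "\<And>n. v n \<in> V" "\<And>n. Q (v n) < \<delta> + inverse (real (Suc n))"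
    by metis
  have mid: "(L2_seminorm (\<lambda>x. v m x - v n x))\<^sup>2 \<le> 2 * Q (v m) + 2 * Q (v n) - 4 * \<delta>" for m n
  proof -
    define w where "w x = (1 / 2) * (v m x + v n x)" for x
    have w: "w \<in> V"
      unfolding w_def using V v by (intro closed_L2_subspace_scale closed_L2_subspace_add)
    have "(L2_seminorm (\<lambda>x. (h x - v m x) - (h x - v n x)))\<^sup>2
        = 2 * Q (v m) + 2 * Q (v n) - (L2_seminorm (\<lambda>x. (h x - v m x) + (h x - v n x)))\<^sup>2"
      unfolding Q_def using v VL h by (intro L2_parallelogram L2_diff) auto
    moreover have "(\<lambda>x. (h x - v m x) + (h x - v n x)) = (\<lambda>x. 2 * (h x - w x))"
      by (simp add: w_def fun_eq_iff algebra_simps)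
    moreover have "(L2_seminorm (\<lambda>x. 2 * (h x - w x)))\<^sup>2 = 4 * Q w"
      unfolding Q_def by (subst L2_seminorm_scale) (simp add: power_mult_distrib)
    moreover have "(\<lambda>x. (h x - v m x) - (h x - v n x)) = (\<lambda>x. v n x - v m x)"
      by (simp add: fun_eq_iff)
    ultimately show ?thesis
      using \<delta>_le[OF w] L2_seminorm_minus_commute[of "v m" "v n"] by simp
  qed
  have "\<exists>N. \<forall>m\<ge>N. \<forall>n\<ge>N. L2_seminorm (\<lambda>x. v m x - v n x) < \<epsilon>" if e: "0 < \<epsilon>" for \<epsilon>
  proof -
    have "0 < \<epsilon>\<^sup>2 / 4" using e by simp
    then obtain N where N: "inverse (real (Suc N)) < \<epsilon>\<^sup>2 / 4"
      using reals_Archimedean by blast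
    have Qs: "Q (v n) < \<delta> + \<epsilon>\<^sup>2 / 4" if "N \<le> n" for n
    proof -
      have "inverse (real (Suc n)) \<le> inverse (real (Suc N))" using that by (intro le_imp_inverse_le) auto
      then show ?thesis using v(2)[of n] N by linarith
    qed
    have "L2_seminorm (\<lambda>x. v m x - v n x) < \<epsilon>" if "N \<le> m" "N \<le> n" for m n
    proof (rule power2_less_imp_less)
      show "(L2_seminorm (\<lambda>x. v m x - v n x))\<^sup>2 < \<epsilon>\<^sup>2"
        using mid[of m n] Qs[OF that(1)] Qs[OF that(2)] by linarith
    qed (use e in simp)
    then show ?thesis by blast
  qed
  then obtain p where p: "p \<in> L2" "(\<lambda>n. L2_seminorm (\<lambda>x. v n x - p x)) \<longlonglongrightarrow> 0"
    using L2_complete[of v] v VL by blast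
  have "\<exists>g\<in>V. L2_seminorm (\<lambda>x. p x - g x) < \<epsilon>" if e: "0 < \<epsilon>" for \<epsilon>
  proof -
    obtain n where "norm (L2_seminorm (\<lambda>x. v n x - p x) - 0) < \<epsilon>"
      using LIMSEQ_D[OF p(2) e] by blast
    then show ?thesis
      using v L2_seminorm_minus_commute[of "v n" p] L2_seminorm_nonneg[of "\<lambda>x. v n x - p x"]
      by (intro bexI[of _ "v n"]) auto
  qed
  then have pV: "p \<in> V" using V p(1) by (simp add: closed_L2_subspace_def)
  have "Q p \<le> \<delta>"
  proof (rule LIMSEQ_le)
    have "(\<lambda>n. L2_seminorm (\<lambda>x. h x - v n x)) \<longlonglongrightarrow> L2_seminorm (\<lambda>x. h x - p x)"
    proof (rule tendsto_L2_seminorm)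
      have "L2_seminorm (\<lambda>x. (h x - v n x) - (h x - p x)) = L2_seminorm (\<lambda>x. v n x - p x)" for n
        using L2_seminorm_minus_commute[of p "v n"] by simp
      then show "(\<lambda>n. L2_seminorm (\<lambda>x. (h x - v n x) - (h x - p x))) \<longlonglongrightarrow> 0"
        using p(2) by simp
    qed (use h v VL p in \<open>auto intro: L2_diff\<close>)
    then show "(\<lambda>n. Q (v n)) \<longlonglongrightarrow> Q p"
      unfolding Q_def by (rule tendsto_power)
    have "(\<lambda>n. \<delta> + inverse (real (Suc n))) \<longlonglongrightarrow> \<delta> + 0"
      by (intro tendsto_add tendsto_const LIMSEQ_inverse_real_of_nat)
    then show "(\<lambda>n. \<delta> + inverse (real (Suc n))) \<longlonglongrightarrow> \<delta>" by (simp only: add_0_right)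
    show "\<exists>N. \<forall>n\<ge>N. Q (v n) \<le> \<delta> + inverse (real (Suc n))"
      using v(2) less_imp_le by blast
  qed
  then have "Q p \<le> Q u" if "u \<in> V" for u using \<delta>_le[OF that] by simp
  then have "L2_seminorm (\<lambda>x. h x - p x) \<le> L2_seminorm (\<lambda>x. h x - u x)" if "u \<in> V" for u
    using that by (intro power2_le_imp_le[OF _ L2_seminorm_nonneg]) (simp add: Q_def)
  with pV show ?thesis by blast
qed

text \<open>
  The difference between a function outside \<open>V\<close> and its nearest point is orthogonal to \<open>V\<close>: otherwise
  a small step along \<open>V\<close> would come closer.
\<close>

theorem closed_L2_subspace_orthogonal:
  assumes V: "closed_L2_subspace V" and ne: "V \<noteq> L2"
  shows "\<exists>g\<in>L2 - L2_null. \<forall>v\<in>V. L2_inner g v = 0"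
proof -
  have VL: "V \<subseteq> L2" using V by (simp add: closed_L2_subspace_def)
  with ne obtain h where h: "h \<in> L2" "h \<notin> V" by blast
  obtain p where p: "p \<in> V" "\<And>v. v \<in> V \<Longrightarrow> L2_seminorm (\<lambda>x. h x - p x) \<le> L2_seminorm (\<lambda>x. h x - v x)"
    using L2_nearest_point[OF V h(1)] by blast
  define g where "g x = h x - p x" for x
  have gL: "g \<in> L2" unfolding g_def using h p VL by (intro L2_diff) auto
  have "L2_seminorm g \<noteq> 0"
  proof
    assume "L2_seminorm g = 0"
    then have "\<exists>v\<in>V. L2_seminorm (\<lambda>x. h x - v x) < \<epsilon>" if "0 < \<epsilon>" for \<epsilon>
      using p(1) that by (intro bexI[of _ p]) (auto simp: g_def[abs_def])
    then have "h \<in> V" using V h(1) by (simp add: closed_L2_subspace_def)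
    with h show False by simp
  qed
  then have gN: "g \<notin> L2_null" using L2_null_iff[OF gL] by simp
  have "L2_inner g v = 0" if v: "v \<in> V" for v
  proof (rule ccontr)
    define c where "c = L2_inner g v"
    assume "L2_inner g v \<noteq> 0"
    then have c: "0 < (norm c)\<^sup>2" by (simp add: c_def)
    define t where "t = 1 / ((L2_seminorm v)\<^sup>2 + 1)"
    have t: "0 < t" "t * (L2_seminorm v)\<^sup>2 \<le> 1"
      by (auto simp: t_def add_nonneg_pos divide_le_eq)
    define w where "w x = (- of_real t * c) * v x" for x
    have wV: "(\<lambda>x. p x - w x) \<in> V"
    proof -
      have "(\<lambda>x. p x + (of_real t * c) * v x) \<in> V"
        using V p(1) v by (intro closed_L2_subspace_scale closed_L2_subspace_add)
      then show ?thesis by (simp add: w_def)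
    qed
    have vL: "v \<in> L2" using v VL by auto
    have wL: "w \<in> L2" unfolding w_def by (rule L2_scale[OF vL])
    have "L2_seminorm g \<le> L2_seminorm (\<lambda>x. g x + w x)"
      using p(2)[OF wV] by (simp add: g_def[abs_def] algebra_simps)
    then have "(L2_seminorm g)\<^sup>2 \<le> (L2_seminorm (\<lambda>x. g x + w x))\<^sup>2"
      by (intro power_mono L2_seminorm_nonneg)
    moreover have "L2_inner g w = - of_real t * (c * cnj c)"
      unfolding w_def by (subst L2_inner_scale) (simp add: c_def mult_ac)
    then have "Re (L2_inner g w) = - t * (norm c)\<^sup>2"
      by (simp add: complex_norm_square[symmetric] flip: of_real_mult of_real_minus)
    moreover have "(L2_seminorm w)\<^sup>2 = t\<^sup>2 * (norm c)\<^sup>2 * (L2_seminorm v)\<^sup>2"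
      unfolding w_def by (subst L2_seminorm_scale) (simp add: norm_mult power_mult_distrib)
    ultimately have "0 \<le> - 2 * t * (norm c)\<^sup>2 + t\<^sup>2 * (norm c)\<^sup>2 * (L2_seminorm v)\<^sup>2"
      using L2_seminorm_add_power2[OF gL wL] by simp
    also have "\<dots> = (t * (norm c)\<^sup>2) * (t * (L2_seminorm v)\<^sup>2 - 2)"
      by (simp add: power2_eq_square algebra_simps)
    also have "\<dots> < 0" using t c by (intro mult_pos_neg mult_pos_pos) auto
    finally show False by simp
  qed
  with gL gN show ?thesis by blast
qed

section \<open>The Plancherel theorem\<close>

lemma bounded_integrable_L2:
  assumes "bounded_integrable f"
  shows "f \<in> L2"
proof -
  obtain B where B: "\<And>x. norm (f x) \<le> B"
    using assms by (auto simp: bounded_integrable_def bounded_iff)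
  show ?thesis
  proof (rule L2_bound)
    show "integrable lborel (\<lambda>x. B * norm (f x))" "f \<in> borel_measurable borel"
      using assms by (auto simp: bounded_integrable_def)
    show "(norm (f x))\<^sup>2 \<le> B * norm (f x)" for x
      unfolding power2_eq_square by (intro mult_right_mono B) simp
  qed
qed

lemma fourier_bounded_integrable_L2:
  assumes "bounded_integrable f"
  shows "fourier f \<in> L2" "L2_seminorm (fourier f) = L2_seminorm f"
proof -
  have "f \<in> borel_measurable borel" using assms by (auto simp: bounded_integrable_def)
  then show "fourier f \<in> L2"
    using plancherel_bounded(1)[OF assms] by (intro L2I fourier_measurable)
  show "L2_seminorm (fourier f) = L2_seminorm f"
    unfolding L2_seminorm_def plancherel_bounded(2)[OF assms] ..
qed

lemma bounded_integrable_add_scale: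
  assumes "bounded_integrable f" "bounded_integrable g"
  shows "bounded_integrable (\<lambda>x. f x + c * g x)"
proof -
  obtain B C where B: "\<And>x. norm (f x) \<le> B" and C: "\<And>x. norm (g x) \<le> C"
    using assms by (auto simp: bounded_integrable_def bounded_iff)
  have "norm (f x + c * g x) \<le> B + norm c * C" for x
    using norm_triangle_mono[OF B[of x] mult_left_mono[OF C[of x] norm_ge_zero[of c], folded norm_mult]] .
  then show ?thesis
    using assms by (auto simp: bounded_integrable_def bounded_iff)
qed

lemma fourier_add_scale:
  assumes "integrable lborel f" "integrable lborel g"
  shows "fourier (\<lambda>x. f x + c * g x) \<xi> = fourier f \<xi> + c * fourier g \<xi>"
proof -
  have "fourier (\<lambda>x. f x + c * g x) \<xi> = (\<integral>x. f x * cis (- 2 * pi * (x \<bullet> \<xi>)) + c * (g x * cis (- 2 * pi * (x \<bullet> \<xi>))) \<partial>lborel)"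
    by (simp add: fourier_def algebra_simps)
  also have "\<dots> = fourier f \<xi> + c * fourier g \<xi>"
    unfolding fourier_def
    using integrable_mult_cis[OF assms(1), of "- 2 * pi" \<xi>] integrable_mult_cis[OF assms(2), of "- 2 * pi" \<xi>]
    by simp
  finally show ?thesis .
qed

lemma L2_approx_bounded_integrable:
  fixes f :: "real^'n \<Rightarrow> complex"
  assumes f: "f \<in> L2"
  shows "\<exists>s. (\<forall>i. bounded_integrable (s i)) \<and> (\<lambda>i. L2_seminorm (\<lambda>x. s i x - f x)) \<longlonglongrightarrow> 0"
proof (intro exI conjI allI)
  have [measurable]: "f \<in> borel_measurable borel" using f by (rule L2_measurable)
  define s where "s i x = (if norm x \<le> real i \<and> norm (f x) \<le> real i then f x else 0)" for i :: nat and x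
  have sm [measurable]: "s i \<in> borel_measurable borel" for i unfolding s_def by measurable
  show "bounded_integrable (s i)" for i
    unfolding bounded_integrable_def
  proof
    have "integrable lborel (indicator (cball 0 (real i)) :: real^'n \<Rightarrow> real)"
      using emeasure_lborel_cball_finite by (intro integrable_real_indicator) auto
    then have "integrable lborel (\<lambda>x::real^'n. real i * indicator (cball 0 (real i)) x)" by simp
    then show "integrable lborel (s i)"
      by (rule Bochner_Integration.integrable_bound) (auto simp: s_def indicator_def)
    show "bounded (range (s i))"
      by (auto simp: bounded_iff s_def intro!: exI[of _ "real i"])
  qed
  have "(\<lambda>i. \<integral>x. (norm (s i x - f x))\<^sup>2 \<partial>lborel) \<longlonglongrightarrow> (\<integral>x. 0 \<partial>(lborel :: (real^'n) measure))"
  proof (rule integral_dominated_convergence[where w="\<lambda>x. (norm (f x))\<^sup>2"])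
    show "integrable lborel (\<lambda>x. (norm (f x))\<^sup>2)" using f by (rule L2_integrable)
    show "AE x in lborel. (\<lambda>i. (norm (s i x - f x))\<^sup>2) \<longlonglongrightarrow> 0"
    proof (rule AE_I2)
      fix x
      obtain N where N: "max (norm x) (norm (f x)) \<le> real N" using real_arch_simple by blast
      have "s i x = f x" if "N \<le> i" for i
        using N that by (simp add: s_def)
      then show "(\<lambda>i. (norm (s i x - f x))\<^sup>2) \<longlonglongrightarrow> 0"
        by (intro tendsto_eventually eventually_sequentiallyI[of N]) simp
    qed
    show "AE x in lborel. norm ((norm (s i x - f x))\<^sup>2) \<le> (norm (f x))\<^sup>2" for i
      by (rule AE_I2) (simp add: s_def)
  qed measurable
  then have "(\<lambda>i. sqrt (\<integral>x. (norm (s i x - f x))\<^sup>2 \<partial>lborel)) \<longlonglongrightarrow> sqrt 0"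
    by (intro tendsto_real_sqrt) simp
  then show "(\<lambda>i. L2_seminorm (\<lambda>x. s i x - f x)) \<longlonglongrightarrow> 0"
    by (simp add: L2_seminorm_def)
qed

text \<open>
  The Fourier transform of square-integrable functions, as a relation: functions are not identified
  modulo null sets, so the transform of \<open>f\<close> is determined only almost everywhere, and no choice among
  the candidates is needed.
\<close>

definition plancherel_pair :: "(real^'n \<Rightarrow> complex) \<Rightarrow> (real^'n \<Rightarrow> complex) \<Rightarrow> bool" where
  "plancherel_pair f \<phi> \<longleftrightarrow> f \<in> L2 \<and> \<phi> \<in> L2 \<and>
     (\<exists>s. (\<forall>i. bounded_integrable (s i)) \<and> (\<lambda>i. L2_seminorm (\<lambda>x. s i x - f x)) \<longlonglongrightarrow> 0 \<and>
          (\<lambda>i. L2_seminorm (\<lambda>\<xi>. fourier (s i) \<xi> - \<phi> \<xi>)) \<longlonglongrightarrow> 0)"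

lemma plancherel_pair_bounded_integrable:
  assumes "bounded_integrable f"
  shows "plancherel_pair f (fourier f)"
  unfolding plancherel_pair_def
  using bounded_integrable_L2[OF assms] fourier_bounded_integrable_L2(1)[OF assms] assms
  by (auto intro!: exI[of _ "\<lambda>_. f"] simp: L2_seminorm_def)

text \<open>
  The Fourier transform preserves norms on bounded integrable functions, so it sends an approximating
  sequence to a Cauchy sequence.
\<close>

theorem plancherel_pair_exists:
  fixes f :: "real^'n \<Rightarrow> complex"
  assumes f: "f \<in> L2"
  shows "\<exists>\<phi>. plancherel_pair f \<phi>"
proof -
  obtain s where s: "\<And>i. bounded_integrable (s i)" and lim: "(\<lambda>i. L2_seminorm (\<lambda>x. s i x - f x)) \<longlonglongrightarrow> 0"
    using L2_approx_bounded_integrable[OF f] by blast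
  have sL: "s i \<in> L2" for i using s by (rule bounded_integrable_L2)
  have dist: "L2_seminorm (\<lambda>\<xi>. fourier (s m) \<xi> - fourier (s n) \<xi>) = L2_seminorm (\<lambda>x. s m x - s n x)" for m n
  proof -
    have "L2_seminorm (fourier (\<lambda>x. s m x + (- 1) * s n x)) = L2_seminorm (\<lambda>x. s m x + (- 1) * s n x)"
      by (intro fourier_bounded_integrable_L2(2) bounded_integrable_add_scale s)
    moreover have "fourier (\<lambda>x. s m x + (- 1) * s n x) = (\<lambda>\<xi>. fourier (s m) \<xi> + (- 1) * fourier (s n) \<xi>)"
      using s by (intro ext fourier_add_scale) (auto simp: bounded_integrable_def)
    ultimately show ?thesis by simp
  qed
  have "\<exists>N. \<forall>m\<ge>N. \<forall>n\<ge>N. L2_seminorm (\<lambda>\<xi>. fourier (s m) \<xi> - fourier (s n) \<xi>) < \<epsilon>" if "0 < \<epsilon>" for \<epsilon>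
  proof -
    obtain N where N: "\<And>n. N \<le> n \<Longrightarrow> norm (L2_seminorm (\<lambda>x. s n x - f x) - 0) < \<epsilon> / 2"
      using LIMSEQ_D[OF lim, of "\<epsilon> / 2"] \<open>0 < \<epsilon>\<close> by (auto simp del: diff_zero)
    have "L2_seminorm (\<lambda>x. s m x - s n x) < \<epsilon>" if "N \<le> m" "N \<le> n" for m n
      using L2_seminorm_diff_triangle[OF sL f sL, of m n] N[OF that(1)] N[OF that(2)]
        L2_seminorm_minus_commute[of f "s n"] by simp
    then show ?thesis unfolding dist by blast
  qed
  then obtain \<phi> where "\<phi> \<in> L2" "(\<lambda>n. L2_seminorm (\<lambda>\<xi>. fourier (s n) \<xi> - \<phi> \<xi>)) \<longlonglongrightarrow> 0"
    using L2_complete[of "\<lambda>i. fourier (s i)"] fourier_bounded_integrable_L2(1)[OF s] by blast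
  with f s lim show ?thesis unfolding plancherel_pair_def by blast
qed

lemma plancherel_pair_norm:
  assumes "plancherel_pair f \<phi>"
  shows "L2_seminorm f = L2_seminorm \<phi>"
proof -
  from assms obtain s where s: "\<And>i. bounded_integrable (s i)"
    and 1: "(\<lambda>i. L2_seminorm (\<lambda>x. s i x - f x)) \<longlonglongrightarrow> 0"
    and 2: "(\<lambda>i. L2_seminorm (\<lambda>\<xi>. fourier (s i) \<xi> - \<phi> \<xi>)) \<longlonglongrightarrow> 0"
    and L: "f \<in> L2" "\<phi> \<in> L2"
    unfolding plancherel_pair_def by blast
  have "(\<lambda>i. L2_seminorm (s i)) \<longlonglongrightarrow> L2_seminorm f"
    by (rule tendsto_L2_seminorm[OF bounded_integrable_L2[OF s] L(1) 1])
  moreover have "(\<lambda>i. L2_seminorm (fourier (s i))) \<longlonglongrightarrow> L2_seminorm \<phi>"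
    by (rule tendsto_L2_seminorm[OF fourier_bounded_integrable_L2(1)[OF s] L(2) 2])
  ultimately show ?thesis
    unfolding fourier_bounded_integrable_L2(2)[OF s] by (rule LIMSEQ_unique)
qed

lemma plancherel_pair_add_scale:
  assumes f: "plancherel_pair f \<phi>" and g: "plancherel_pair g \<rho>"
  shows "plancherel_pair (\<lambda>x. f x + c * g x) (\<lambda>\<xi>. \<phi> \<xi> + c * \<rho> \<xi>)"
proof -
  from f obtain s where s: "\<And>i. bounded_integrable (s i)"
    and s1: "(\<lambda>i. L2_seminorm (\<lambda>x. s i x - f x)) \<longlonglongrightarrow> 0"
    and s2: "(\<lambda>i. L2_seminorm (\<lambda>\<xi>. fourier (s i) \<xi> - \<phi> \<xi>)) \<longlonglongrightarrow> 0"
    and fL: "f \<in> L2" "\<phi> \<in> L2"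
    unfolding plancherel_pair_def by blast
  from g obtain t where t: "\<And>i. bounded_integrable (t i)"
    and t1: "(\<lambda>i. L2_seminorm (\<lambda>x. t i x - g x)) \<longlonglongrightarrow> 0"
    and t2: "(\<lambda>i. L2_seminorm (\<lambda>\<xi>. fourier (t i) \<xi> - \<rho> \<xi>)) \<longlonglongrightarrow> 0"
    and gL: "g \<in> L2" "\<rho> \<in> L2"
    unfolding plancherel_pair_def by blast
  have lim: "(\<lambda>i. L2_seminorm (\<lambda>x. (u i x + c * v i x) - (p x + c * q x))) \<longlonglongrightarrow> 0"
    if L: "\<And>i. u i \<in> L2" "\<And>i. v i \<in> L2" "p \<in> L2" "q \<in> L2"
      and u: "(\<lambda>i. L2_seminorm (\<lambda>x. u i x - p x)) \<longlonglongrightarrow> 0" and v: "(\<lambda>i. L2_seminorm (\<lambda>x. v i x - q x)) \<longlonglongrightarrow> 0"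
    for u v :: "nat \<Rightarrow> real^'n \<Rightarrow> complex" and p q
  proof (rule tendsto_sandwich[OF always_eventually always_eventually tendsto_const])
    have "(\<lambda>i. L2_seminorm (\<lambda>x. u i x - p x) + norm c * L2_seminorm (\<lambda>x. v i x - q x)) \<longlonglongrightarrow> 0 + norm c * 0"
      by (intro tendsto_add tendsto_mult tendsto_const u v)
    then show "(\<lambda>i. L2_seminorm (\<lambda>x. u i x - p x) + norm c * L2_seminorm (\<lambda>x. v i x - q x)) \<longlonglongrightarrow> 0" by simp
    show "\<forall>i. L2_seminorm (\<lambda>x. (u i x + c * v i x) - (p x + c * q x)) \<le> L2_seminorm (\<lambda>x. u i x - p x) + norm c * L2_seminorm (\<lambda>x. v i x - q x)"
    proof
      fix i
      have "L2_seminorm (\<lambda>x. (u i x - p x) + c * (v i x - q x)) \<le> L2_seminorm (\<lambda>x. u i x - p x) + L2_seminorm (\<lambda>x. c * (v i x - q x))"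
        using L by (intro L2_seminorm_triangle L2_scale L2_diff)
      moreover have "(\<lambda>x. (u i x - p x) + c * (v i x - q x)) = (\<lambda>x. (u i x + c * v i x) - (p x + c * q x))"
        by (simp add: algebra_simps)
      ultimately show "L2_seminorm (\<lambda>x. (u i x + c * v i x) - (p x + c * q x)) \<le> L2_seminorm (\<lambda>x. u i x - p x) + norm c * L2_seminorm (\<lambda>x. v i x - q x)"
        by (simp only: L2_seminorm_scale)
    qed
  qed (simp add: L2_seminorm_nonneg)
  have four: "fourier (\<lambda>x. s i x + c * t i x) = (\<lambda>\<xi>. fourier (s i) \<xi> + c * fourier (t i) \<xi>)" for i
    using s t by (intro ext fourier_add_scale) (auto simp: bounded_integrable_def)
  have "(\<lambda>i. L2_seminorm (\<lambda>\<xi>. fourier (\<lambda>x. s i x + c * t i x) \<xi> - (\<phi> \<xi> + c * \<rho> \<xi>))) \<longlonglongrightarrow> 0"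
    unfolding four by (intro lim fourier_bounded_integrable_L2 s t fL gL s2 t2)
  moreover have "(\<lambda>i. L2_seminorm (\<lambda>x. (s i x + c * t i x) - (f x + c * g x))) \<longlonglongrightarrow> 0"
    by (intro lim bounded_integrable_L2 s t fL gL s1 t1)
  ultimately show ?thesis
    unfolding plancherel_pair_def
    using bounded_integrable_add_scale[OF s t]
      L2_add[OF fL(1) L2_scale[OF gL(1), of c]] L2_add[OF fL(2) L2_scale[OF gL(2), of c]]
    by (intro conjI exI[of _ "\<lambda>i x. s i x + c * t i x"]) auto
qed

text \<open>
  Polarisation: inner products are determined by the norms of \<open>f + g\<close> and \<open>f + \<i> * g\<close>.
\<close>

theorem plancherel_pair_inner:
  assumes f: "plancherel_pair f \<phi>" and g: "plancherel_pair g \<rho>"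
  shows "L2_inner f g = L2_inner \<phi> \<rho>"
proof -
  have L: "f \<in> L2" "\<phi> \<in> L2" "g \<in> L2" "\<rho> \<in> L2"
    using f g by (auto simp: plancherel_pair_def)
  have Re: "Re (cnj c * L2_inner f g) = Re (cnj c * L2_inner \<phi> \<rho>)" for c
    using plancherel_pair_norm[OF f] plancherel_pair_norm[OF g]
      plancherel_pair_norm[OF plancherel_pair_add_scale[OF f g, of c]]
      L2_seminorm_add_power2[OF L(1) L2_scale[OF L(3), of c]]
      L2_seminorm_add_power2[OF L(2) L2_scale[OF L(4), of c]]
    by (simp add: L2_inner_scale L2_seminorm_scale)
  show ?thesis
    using Re[of 1] Re[of "\<i>"] by (simp add: complex_eq_iff)
qed

section \<open>The quasi-regular representation on the Fourier side\<close>

lemma matrix_inv_mult_vec: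
  fixes h :: "real^'n^'n"
  assumes "invertible h"
  shows "matrix_inv h *v (h *v x) = x" "h *v (matrix_inv h *v x) = x" "invertible (matrix_inv h)"
    "\<bar>det (matrix_inv h)\<bar> = 1 / \<bar>det h\<bar>"
proof -
  have i: "h ** matrix_inv h = mat 1" "matrix_inv h ** h = mat 1"
    using someI_ex[of "\<lambda>A'. h ** A' = mat 1 \<and> A' ** h = mat 1"] assms
    unfolding matrix_inv_def invertible_def by auto
  show "matrix_inv h *v (h *v x) = x" "h *v (matrix_inv h *v x) = x" "invertible (matrix_inv h)"
    using i by (auto simp: matrix_vector_mul_assoc invertible_def)
  have "\<bar>det h\<bar> * \<bar>det (matrix_inv h)\<bar> = 1"
    using i(1) det_mul[of h "matrix_inv h"] by (simp add: abs_mult[symmetric])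
  then show "\<bar>det (matrix_inv h)\<bar> = 1 / \<bar>det h\<bar>"
    by (metis mult_zero_left nonzero_eq_divide_eq mult.commute zero_neq_one)
qed

lemma integral_affine_matrix:
  fixes f :: "real^'n \<Rightarrow> 'b::{banach, second_countable_topology}"
  assumes h: "invertible h" and f [measurable]: "f \<in> borel_measurable borel"
  shows "(\<integral>y. f (matrix_inv h *v (y - x)) \<partial>lborel) = \<bar>det h\<bar> *\<^sub>R (\<integral>y. f y \<partial>lborel)"
    and "integrable lborel f \<Longrightarrow> integrable lborel (\<lambda>y. f (matrix_inv h *v (y - x)))"
proof -
  show "(\<integral>y. f (matrix_inv h *v (y - x)) \<partial>lborel) = \<bar>det h\<bar> *\<^sub>R (\<integral>y. f y \<partial>lborel)"
    using integral_translate[of "\<lambda>y. f (matrix_inv h *v y)" "- x"]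
    by (simp add: integral_matrix(1)[OF matrix_inv_mult_vec(3)[OF h] f] matrix_inv_mult_vec(4)[OF h])
  assume "integrable lborel f"
  then have "integrable lborel (\<lambda>y. f (matrix_inv h *v y))"
    by (simp add: integral_matrix(2)[OF matrix_inv_mult_vec(3)[OF h] f])
  from integrable_translate[OF this, of "- x"]
  show "integrable lborel (\<lambda>y. f (matrix_inv h *v (y - x)))" by simp
qed

definition dual_regular ::
    "(real^'n) \<times> (real^'n^'n) \<Rightarrow> ((real^'n) \<Rightarrow> complex) \<Rightarrow> (real^'n) \<Rightarrow> complex" where
  "dual_regular p \<phi> = (\<lambda>\<xi>. of_real (\<bar>det (snd p)\<bar> powr (1 / 2)) * cis (- 2 * pi * (fst p \<bullet> \<xi>)) * \<phi> (transpose (snd p) *v \<xi>))"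

lemma powr_half_squared: "0 < c \<Longrightarrow> (c powr (1 / 2))\<^sup>2 = (c::real)" "0 < c \<Longrightarrow> (c powr (- 1 / 2))\<^sup>2 = 1 / (c::real)"
  by (simp_all add: power2_eq_square powr_add[symmetric] powr_minus_divide)

lemma quasi_regular_measurable:
  assumes [measurable]: "f \<in> borel_measurable borel"
  shows "quasi_regular p f \<in> borel_measurable borel"
  unfolding quasi_regular_def by measurable

lemma dual_regular_measurable:
  assumes [measurable]: "f \<in> borel_measurable borel"
  shows "dual_regular p f \<in> borel_measurable borel"
  unfolding dual_regular_def by measurable

lemma quasi_regular_L2:
  assumes h: "invertible (snd p)" and f: "f \<in> L2"
  shows "quasi_regular p f \<in> L2" "L2_seminorm (quasi_regular p f) = L2_seminorm f"
proof -
  obtain x h where p: "p = (x, h)" by (cases p)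
  have h: "invertible h" using assms p by simp
  then have d: "0 < \<bar>det h\<bar>" by (simp add: invertible_det_nz)
  have fm [measurable]: "f \<in> borel_measurable borel" using f by (rule L2_measurable)
  have n2: "(norm (quasi_regular p f y))\<^sup>2 = (1 / \<bar>det h\<bar>) * (norm (f (matrix_inv h *v (y - x))))\<^sup>2" for y
    using powr_half_squared(2)[OF d] by (simp add: quasi_regular_def p norm_mult power_mult_distrib)
  have fm2: "(\<lambda>y. (norm (f y))\<^sup>2) \<in> borel_measurable borel" by measurable
  show "quasi_regular p f \<in> L2"
    unfolding n2 using integral_affine_matrix(2)[OF h fm2 L2_integrable[OF f]]
    by (intro L2I quasi_regular_measurable) (auto simp: n2)
  show "L2_seminorm (quasi_regular p f) = L2_seminorm f"
    unfolding L2_seminorm_def n2 using integral_affine_matrix(1)[OF h fm2, of x] d by simp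
qed

lemma invertible_transpose: "invertible h \<Longrightarrow> invertible (transpose h)" for h :: "real^'n^'n"
  by (simp add: invertible_det_nz det_transpose)

lemma dual_regular_L2:
  assumes h: "invertible (snd p)" and f: "f \<in> L2"
  shows "dual_regular p f \<in> L2" "L2_seminorm (dual_regular p f) = L2_seminorm f"
proof -
  obtain x h where p: "p = (x, h)" by (cases p)
  have h: "invertible h" using assms p by simp
  then have d: "0 < \<bar>det h\<bar>" by (simp add: invertible_det_nz)
  have fm [measurable]: "f \<in> borel_measurable borel" using f by (rule L2_measurable)
  have n2: "(norm (dual_regular p f y))\<^sup>2 = \<bar>det h\<bar> * (norm (f (transpose h *v y)))\<^sup>2" for y
    using powr_half_squared(1)[OF d] by (simp add: dual_regular_def p norm_mult power_mult_distrib)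
  have fm2: "(\<lambda>y. (norm (f y))\<^sup>2) \<in> borel_measurable borel" by measurable
  show "dual_regular p f \<in> L2"
    using integral_matrix(2)[OF invertible_transpose[OF h] fm2] L2_integrable[OF f]
    by (intro L2I dual_regular_measurable) (auto simp: n2)
  show "L2_seminorm (dual_regular p f) = L2_seminorm f"
    unfolding L2_seminorm_def n2 using integral_matrix(1)[OF invertible_transpose[OF h] fm2] d
    by (simp add: det_transpose)
qed

lemma bounded_integrable_quasi_regular:
  assumes h: "invertible (snd p)" and f: "bounded_integrable f"
  shows "bounded_integrable (quasi_regular p f)"
proof -
  have fi: "integrable lborel f" using f by (simp add: bounded_integrable_def)
  have fm: "f \<in> borel_measurable borel" using fi by auto
  obtain B where B: "\<And>x. norm (f x) \<le> B"
    using f by (auto simp: bounded_integrable_def bounded_iff)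
  have "norm (quasi_regular p f y) \<le> \<bar>det (snd p)\<bar> powr (- 1 / 2) * B" for y
    by (simp add: quasi_regular_def norm_mult B mult_left_mono)
  moreover have "integrable lborel (quasi_regular p f)"
    unfolding quasi_regular_def by (intro integrable_mult_right integral_affine_matrix(2) h fm fi)
  ultimately show ?thesis
    by (auto simp: bounded_integrable_def bounded_iff)
qed

lemma inner_matrix_transpose: "(h *v u) \<bullet> \<xi> = u \<bullet> (transpose h *v \<xi>)" for h :: "real^'n^'m"
  by (metis dot_lmul_matrix inner_commute transpose_matrix_vector)

text \<open>
  Substitute \<open>y = x + h *v u\<close> in the Fourier integral.
\<close>

lemma fourier_quasi_regular:
  assumes h: "invertible (snd p)" and f [measurable]: "f \<in> borel_measurable borel"
  shows "fourier (quasi_regular p f) = dual_regular p (fourier f)"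
proof
  fix \<xi>
  obtain x h where p: "p = (x, h)" by (cases p)
  have h: "invertible h" using assms p by simp
  then have d: "0 < \<bar>det h\<bar>" by (simp add: invertible_det_nz)
  define c where "c = \<bar>det h\<bar> powr (- 1 / 2)"
  have dc: "\<bar>det h\<bar> * c = \<bar>det h\<bar> powr (1 / 2)"
  proof -
    have "\<bar>det h\<bar> powr 1 * c = \<bar>det h\<bar> powr (1 / 2)" unfolding c_def powr_add[symmetric] by simp
    then show ?thesis using d by simp
  qed
  define F where "F u = of_real c * f u * cis (- 2 * pi * ((h *v u + x) \<bullet> \<xi>))" for u
  have Fm: "F \<in> borel_measurable borel" unfolding F_def by measurable
  have "fourier (quasi_regular p f) \<xi> = (\<integral>y. F (matrix_inv h *v (y - x)) \<partial>lborel)"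
    unfolding fourier_def F_def quasi_regular_def p c_def
    by (simp add: matrix_inv_mult_vec(2)[OF h])
  also have "\<dots> = \<bar>det h\<bar> *\<^sub>R (\<integral>u. F u \<partial>lborel)"
    by (rule integral_affine_matrix(1)[OF h Fm])
  also have "(\<integral>u. F u \<partial>lborel) = of_real c * cis (- 2 * pi * (x \<bullet> \<xi>)) * fourier f (transpose h *v \<xi>)"
  proof -
    have "F u = (of_real c * cis (- 2 * pi * (x \<bullet> \<xi>))) * (f u * cis (- 2 * pi * (u \<bullet> (transpose h *v \<xi>))))" for u
    proof -
      have "cis (- 2 * pi * ((h *v u + x) \<bullet> \<xi>)) = cis (- 2 * pi * (x \<bullet> \<xi>)) * cis (- 2 * pi * (u \<bullet> (transpose h *v \<xi>)))"
        unfolding inner_add_left inner_matrix_transpose cis_mult by (simp add: algebra_simps)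
      then show ?thesis by (simp add: F_def)
    qed
    then show ?thesis by (simp add: fourier_def)
  qed
  finally show "fourier (quasi_regular p f) \<xi> = dual_regular p (fourier f) \<xi>"
    by (simp add: dual_regular_def p scaleR_conv_of_real dc[symmetric])
qed

text \<open>
  Both representations are isometric, so the identity extends from bounded integrable functions.
\<close>

theorem plancherel_pair_quasi_regular:
  assumes h: "invertible (snd p)" and f: "plancherel_pair f \<phi>"
  shows "plancherel_pair (quasi_regular p f) (dual_regular p \<phi>)"
proof -
  from f obtain s where s: "\<And>i. bounded_integrable (s i)"
    and 1: "(\<lambda>i. L2_seminorm (\<lambda>x. s i x - f x)) \<longlonglongrightarrow> 0"
    and 2: "(\<lambda>i. L2_seminorm (\<lambda>\<xi>. fourier (s i) \<xi> - \<phi> \<xi>)) \<longlonglongrightarrow> 0"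
    and L: "f \<in> L2" "\<phi> \<in> L2"
    unfolding plancherel_pair_def by blast
  have sm: "s i \<in> borel_measurable borel" for i using s[of i] by (auto simp: bounded_integrable_def)
  have "L2_seminorm (\<lambda>x. quasi_regular p (s i) x - quasi_regular p f x) = L2_seminorm (\<lambda>x. s i x - f x)" for i
  proof -
    have "(\<lambda>x. quasi_regular p (s i) x - quasi_regular p f x) = quasi_regular p (\<lambda>x. s i x - f x)"
      by (simp add: quasi_regular_def fun_eq_iff algebra_simps)
    then show ?thesis
      using quasi_regular_L2(2)[OF h L2_diff[OF bounded_integrable_L2[OF s] L(1)], of i] by simp
  qed
  moreover have "L2_seminorm (\<lambda>x. fourier (quasi_regular p (s i)) x - dual_regular p \<phi> x) = L2_seminorm (\<lambda>x. fourier (s i) x - \<phi> x)" for i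
  proof -
    have "(\<lambda>x. fourier (quasi_regular p (s i)) x - dual_regular p \<phi> x) = dual_regular p (\<lambda>x. fourier (s i) x - \<phi> x)"
      unfolding fourier_quasi_regular[OF h sm] by (simp add: dual_regular_def fun_eq_iff algebra_simps)
    then show ?thesis
      using dual_regular_L2(2)[OF h L2_diff[OF fourier_bounded_integrable_L2(1)[OF s] L(2)], of i] by simp
  qed
  ultimately show ?thesis
    unfolding plancherel_pair_def
    using quasi_regular_L2(1)[OF h L(1)] dual_regular_L2(1)[OF h L(2)] bounded_integrable_quasi_regular[OF h s] 1 2
    by (intro conjI exI[of _ "\<lambda>i. quasi_regular p (s i)"]) auto
qed

section \<open>The regular representation of an irreducible algebra\<close>

lemma first_index_le: "first_index \<le> i"
  unfolding first_index_def by simp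

lemma transpose_nth: "transpose A $ i $ j = A $ j $ i"
  by (simp add: transpose_def)

lemma linear_transpose: "linear (transpose :: real^'n^'m \<Rightarrow> real^'m^'n)"
  by (rule linearI) (simp_all add: vec_eq_iff transpose_def)

lemma mult_axis_nth: "(A *v axis j 1) $ k = A $ k $ j" for A :: "real^'n^'m"
  by (simp add: matrix_vector_mul_component inner_axis)

lemma subspace_nilradical: "subspace (nilradical :: 'a::{real_algebra_1,comm_ring_1} set)"
proof (rule subspaceI)
  show "(0::'a) \<in> nilradical" unfolding nilradical_def by (auto intro: exI[of _ 1])
next
  fix x y :: 'a assume "x \<in> nilradical" "y \<in> nilradical"
  then obtain m n where mn: "x ^ m = 0" "y ^ n = 0" by (auto simp: nilradical_def)
  have "(x + y) ^ (m + n) = (\<Sum>k\<le>m + n. of_nat ((m + n) choose k) * x ^ k * y ^ (m + n - k))"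
    by (rule binomial_ring)
  also have "\<dots> = 0"
  proof (intro sum.neutral ballI)
    fix k assume "k \<in> {..m + n}"
    show "of_nat ((m + n) choose k) * x ^ k * y ^ (m + n - k) = 0"
    proof (cases "m \<le> k")
      case True
      then have "x ^ k = 0" using mn power_add[of x m "k - m"] by simp
      then show ?thesis by simp
    next
      case False
      then have "m + n - k = n + (m - k)" by simp
      then have "y ^ (m + n - k) = 0" using mn by (simp only: power_add) simp
      then show ?thesis by simp
    qed
  qed
  finally show "x + y \<in> nilradical" unfolding nilradical_def by blast
next
  fix c and x :: 'a assume "x \<in> nilradical"
  then obtain m where "x ^ m = 0" by (auto simp: nilradical_def)
  then have "((c *\<^sub>R 1) * x) ^ m = 0" by (simp only: power_mult_distrib mult_zero_right)
  then have "(c *\<^sub>R x) ^ m = 0" by simp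
  then show "c *\<^sub>R x \<in> nilradical" unfolding nilradical_def by blast
qed

lemma nilradical_mult:
  fixes x y :: "'a::comm_ring_1"
  assumes "x \<in> nilradical"
  shows "x * y \<in> nilradical"
proof -
  obtain m where "x ^ m = 0" using assms by (auto simp: nilradical_def)
  then have "(x * y) ^ m = 0" by (simp add: power_mult_distrib)
  then show ?thesis unfolding nilradical_def by blast
qed

lemma one_notin_nilradical: "(1::'a::comm_ring_1) \<notin> nilradical"
  by (simp add: nilradical_def)

locale jordan_hoelder_algebra =
  fixes a :: "'n::{finite,linorder} \<Rightarrow> 'a::{real_algebra_1,comm_ring_1}"
    and \<psi> :: "real^('n::{finite,linorder}) \<Rightarrow> 'a"
    and \<Psi> :: "'a \<Rightarrow> 'n sqmat"
  assumes irreducible: "irreducible_algebra TYPE('a)"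
    and Jordan_Hoelder: "Jordan_Hoelder_basis a"
    and \<psi>_def: "\<psi> = (\<lambda>x. \<Sum>i\<in>UNIV. x $ i *\<^sub>R a i)"
    and \<Psi>: "\<And>b x. inv \<psi> (b * \<psi> x) = \<Psi> b *v x"
begin

lemma a_first: "a first_index = 1"
  and family: "family_basis (- {first_index}) a nilradical"
  and tails: "\<And>k l n y. k < l \<Longrightarrow> n \<in> nilradical \<Longrightarrow> y \<in> span (a ` {k..}) \<Longrightarrow> n * y \<in> span (a ` {k<..})"
  using Jordan_Hoelder by (auto simp: Jordan_Hoelder_basis_def)

lemma a_nilradical: "i \<noteq> first_index \<Longrightarrow> a i \<in> nilradical"
  using family span_base[of "a i" "a ` (- {first_index})"] by (auto simp: family_basis_def)

lemma inj_a: "inj a"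
proof (rule injI)
  fix i j assume eq: "a i = a j"
  have "i = first_index \<longleftrightarrow> j = first_index"
    using eq a_first a_nilradical one_notin_nilradical by metis
  moreover have "i = j" if "i \<noteq> first_index" "j \<noteq> first_index"
    using family eq that by (auto simp: family_basis_def inj_on_def)
  ultimately show "i = j" by blast
qed

lemma range_a: "range a = insert 1 (a ` (- {first_index}))"
  using a_first by (auto simp: image_iff)

lemma independent_a: "independent (range a)"
  unfolding range_a
  using family one_notin_nilradical by (intro independent_insertI) (auto simp: family_basis_def)

lemma span_a: "span (range a) = UNIV"
proof -
  have "x \<in> span (range a)" for x
  proof -
    obtain u n where un: "u \<in> span {1}" "n \<in> nilradical" "x = u + n"
      using irreducible unfolding irreducible_algebra_def by blast
    have "u \<in> span (range a)" using un(1) span_mono[of "{1}" "range a"] by (auto simp: range_a)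
    moreover have "n \<in> span (range a)"
      using un(2) family span_mono[of "a ` (- {first_index})" "range a"] by (auto simp: family_basis_def)
    ultimately show ?thesis unfolding un(3) by (rule span_add)
  qed
  then show ?thesis by auto
qed

lemma linear_\<psi>: "linear \<psi>"
  unfolding \<psi>_def by (rule linearI) (simp_all add: sum.distrib scaleR_left_distrib scaleR_sum_right)

lemma \<psi>_axis: "\<psi> (axis i 1) = a i"
proof -
  have "\<psi> (axis i 1) = (\<Sum>j\<in>UNIV. if j = i then a j else 0)"
    unfolding \<psi>_def by (intro sum.cong) (auto simp: axis_def)
  then show ?thesis by simp
qed

lemma inj_\<psi>: "inj \<psi>"
  unfolding linear_injective_0[OF linear_\<psi>]
proof (intro allI impI)
  fix x assume "\<psi> x = 0"
  then have "(\<Sum>b\<in>range a. x $ (inv a b) *\<^sub>R b) = 0"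
    by (simp add: sum.reindex inj_a \<psi>_def)
  then have "\<forall>b\<in>range a. x $ (inv a b) = 0"
    using independentD[OF independent_a, of "range a" "\<lambda>b. x $ inv a b"] by auto
  then show "x = 0" by (simp add: vec_eq_iff inj_a)
qed

lemma surj_\<psi>: "surj \<psi>"
proof -
  have "span (range a) \<subseteq> range \<psi>"
    by (rule span_minimal) (auto simp: \<psi>_axis[symmetric] linear_\<psi> linear_subspace_image subspace_UNIV)
  then show ?thesis by (simp add: span_a top.extremum_unique)
qed

lemma \<psi>_inv [simp]: "\<psi> (inv \<psi> b) = b" "inv \<psi> (\<psi> x) = x"
  by (simp_all add: surj_\<psi> surj_f_inv_f inj_\<psi>)

lemma linear_inv_\<psi>: "linear (inv \<psi>)"
proof (rule linearI)
  have "\<psi> (inv \<psi> b + inv \<psi> c) = b + c" for b c by (simp add: linear_add[OF linear_\<psi>])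
  then show "inv \<psi> (b + c) = inv \<psi> b + inv \<psi> c" for b c by (metis \<psi>_inv(2))
  have "\<psi> (r *\<^sub>R inv \<psi> b) = r *\<^sub>R b" for r b by (simp add: linear_scale[OF linear_\<psi>])
  then show "inv \<psi> (r *\<^sub>R b) = r *\<^sub>R inv \<psi> b" for r b by (metis \<psi>_inv(2))
qed

lemma inv_\<psi>_a: "inv \<psi> (a i) = axis i 1"
  by (simp flip: \<psi>_axis)

lemma inv_\<psi>_one: "inv \<psi> 1 = axis first_index 1"
  using inv_\<psi>_a[of first_index] by (simp add: a_first)

lemma inv_\<psi>_mult: "inv \<psi> (b * c) = \<Psi> b *v inv \<psi> c"
  using \<Psi>[of b "inv \<psi> c"] by simp

lemma \<Psi>_nth: "\<Psi> b $ k $ j = inv \<psi> (b * a j) $ k"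
  by (simp add: inv_\<psi>_mult inv_\<psi>_a mult_axis_nth)

lemma linear_\<Psi>: "linear \<Psi>"
  by (rule linearI)
    (simp_all add: vec_eq_iff \<Psi>_nth distrib_right linear_add[OF linear_inv_\<psi>] linear_scale[OF linear_inv_\<psi>])

lemma \<Psi>_one: "\<Psi> 1 = mat 1"
  by (simp add: vec_eq_iff \<Psi>_nth inv_\<psi>_a mat_def axis_def)

lemma \<Psi>_mult: "\<Psi> (b * c) = \<Psi> b ** \<Psi> c"
proof -
  have "\<Psi> (b * c) *v x = (\<Psi> b ** \<Psi> c) *v x" for x
    using inv_\<psi>_mult[of "b * c" "\<psi> x"] inv_\<psi>_mult[of b "c * \<psi> x"] inv_\<psi>_mult[of c "\<psi> x"]
    by (simp add: matrix_vector_mul_assoc[symmetric] mult.assoc)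
  then show ?thesis by (simp add: matrix_eq)
qed

lemma \<Psi>_first: "\<Psi> b *v axis first_index 1 = inv \<psi> b"
  using inv_\<psi>_mult[of b 1] by (simp add: inv_\<psi>_one)

lemma inj_\<Psi>: "inj \<Psi>"
  by (rule injI) (metis \<Psi>_first \<psi>_inv(1))

lemma coordinate_tail:
  assumes "b \<in> span (a ` {k<..})" "i \<le> k"
  shows "inv \<psi> b $ i = 0"
proof -
  have "subspace {b. inv \<psi> b $ i = 0}"
    by (rule subspaceI)
      (simp_all add: linear_0[OF linear_inv_\<psi>] linear_add[OF linear_inv_\<psi>] linear_scale[OF linear_inv_\<psi>])
  moreover have "a ` {k<..} \<subseteq> {b. inv \<psi> b $ i = 0}"
    using assms(2) by (auto simp: inv_\<psi>_a axis_def)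
  ultimately show ?thesis
    using assms(1) span_minimal by blast
qed

lemma nilradical_iff: "b \<in> nilradical \<longleftrightarrow> inv \<psi> b $ first_index = 0"
proof
  assume "b \<in> nilradical"
  then have "b \<in> span (a ` (- {first_index}))" using family by (simp add: family_basis_def)
  moreover have "- {first_index} = {first_index :: 'n<..}"
    by (auto simp: less_le first_index_le)
  ultimately show "inv \<psi> b $ first_index = 0"
    by (intro coordinate_tail[OF _ order_refl]) simp
next
  assume 0: "inv \<psi> b $ first_index = 0"
  have "\<psi> (inv \<psi> b) = (\<Sum>i\<in>UNIV. inv \<psi> b $ i *\<^sub>R a i)" by (simp add: \<psi>_def)
  also have "\<dots> \<in> nilradical"
  proof (rule subspace_sum[OF subspace_nilradical])
    fix i
    show "inv \<psi> b $ i *\<^sub>R a i \<in> nilradical"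
      using 0 a_nilradical[of i] subspace_nilradical
      by (cases "i = first_index") (auto simp: subspace_def)
  qed
  finally show "b \<in> nilradical" by simp
qed

text \<open>
  If some index exceeds \<open>j\<close>, or if \<open>k < j\<close>, the condition on Jordan-Hoelder bases applies. If \<open>j = k\<close> is
  the last index, it shows that \<open>n * a j\<close> is a multiple of \<open>a j\<close>, and iterating shows that a power of the
  factor is zero.
\<close>

lemma nilpotent_strictly_lower:
  assumes n: "n \<in> nilradical" and k: "k \<le> j"
  shows "inv \<psi> (n * a j) $ k = 0"
proof (cases "\<exists>l. k < l \<and> k < j \<or> j < l")
  case True
  then show ?thesis
  proof (elim exE disjE conjE)
    fix l assume "j < l"
    then show ?thesis
      using tails[of j l n "a j"] n k coordinate_tail[of "n * a j" j k] span_base[of "a j" "a ` {j..}"] by auto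
  next
    fix l assume "k < l" "k < j"
    then show ?thesis
      using tails[of k l n "a j"] n coordinate_tail[of "n * a j" k k] span_base[of "a j" "a ` {k..}"] by auto
  qed
next
  case False
  have last: "l \<le> j" for l using False by (meson not_le)
  have "\<not> k < j" using False by blast
  with k have kj: "k = j" by simp
  define c where "c = inv \<psi> (n * a j) $ j"
  have "inv \<psi> (n * a j) $ i = 0" if "i < j" for i
    using tails[of i j n "a j"] n that coordinate_tail[of "n * a j" i i] span_base[of "a j" "a ` {i..}"] by auto
  then have "inv \<psi> (n * a j) = c *\<^sub>R axis j 1"
    using last by (auto simp: vec_eq_iff axis_def c_def) (metis le_less)
  then have step: "n * a j = c *\<^sub>R a j"
    by (metis \<psi>_inv(1) \<psi>_axis linear_\<psi> linear_scale)
  obtain m where m: "n ^ m = 0" using n by (auto simp: nilradical_def)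
  have "n ^ m * a j = c ^ m *\<^sub>R a j" for m
    by (induction m) (simp_all add: mult.assoc step mult.left_commute)
  then have "c ^ m *\<^sub>R a j = 0" using m by (metis mult_zero_left)
  moreover have "a j \<noteq> 0" by (metis inv_\<psi>_a linear_0 linear_inv_\<psi> axis_eq_0_iff zero_neq_one)
  ultimately show ?thesis by (simp add: kj c_def)
qed

lemma decompose_first: "b - (inv \<psi> b $ first_index) *\<^sub>R 1 \<in> nilradical"
proof -
  have "inv \<psi> (b - (inv \<psi> b $ first_index) *\<^sub>R 1) = inv \<psi> b - (inv \<psi> b $ first_index) *\<^sub>R axis first_index 1"
    using inv_\<psi>_a[of first_index]
    by (simp add: a_first linear_diff[OF linear_inv_\<psi>] linear_scale[OF linear_inv_\<psi>])
  then show ?thesis unfolding nilradical_iff by (simp add: axis_def)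
qed

text \<open>
  Up to its scalar part, multiplication by \<open>b\<close> is multiplication by a nilpotent element.
\<close>

lemma \<Psi>_triangular: "k < j \<Longrightarrow> \<Psi> b $ k $ j = 0" and \<Psi>_diagonal: "\<Psi> b $ j $ j = inv \<psi> b $ first_index"
proof -
  define c where "c = inv \<psi> b $ first_index"
  define n where "n = b - c *\<^sub>R 1"
  have n: "n \<in> nilradical" unfolding n_def c_def by (rule decompose_first)
  have "b * a j = c *\<^sub>R a j + n * a j" by (simp add: n_def algebra_simps)
  then have "\<Psi> b $ k $ j = c * axis j 1 $ k + inv \<psi> (n * a j) $ k" for k
    by (simp add: \<Psi>_nth linear_add[OF linear_inv_\<psi>] linear_scale[OF linear_inv_\<psi>] inv_\<psi>_a)
  then show "k < j \<Longrightarrow> \<Psi> b $ k $ j = 0" "\<Psi> b $ j $ j = inv \<psi> b $ first_index"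
    using nilpotent_strictly_lower[OF n, of k j] nilpotent_strictly_lower[OF n, of j j]
    by (auto simp: axis_def c_def)
qed

text \<open>
  Transposition makes the matrices upper triangular. It reverses products, but the algebra is
  commutative, so \<open>T\<close> is still multiplicative.
\<close>

definition T :: "'a \<Rightarrow> 'n sqmat" where "T b = transpose (\<Psi> b)"

lemma linear_T: "linear T"
  unfolding T_def using linear_compose[OF linear_\<Psi> linear_transpose] by (simp add: o_def)

lemma T_one: "T 1 = mat 1"
  by (simp add: T_def \<Psi>_one)

lemma T_mult: "T (b * c) = T b ** T c"
  by (metis T_def \<Psi>_mult matrix_transpose_mul mult.commute)

lemma inj_T: "inj T"
  by (rule injI) (metis T_def injD[OF inj_\<Psi>] transpose_transpose)

lemma T_nth: "T (a i) $ j $ k = inv \<psi> (a i * a j) $ k"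
  by (simp add: T_def transpose_nth \<Psi>_nth)

lemma T_lower: "j < i \<Longrightarrow> T b $ i $ j = 0" and T_diagonal: "T b $ i $ i = inv \<psi> b $ first_index"
  by (simp_all add: T_def transpose_nth \<Psi>_triangular \<Psi>_diagonal)

theorem canonical_basis_T: "canonical_basis (T ` nilradical) (\<lambda>i. T (a i))"
proof -
  have B: "inj_on a (- {first_index})" "independent (a ` (- {first_index}))" "span (a ` (- {first_index})) = nilradical"
    using family by (auto simp: family_basis_def)
  have eq: "(\<lambda>i. T (a i)) ` I = T ` (a ` I)" for I by auto
  have "independent (T ` (a ` (- {first_index})))"
    using B inj_T by (intro linear_independent_injective_image linear_T) (auto intro: inj_on_subset)
  moreover have "span (T ` (a ` (- {first_index}))) = T ` nilradical"
    using B linear_span_image[OF linear_T] by metis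
  moreover have "inj_on (\<lambda>i. T (a i)) (- {first_index})"
    using inj_a inj_T by (auto simp: inj_on_def)
  moreover have "transpose (T (a i)) *v axis first_index 1 = axis i 1" for i
    by (simp add: T_def \<Psi>_first inv_\<psi>_a)
  ultimately show ?thesis
    by (simp add: canonical_basis_def family_basis_def eq)
qed

context
  fixes d :: "'n \<Rightarrow> 'n \<Rightarrow> 'n \<Rightarrow> real"
  assumes d: "\<And>i j. a i * a j = (\<Sum>k\<in>UNIV. d i j k *\<^sub>R a k)"
begin

lemma structure_constants: "d i j k = inv \<psi> (a i * a j) $ k"
proof -
  have "a i * a j = \<psi> (\<chi> k. d i j k)" by (simp add: d \<psi>_def)
  then show ?thesis by simp
qed

lemma structure_constants_T: "T (a i) $ j $ k = d i j k"
  by (simp add: T_nth structure_constants)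

lemma structure_constants_commute: "d i j k = d j i k"
  by (simp add: structure_constants mult.commute)

lemma structure_constants_first: "d first_index j k = (if j = k then 1 else 0)"
  by (simp add: structure_constants a_first inv_\<psi>_a axis_def)

lemma structure_constants_zero:
  assumes "i \<noteq> first_index" "j \<noteq> first_index" "k \<le> max i j"
  shows "d i j k = 0"
  using assms nilpotent_strictly_lower[OF a_nilradical[of i], of k j]
    nilpotent_strictly_lower[OF a_nilradical[of j], of k i]
  by (auto simp: structure_constants mult.commute max_def split: if_splits)

lemma structure_constants_expansion:
  assumes i: "i \<noteq> first_index"
  shows "T (a i) = matrix_unit first_index i +
    (\<Sum>j | first_index < j. \<Sum>k | j < k. d i j k *\<^sub>R matrix_unit j k)"
proof -
  have entry: "(\<Sum>j | first_index < j. \<Sum>k | j < k. d i j k *\<^sub>R matrix_unit j k) $ r $ c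
      = (if first_index < r \<and> r < c then d i r c else 0)" for r c
  proof -
    have "(\<Sum>j | first_index < j. \<Sum>k | j < k. d i j k *\<^sub>R matrix_unit j k) $ r $ c
        = (\<Sum>j | first_index < j. \<Sum>k | j < k. if r = j \<and> c = k then d i j k else 0)"
      by (simp add: matrix_unit_def if_distrib cong: if_cong)
    also have "\<dots> = (\<Sum>j | first_index < j. if r = j then (if j < c then d i j c else 0) else 0)"
      by (intro sum.cong refl) (auto simp: sum.delta)
    also have "\<dots> = (if first_index < r \<and> r < c then d i r c else 0)"
      by (simp add: sum.delta)
    finally show ?thesis .
  qed
  have "T (a i) $ r $ c = (matrix_unit first_index i $ r $ c) + (if first_index < r \<and> r < c then d i r c else 0)" for r c
  proof (cases "r = first_index")
    case True
    then show ?thesis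
      by (simp add: structure_constants_T structure_constants_commute[of i first_index] structure_constants_first matrix_unit_def)
  next
    case False
    then have "first_index < r" using first_index_le[of r] by (simp add: le_less)
    then show ?thesis
      using False structure_constants_zero[OF i False, of c]
      by (auto simp: structure_constants_T matrix_unit_def not_less le_max_iff_disj)
  qed
  then show ?thesis
    unfolding vec_eq_iff vector_add_component entry by simp
qed

end

end

section \<open>The matrix groups\<close>

lemma scaleR_matrix_mult_left: "(c *\<^sub>R A) ** B = c *\<^sub>R (A ** B)" for A :: "real^'n^'m" and B :: "real^'k^'n"
  by (simp add: matrix_matrix_mult_def vec_eq_iff sum_distrib_left mult.assoc)

lemma scaleR_matrix_mult_right: "A ** (c *\<^sub>R B) = c *\<^sub>R (A ** B)" for A :: "real^'n^'m" and B :: "real^'k^'n"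
  by (simp add: matrix_matrix_mult_def vec_eq_iff sum_distrib_left mult.left_commute)

lemma bounded_bilinear_matrix_mult: "bounded_bilinear ((**) :: real^'n^'n \<Rightarrow> real^'n^'n \<Rightarrow> real^'n^'n)"
  unfolding bilinear_conv_bounded_bilinear[symmetric] bilinear_def
  by (auto intro!: linearI simp: matrix_add_ldistrib scaleR_matrix_mult_left scaleR_matrix_mult_right)
    (simp add: matrix_matrix_mult_def vec_eq_iff distrib_right sum.distrib)

lemma mat_exp_scaleR_one: "mat_exp (r *\<^sub>R mat 1) = exp r *\<^sub>R (mat 1 :: real^'n^'n)"
proof -
  have "mat_pow (r *\<^sub>R mat 1 :: real^'n^'n) m = r ^ m *\<^sub>R mat 1" for m
    by (induction m) (simp_all add: scaleR_matrix_mult_left)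
  then have "mat_exp (r *\<^sub>R mat 1 :: real^'n^'n) = (\<Sum>m. (inverse (fact m) * r ^ m) *\<^sub>R mat 1)"
    by (simp add: mat_exp_def divide_inverse)
  moreover have "(\<lambda>m. (inverse (fact m) * r ^ m) *\<^sub>R (mat 1 :: real^'n^'n)) sums (exp r *\<^sub>R mat 1)"
    using exp_converges[of r] by (intro sums_scaleR_left) (simp add: divide_inverse)
  ultimately show ?thesis by (simp add: sums_iff)
qed

text \<open>
  A bound, uniform near \<open>t = 0\<close>, that determines the generator of a one-parameter group.
\<close>

lemma mat_exp_first_order:
  fixes X :: "real^'n^'n"
  shows "\<exists>C. \<forall>t. \<bar>t\<bar> \<le> 1 \<longrightarrow> norm (mat_exp (t *\<^sub>R X) - mat 1 - t *\<^sub>R X) \<le> C * t\<^sup>2"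
proof -
  obtain K where K: "0 < K" "\<And>(A :: real^'n^'n) (B :: real^'n^'n). norm (A ** B) \<le> norm A * norm B * K"
    using bounded_bilinear.pos_bounded[OF bounded_bilinear_matrix_mult] by auto
  define r where "r = norm X * K"
  define c where "c = norm (mat 1 :: real^'n^'n)"
  have r: "0 \<le> r" using K by (simp add: r_def)
  have pow: "norm (mat_pow X m) \<le> c * r ^ m" for m
  proof (induction m)
    case (Suc m)
    have "norm (mat_pow X (Suc m)) \<le> norm X * norm (mat_pow X m) * K" using K(2) by simp
    also have "\<dots> \<le> norm X * (c * r ^ m) * K" using Suc K(1) by (intro mult_right_mono mult_left_mono) auto
    finally show ?case by (simp add: r_def mult_ac)
  qed (simp add: c_def)
  have scale: "mat_pow (t *\<^sub>R X) m = t ^ m *\<^sub>R mat_pow X m" for t m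
    by (induction m) (simp_all add: scaleR_matrix_mult_left scaleR_matrix_mult_right)
  define g where "g t m = (1 / fact m) *\<^sub>R mat_pow (t *\<^sub>R X) m" for t m
  have g_le: "norm (g t m) \<le> c * ((\<bar>t\<bar> * r) ^ m / fact m)" for t m
    using mult_left_mono[OF pow[of m], of "\<bar>t\<bar> ^ m / fact m"]
    by (simp add: g_def scale power_abs power_mult_distrib abs_mult field_simps)
  have sum_exp: "summable (\<lambda>m. c * ((\<bar>t\<bar> * r) ^ m / fact m))" for t
    using exp_converges[of "\<bar>t\<bar> * r"] by (intro summable_mult) (simp add: sums_iff divide_inverse mult.commute)
  have summ: "summable (g t)" for t
    by (rule summable_comparison_test[OF _ sum_exp[of t]]) (use g_le in blast)
  define C where "C = (\<Sum>m. c * (r ^ (m + 2) / fact (m + 2)))"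
  have "norm (mat_exp (t *\<^sub>R X) - mat 1 - t *\<^sub>R X) \<le> C * t\<^sup>2" if t: "\<bar>t\<bar> \<le> 1" for t
  proof -
    have "mat_exp (t *\<^sub>R X) = (\<Sum>m. g t (m + 2)) + (\<Sum>m<2. g t m)"
      unfolding mat_exp_def g_def[symmetric] by (rule suminf_split_initial_segment[OF summ])
    also have "(\<Sum>m<2. g t m) = mat 1 + t *\<^sub>R X"
      by (simp add: numeral_2_eq_2 g_def)
    finally have eq: "mat_exp (t *\<^sub>R X) - mat 1 - t *\<^sub>R X = (\<Sum>m. g t (m + 2))" by simp
    have bound: "norm (g t (m + 2)) \<le> (c * (r ^ (m + 2) / fact (m + 2))) * t\<^sup>2" for m
    proof -
      have "\<bar>t\<bar> ^ (m + 2) \<le> t\<^sup>2"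
        using power_le_one[of "\<bar>t\<bar>" m] t mult_right_mono[of "\<bar>t\<bar> ^ m" 1 "t\<^sup>2"]
        unfolding power_add power2_abs by simp
      moreover have "0 \<le> c" by (simp add: c_def)
      ultimately have "(c * (r ^ (m + 2) / fact (m + 2))) * \<bar>t\<bar> ^ (m + 2) \<le> (c * (r ^ (m + 2) / fact (m + 2))) * t\<^sup>2"
        using r by (intro mult_left_mono) auto
      moreover have "c * ((\<bar>t\<bar> * r) ^ (m + 2) / fact (m + 2)) = (c * (r ^ (m + 2) / fact (m + 2))) * \<bar>t\<bar> ^ (m + 2)"
        unfolding power_mult_distrib by (simp only: times_divide_eq_right times_divide_eq_left mult_ac)
      ultimately show ?thesis using g_le[of t "m + 2"] by linarith
    qed
    have sc: "summable (\<lambda>m. c * (r ^ (m + 2) / fact (m + 2)))"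
      using sum_exp[of 1, THEN summable_ignore_initial_segment, of 2] by simp
    have "norm (\<Sum>m. g t (m + 2)) \<le> (\<Sum>m. (c * (r ^ (m + 2) / fact (m + 2))) * t\<^sup>2)"
      using bound by (intro norm_suminf_le summable_mult2 sc)
    also have "\<dots> = C * t\<^sup>2"
      unfolding C_def by (rule suminf_mult2[symmetric]) (rule sc)
    finally show ?thesis unfolding eq .
  qed
  then show ?thesis by blast
qed

lemma matrix_inv_unique:
  fixes A B :: "real^'n^'n"
  assumes "A ** B = mat 1" "B ** A = mat 1"
  shows "matrix_inv A = B"
proof -
  have "invertible A" using assms by (auto simp: invertible_def)
  then have "matrix_inv A ** A = mat 1"
    by (simp add: matrix_eq matrix_vector_mul_assoc[symmetric] matrix_inv_mult_vec)
  then have "matrix_inv A ** (A ** B) = B" by (simp add: matrix_mul_assoc)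
  then show ?thesis using assms by simp
qed

lemma closed_matrix_groupI:
  assumes C: "closed C" and H: "H = GL \<inter> C" and one: "mat 1 \<in> H"
    and mult: "\<And>g h. g \<in> H \<Longrightarrow> h \<in> H \<Longrightarrow> g ** h \<in> H"
    and inv: "\<And>h. h \<in> H \<Longrightarrow> \<exists>g\<in>H. h ** g = mat 1 \<and> g ** h = mat 1"
  shows "closed_matrix_group H"
proof -
  have "matrix_inv h \<in> H" if "h \<in> H" for h
    using inv[OF that] matrix_inv_unique by metis
  moreover have "closedin (top_of_set GL) H"
    unfolding H by (rule closedin_closed_Int[OF C])
  ultimately show ?thesis
    using H one mult by (auto simp: closed_matrix_group_def)
qed

context jordan_hoelder_algebra
begin

text \<open>
  Since \<open>\<xi>\<close> is the first row of \<open>M \<xi>\<close> (\<open>M_row\<close>), this is a linear chart for the matrix groups below.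
\<close>

definition M :: "(real, 'n) vec \<Rightarrow> 'n sqmat" where "M \<xi> = T (\<psi> \<xi>)"

text \<open>
  The product of the algebra in coordinates. By \<open>transpose_M\<close> it is also the dual action of \<open>M \<xi>\<close>, and
  commutativity lets the acting element and the point exchange their roles.
\<close>

definition star :: "(real, 'n) vec \<Rightarrow> (real, 'n) vec \<Rightarrow> (real, 'n) vec" where
  "star \<xi> \<eta> = inv \<psi> (\<psi> \<xi> * \<psi> \<eta>)"

lemma linear_M: "linear M"
  unfolding M_def using linear_compose[OF linear_\<psi> linear_T] by (simp add: o_def)

lemma M_one: "M (axis first_index 1) = mat 1"
  by (simp add: M_def \<psi>_axis a_first T_one)

lemma M_star: "M \<xi> ** M \<eta> = M (star \<xi> \<eta>)"
  by (simp add: M_def star_def T_mult)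

lemma star_commute: "star \<xi> \<eta> = star \<eta> \<xi>"
  by (simp add: star_def mult.commute)

lemma transpose_M: "transpose (M \<xi>) *v \<eta> = star \<xi> \<eta>"
  by (simp add: M_def T_def star_def inv_\<psi>_mult)

lemma star_one: "star \<xi> (axis first_index 1) = \<xi>"
  by (simp add: star_def \<psi>_axis a_first)

lemma M_row: "M \<xi> $ first_index = \<xi>"
proof -
  have "M \<xi> $ first_index $ k = \<xi> $ k" for k
    using star_one[of \<xi>] mult_axis_nth[of "transpose (M \<xi>)" first_index k]
    unfolding transpose_M transpose_nth by simp
  then show ?thesis by (simp add: vec_eq_iff)
qed

lemma M_lower: "j < i \<Longrightarrow> M \<xi> $ i $ j = 0" and M_diagonal: "M \<xi> $ i $ i = \<xi> $ first_index"
  by (simp_all add: M_def T_lower T_diagonal)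

lemma det_M: "det (M \<xi>) = (\<xi> $ first_index) ^ CARD('n)"
  by (subst det_upper_triangular) (simp_all add: M_lower M_diagonal)

lemma invertible_M: "invertible (M \<xi>) \<longleftrightarrow> \<xi> $ first_index \<noteq> 0"
  by (simp add: invertible_det_nz det_M)

lemma star_first: "star \<xi> \<eta> $ first_index = \<xi> $ first_index * \<eta> $ first_index"
proof -
  define b c \<beta> \<gamma> where "b = \<psi> \<xi>" "c = \<psi> \<eta>" "\<beta> = \<xi> $ first_index" "\<gamma> = \<eta> $ first_index"
  have "(b - \<beta> *\<^sub>R 1) * c + (c - \<gamma> *\<^sub>R 1) * (\<beta> *\<^sub>R 1) \<in> nilradical"
    using decompose_first[of b] decompose_first[of c]
    by (intro subspace_add[OF subspace_nilradical] nilradical_mult) (simp_all add: b_c_\<beta>_\<gamma>_def)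
  moreover have "(b - \<beta> *\<^sub>R 1) * c + (c - \<gamma> *\<^sub>R 1) * (\<beta> *\<^sub>R 1) = b * c - (\<beta> * \<gamma>) *\<^sub>R 1"
    by (simp add: algebra_simps)
  ultimately have "inv \<psi> (b * c - (\<beta> * \<gamma>) *\<^sub>R 1) $ first_index = 0"
    by (simp add: nilradical_iff)
  then show ?thesis
    by (simp add: linear_diff[OF linear_inv_\<psi>] linear_scale[OF linear_inv_\<psi>] inv_\<psi>_one star_def b_c_\<beta>_\<gamma>_def)
qed

lemma star_inverse:
  assumes "\<xi> $ first_index \<noteq> 0"
  shows "\<exists>\<eta>. star \<xi> \<eta> = axis first_index 1 \<and> \<eta> $ first_index = inverse (\<xi> $ first_index)"
proof -
  have "invertible (transpose (M \<xi>))" using assms by (simp add: invertible_M invertible_transpose)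
  then have 1: "star \<xi> (matrix_inv (transpose (M \<xi>)) *v axis first_index 1) = axis first_index 1" (is "star \<xi> ?\<eta> = _")
    unfolding transpose_M[symmetric] by (rule matrix_inv_mult_vec(2))
  then have "\<xi> $ first_index * ?\<eta> $ first_index = 1"
    using star_first[of \<xi> ?\<eta>] by simp
  with 1 show ?thesis
    by (metis inverse_unique)
qed

definition unit_group :: "'n sqmat set" where "unit_group = M ` {\<xi>. \<xi> $ first_index \<noteq> 0}"

definition shear_group :: "'n sqmat set" where "shear_group = M ` {\<xi>. \<xi> $ first_index = 1}"

lemma closed_range_M: "closed (range M)"
  by (intro closed_subspace linear_subspace_image linear_M subspace_UNIV)

lemma invertible_unit_group: "h \<in> unit_group \<Longrightarrow> invertible h"
  by (auto simp: unit_group_def invertible_M)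

lemma closed_matrix_group_unit_group: "closed_matrix_group unit_group"
proof (rule closed_matrix_groupI[OF closed_range_M])
  show "unit_group = GL \<inter> range M"
    by (auto simp: unit_group_def GL_def invertible_M)
  show "mat 1 \<in> unit_group"
    unfolding unit_group_def by (rule image_eqI[where x="axis first_index 1"], rule M_one[symmetric]) (simp add: axis_def)
  show "g ** h \<in> unit_group" if "g \<in> unit_group" "h \<in> unit_group" for g h
    using that by (auto simp: unit_group_def M_star star_first)
  show "\<exists>g\<in>unit_group. h ** g = mat 1 \<and> g ** h = mat 1" if h: "h \<in> unit_group" for h
  proof -
    obtain \<xi> where \<xi>: "h = M \<xi>" "\<xi> $ first_index \<noteq> 0" using h by (auto simp: unit_group_def)
    then obtain \<eta> where \<eta>: "star \<xi> \<eta> = axis first_index 1" "\<eta> $ first_index = inverse (\<xi> $ first_index)"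
      using star_inverse by blast
    then show ?thesis
      using \<xi> by (intro bexI[of _ "M \<eta>"]) (auto simp: M_star M_one star_commute[of \<eta>] unit_group_def)
  qed
qed

lemma continuous_on_nth2: "continuous_on A (\<lambda>A :: 'n sqmat. A $ i $ j)"
  by (intro continuous_on_component continuous_on_id)

lemma closed_matrix_group_shear_group: "closed_matrix_group shear_group"
proof (rule closed_matrix_groupI)
  show "closed (range M \<inter> {A. A $ first_index $ first_index = 1})"
    by (intro closed_Int closed_range_M closed_Collect_eq continuous_on_nth2 continuous_on_const)
  show "shear_group = GL \<inter> (range M \<inter> {A. A $ first_index $ first_index = 1})"
    by (auto simp: shear_group_def GL_def invertible_M M_diagonal)
  show "mat 1 \<in> shear_group"
    unfolding shear_group_def by (rule image_eqI[where x="axis first_index 1"], rule M_one[symmetric]) (simp add: axis_def)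
  show "g ** h \<in> shear_group" if "g \<in> shear_group" "h \<in> shear_group" for g h
    using that by (auto simp: shear_group_def M_star star_first)
  show "\<exists>g\<in>shear_group. h ** g = mat 1 \<and> g ** h = mat 1" if h: "h \<in> shear_group" for h
  proof -
    obtain \<xi> where \<xi>: "h = M \<xi>" "\<xi> $ first_index = 1" using h by (auto simp: shear_group_def)
    then obtain \<eta> where \<eta>: "star \<xi> \<eta> = axis first_index 1" "\<eta> $ first_index = inverse (\<xi> $ first_index)"
      using star_inverse[of \<xi>] by auto
    then show ?thesis
      using \<xi> by (intro bexI[of _ "M \<eta>"]) (auto simp: M_star M_one star_commute[of \<eta>] shear_group_def)
  qed
qed

lemma connected_shear_group: "connected shear_group"
proof -
  have "convex {\<xi> :: (real, 'n) vec. \<xi> $ first_index = 1}"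
    by (auto simp: convex_def algebra_simps)
  then show ?thesis
    unfolding shear_group_def by (intro convex_connected convex_linear_image linear_M)
qed

lemma shear_group_unitriangular: "shear_group \<subseteq> unitriangular"
  by (auto simp: shear_group_def unitriangular_def M_lower M_diagonal)

lemma shear_group_commute: "g \<in> shear_group \<Longrightarrow> h \<in> shear_group \<Longrightarrow> g ** h = h ** g"
  by (auto simp: shear_group_def M_star star_commute)

definition dilations :: "'n sqmat set" where "dilations = range (\<lambda>r. exp r *\<^sub>R mat 1)"

lemma mat_one_first: "(mat 1 :: 'n sqmat) $ first_index $ first_index = 1"
  by (simp add: mat_def)

lemma scale_one_M: "c *\<^sub>R mat 1 = M (c *\<^sub>R axis first_index 1)"
  by (simp add: linear_scale[OF linear_M] M_one)

lemma dilations_subset: "dilations \<subseteq> unit_group"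
  by (auto simp: dilations_def unit_group_def scale_one_M axis_def)

lemma closed_matrix_group_dilations: "closed_matrix_group dilations"
proof (rule closed_matrix_groupI)
  show "closed (span {mat 1} \<inter> {A :: 'n sqmat. 0 \<le> A $ first_index $ first_index})"
    by (intro closed_Int closed_span closed_Collect_le continuous_on_nth2 continuous_on_const)
  show "dilations = GL \<inter> (span {mat 1} \<inter> {A. 0 \<le> A $ first_index $ first_index})"
  proof (intro equalityI subsetI)
    fix A assume "A \<in> GL \<inter> (span {mat 1} \<inter> {A :: 'n sqmat. 0 \<le> A $ first_index $ first_index})"
    then have A: "A \<in> span {mat 1}" "0 \<le> A $ first_index $ first_index" "invertible A"
      by (auto simp: GL_def)
    then obtain c where "A = c *\<^sub>R mat 1" by (auto simp: span_singleton)
    with A have c: "A = c *\<^sub>R mat 1" "0 \<le> c" "invertible A" by (auto simp: mat_one_first)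
    have "c \<noteq> 0" using c(1,3) by (auto simp: scale_one_M invertible_M)
    then show "A \<in> dilations"
      using c by (auto simp: dilations_def intro!: image_eqI[of _ _ "ln c"])
  qed (use dilations_subset invertible_unit_group in \<open>auto simp: dilations_def span_singleton GL_def mat_one_first\<close>)
  show "mat 1 \<in> dilations"
    unfolding dilations_def by (rule image_eqI[of _ _ 0]) auto
  show "g ** h \<in> dilations" if gh: "g \<in> dilations" "h \<in> dilations" for g h
  proof -
    obtain r s where "g = exp r *\<^sub>R mat 1" "h = exp s *\<^sub>R mat 1"
      using gh by (auto simp: dilations_def)
    then have "g ** h = exp (s + r) *\<^sub>R mat 1"
      by (simp add: scaleR_matrix_mult_left scaleR_matrix_mult_right exp_add)
    then show ?thesis unfolding dilations_def by (rule image_eqI) simp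
  qed
  show "\<exists>g\<in>dilations. h ** g = mat 1 \<and> g ** h = mat 1" if h: "h \<in> dilations" for h
  proof -
    obtain r where r: "h = exp r *\<^sub>R mat 1" using h by (auto simp: dilations_def)
    then show ?thesis
      by (intro bexI[of _ "exp (- r) *\<^sub>R mat 1"])
        (auto simp: dilations_def scaleR_matrix_mult_left scaleR_matrix_mult_right simp flip: exp_add)
  qed
qed

text \<open>
  Comparing the diagonal entries in the first row shows that \<open>\<epsilon>\<close> is the sign of the first coordinate of
  \<open>h\<close> and that \<open>g\<close> is the scalar matrix of its modulus.
\<close>

lemma unit_group_decomposition:
  assumes "h \<in> unit_group"
  shows "\<exists>!(\<epsilon>, g, s). \<epsilon> \<in> {1, - 1 :: real} \<and> g \<in> dilations \<and> s \<in> shear_group \<and> h = \<epsilon> *\<^sub>R (g ** s)"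
proof -
  obtain \<xi> where \<xi>: "h = M \<xi>" "\<xi> $ first_index \<noteq> 0" using assms by (auto simp: unit_group_def)
  define c where "c = \<xi> $ first_index"
  have c: "c \<noteq> 0" using \<xi> by (simp add: c_def)
  define s0 where "s0 = M ((1 / c) *\<^sub>R \<xi>)"
  show ?thesis
  proof (rule ex1I[of _ "(sgn c, exp (ln \<bar>c\<bar>) *\<^sub>R mat 1, s0)"], clarify, intro conjI)
    show "sgn c \<in> {1, - 1}" using c by (auto simp: sgn_if)
    show "exp (ln \<bar>c\<bar>) *\<^sub>R mat 1 \<in> dilations" unfolding dilations_def by (rule rangeI)
    show "s0 \<in> shear_group" using c by (auto simp: s0_def shear_group_def c_def)
    show "h = sgn c *\<^sub>R (exp (ln \<bar>c\<bar>) *\<^sub>R mat 1 ** s0)"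
      using c by (simp add: s0_def \<xi>(1) scaleR_matrix_mult_left linear_scale[OF linear_M] sgn_if)
  next
    fix z :: "real \<times> 'n sqmat \<times> 'n sqmat"
    obtain \<epsilon> g s where z: "z = (\<epsilon>, g, s)" by (cases z)
    assume "case z of (\<epsilon>, g, s) \<Rightarrow> \<epsilon> \<in> {1, - 1} \<and> g \<in> dilations \<and> s \<in> shear_group \<and> h = \<epsilon> *\<^sub>R (g ** s)"
    then have e: "\<epsilon> = 1 \<or> \<epsilon> = - 1" and "g \<in> dilations" and s: "s \<in> shear_group" and h: "h = \<epsilon> *\<^sub>R (g ** s)"
      by (auto simp: z)
    then obtain r where r: "g = exp r *\<^sub>R mat 1" by (auto simp: dilations_def)
    have h2: "h = (\<epsilon> * exp r) *\<^sub>R s" by (simp add: h r scaleR_matrix_mult_left)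
    have "s $ first_index $ first_index = 1" using s by (auto simp: shear_group_def M_diagonal)
    then have "h $ first_index $ first_index = \<epsilon> * exp r" by (simp add: h2)
    then have ce: "c = \<epsilon> * exp r" by (simp add: \<xi>(1) M_diagonal c_def)
    have abs: "\<bar>c\<bar> = exp r" and sgn: "sgn c = \<epsilon>"
      using e by (auto simp: ce sgn_mult abs_mult)
    have "s0 = s"
      using c h2 \<xi>(1) by (simp add: s0_def linear_scale[OF linear_M] ce[symmetric])
    then show "z = (sgn c, exp (ln \<bar>c\<bar>) *\<^sub>R mat 1, s0)"
      by (simp add: z sgn abs r)
  qed
qed

lemma shear_group_eq: "shear_group = {mat 1 + T b |b. b \<in> nilradical}"
proof (intro equalityI subsetI)
  fix A assume "A \<in> shear_group"
  then obtain \<xi> where \<xi>: "A = M \<xi>" "\<xi> $ first_index = 1" by (auto simp: shear_group_def)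
  have "\<psi> \<xi> - 1 \<in> nilradical" using decompose_first[of "\<psi> \<xi>"] \<xi>(2) by simp
  moreover have "A = mat 1 + T (\<psi> \<xi> - 1)"
    by (simp add: \<xi>(1) M_def linear_diff[OF linear_T] T_one)
  ultimately show "A \<in> {mat 1 + T b |b. b \<in> nilradical}" by blast
next
  fix A assume "A \<in> {mat 1 + T b |b. b \<in> nilradical}"
  then obtain b where b: "A = mat 1 + T b" "b \<in> nilradical" by blast
  have "A = M (inv \<psi> (1 + b))" by (simp add: b(1) M_def linear_add[OF linear_T] T_one)
  moreover have "inv \<psi> (1 + b) $ first_index = 1"
    using b(2) by (simp add: linear_add[OF linear_inv_\<psi>] inv_\<psi>_one nilradical_iff)
  ultimately show "A \<in> shear_group" by (auto simp: shear_group_def)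
qed

text \<open>
  The exponential series of a nilpotent element is a finite sum in the algebra. Conversely, the
  difference quotients of the one-parameter group generated by \<open>X\<close> lie in the closed subspace
  \<open>T ` nilradical\<close> and converge to \<open>X\<close>.
\<close>

theorem lie_algebra_shear_group: "matrix_lie_algebra shear_group = T ` nilradical"
proof (intro equalityI subsetI)
  fix X assume "X \<in> T ` nilradical"
  then obtain b where b: "X = T b" "b \<in> nilradical" by blast
  obtain m where m: "b ^ m = 0" using b(2) by (auto simp: nilradical_def)
  have pow: "mat_pow (t *\<^sub>R X) k = T (t ^ k *\<^sub>R b ^ k)" for t k
  proof (induction k)
    case (Suc k)
    then show ?case
      by (simp add: b(1) linear_scale[OF linear_T] scaleR_matrix_mult_left scaleR_matrix_mult_right flip: T_mult)
  qed (simp add: T_one)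
  have "mat_exp (t *\<^sub>R X) \<in> shear_group" for t
  proof -
    define f where "f k = (1 / fact k) *\<^sub>R (t ^ k *\<^sub>R b ^ k)" for k
    have fz: "f k = 0" if "m \<le> k" for k
      using m that power_add[of b m "k - m"] by (simp add: f_def)
    have "mat_exp (t *\<^sub>R X) = (\<Sum>k. T (f k))"
      by (simp add: mat_exp_def pow f_def linear_scale[OF linear_T])
    also have "\<dots> = (\<Sum>k<Suc m. T (f k))"
      by (rule suminf_finite) (auto simp: fz linear_0[OF linear_T])
    also have "\<dots> = T (f 0) + T (\<Sum>k<m. f (Suc k))"
      by (subst sum.lessThan_Suc_shift) (simp add: linear_sum[OF linear_T] o_def)
    also have "T (f 0) = mat 1" by (simp add: f_def T_one)
    finally have "mat_exp (t *\<^sub>R X) = mat 1 + T (\<Sum>k<m. f (Suc k))" .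
    moreover have "(\<Sum>k<m. f (Suc k)) \<in> nilradical"
    proof (rule subspace_sum[OF subspace_nilradical])
      fix k
      have "f (Suc k) = b * ((1 / fact (Suc k) * t ^ Suc k) *\<^sub>R b ^ k)" by (simp add: f_def)
      then show "f (Suc k) \<in> nilradical" using nilradical_mult[OF b(2)] by metis
    qed
    ultimately show ?thesis unfolding shear_group_eq by blast
  qed
  then show "X \<in> matrix_lie_algebra shear_group" by (simp add: matrix_lie_algebra_def)
next
  fix X assume X: "X \<in> matrix_lie_algebra shear_group"
  obtain C where C: "\<And>t. \<bar>t\<bar> \<le> 1 \<Longrightarrow> norm (mat_exp (t *\<^sub>R X) - mat 1 - t *\<^sub>R X) \<le> C * t\<^sup>2"
    using mat_exp_first_order[of X] by blast
  have sub: "subspace (T ` nilradical)"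
    by (rule linear_subspace_image[OF linear_T subspace_nilradical])
  define Z where "Z k = real (Suc k) *\<^sub>R (mat_exp (inverse (real (Suc k)) *\<^sub>R X) - mat 1)" for k
  have ZT: "Z k \<in> T ` nilradical" for k
  proof -
    have "mat_exp (inverse (real (Suc k)) *\<^sub>R X) \<in> shear_group"
      using X by (simp add: matrix_lie_algebra_def)
    then have "mat_exp (inverse (real (Suc k)) *\<^sub>R X) - mat 1 \<in> T ` nilradical"
      by (auto simp: shear_group_eq)
    then show ?thesis unfolding Z_def by (rule subspace_scale[OF sub])
  qed
  have "Z \<longlonglongrightarrow> X"
  proof (rule LIM_zero_cancel, rule Lim_null_comparison[OF always_eventually])
    show "\<forall>k. norm (Z k - X) \<le> C * inverse (real (Suc k))"
    proof
      fix k
      define t where "t = inverse (real (Suc k))"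
      have t: "0 < t" "t \<le> 1" "real (Suc k) = 1 / t" by (auto simp: t_def field_simps)
      have "Z k = real (Suc k) *\<^sub>R (mat_exp (t *\<^sub>R X) - mat 1)"
        by (simp only: Z_def t_def)
      then have "Z k - X = (1 / t) *\<^sub>R (mat_exp (t *\<^sub>R X) - mat 1 - t *\<^sub>R X)"
        unfolding t(3) using t(1) by (simp add: scaleR_diff_right)
      then have "norm (Z k - X) = (1 / t) * norm (mat_exp (t *\<^sub>R X) - mat 1 - t *\<^sub>R X)"
        using t(1) by simp
      also have "\<dots> \<le> (1 / t) * (C * t\<^sup>2)"
        using t by (intro mult_left_mono C) auto
      also have "\<dots> = C * t" using t(1) by (simp add: power2_eq_square)
      finally show "norm (Z k - X) \<le> C * inverse (real (Suc k))" by (simp add: t_def)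
    qed
    show "(\<lambda>k. C * inverse (real (Suc k))) \<longlonglongrightarrow> 0"
      by (intro tendsto_mult_right_zero LIMSEQ_inverse_real_of_nat)
  qed
  then show "X \<in> T ` nilradical"
    by (rule closed_sequentially[OF closed_subspace[OF sub] ZT])
qed

section \<open>Irreducibility\<close>

lemma bounded_bilinear_star: "bounded_bilinear star"
  unfolding bilinear_conv_bounded_bilinear[symmetric] bilinear_def star_def
  by (auto intro!: linearI simp: distrib_left distrib_right linear_add[OF linear_\<psi>] linear_scale[OF linear_\<psi>]
    linear_add[OF linear_inv_\<psi>] linear_scale[OF linear_inv_\<psi>])

lemma star_measurable [measurable (raw)]:
  assumes [measurable]: "f \<in> borel_measurable N" "g \<in> borel_measurable N"
  shows "(\<lambda>x. star (f x) (g x)) \<in> borel_measurable N"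
proof -
  have "continuous_on UNIV (\<lambda>x. star (fst x) (snd x))"
    by (intro bounded_bilinear.continuous_on[OF bounded_bilinear_star] continuous_intros)
  then show ?thesis by (rule borel_measurable_continuous_Pair[OF assms])
qed

lemma AE_first_neq_0: "AE \<xi> in lborel. (\<xi> :: (real, 'n) vec) $ first_index \<noteq> 0"
proof -
  have "axis first_index 1 \<in> (Basis :: (real, 'n) vec set)" by (simp add: axis_in_Basis_iff)
  from AE_lborel_inner_neq[OF this, of 0] show ?thesis by (simp add: inner_axis)
qed

lemma AE_star:
  assumes "\<zeta> $ first_index \<noteq> 0" "Measurable.pred borel P"
  shows "(AE \<xi> in lborel. P (star \<zeta> \<xi>)) \<longleftrightarrow> (AE \<xi> in lborel. P \<xi>)"
proof -
  have "invertible (transpose (M \<zeta>))" using assms(1) by (simp add: invertible_M invertible_transpose)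
  from AE_matrix[OF this assms(2)] show ?thesis unfolding transpose_M .
qed

lemma dual_regular_M:
  "dual_regular (x, M \<zeta>) \<phi> = (\<lambda>\<xi>. of_real (\<bar>det (M \<zeta>)\<bar> powr (1 / 2)) * cis (- 2 * pi * (x \<bullet> \<xi>)) * \<phi> (star \<zeta> \<xi>))"
  unfolding dual_regular_def fst_conv snd_conv transpose_M ..

text \<open>
  Up to a nonzero factor and a reflection, the matrix coefficient as a function of \<open>x\<close> is the Fourier
  transform of the product. So the product is zero almost everywhere.
\<close>

lemma orthogonal_orbit_product:
  assumes f: "plancherel_pair f \<phi>" and g: "plancherel_pair g \<gamma>"
    and \<zeta>: "\<zeta> $ first_index \<noteq> 0"
    and zero: "\<And>x. L2_inner g (quasi_regular (x, M \<zeta>) f) = 0"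
  shows "AE \<xi> in lborel. \<gamma> \<xi> * cnj (\<phi> (star \<zeta> \<xi>)) = 0"
proof -
  have inv: "invertible (M \<zeta>)" using \<zeta> by (simp add: invertible_M)
  define c where "c = \<bar>det (M \<zeta>)\<bar> powr (1 / 2)"
  have c: "c \<noteq> 0" using inv by (simp add: c_def invertible_det_nz)
  have L: "\<gamma> \<in> L2" "\<phi> \<in> L2" using f g by (auto simp: plancherel_pair_def)
  define w where "w \<xi> = of_real c * (\<gamma> \<xi> * cnj (\<phi> (star \<zeta> \<xi>)))" for \<xi>
  have "integrable lborel (\<lambda>\<xi>. \<gamma> \<xi> * cnj (dual_regular (0, M \<zeta>) \<phi> \<xi>))"
    using inv by (intro L2_inner_integrable L dual_regular_L2) simp
  then have w: "integrable lborel w"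
    by (simp add: w_def[abs_def] dual_regular_M c_def mult_ac)
  have "fourier w \<eta> = 0" for \<eta>
  proof -
    have "L2_inner g (quasi_regular (- \<eta>, M \<zeta>) f) = L2_inner \<gamma> (dual_regular (- \<eta>, M \<zeta>) \<phi>)"
      using inv by (intro plancherel_pair_inner g plancherel_pair_quasi_regular f) simp
    also have "\<dots> = fourier w \<eta>"
      unfolding L2_inner_def fourier_def
      by (intro Bochner_Integration.integral_cong)
        (simp_all add: dual_regular_M w_def c_def cis_cnj inner_commute mult_ac)
    finally show ?thesis using zero by simp
  qed
  then have "AE \<xi> in lborel. w \<xi> = 0" by (rule fourier_eq_zero_imp_AE[OF w])
  then show ?thesis by eventually_elim (use c in \<open>simp add: w_def\<close>)
qed

text \<open>
  If the transform \<open>\<gamma>\<close> of a function orthogonal to \<open>V\<close> is not null, then Fubini yields one point \<open>\<xi>\<close> of the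
  open orbit at which \<open>\<phi> (star \<zeta> \<xi>) = 0\<close> for almost all \<open>\<zeta>\<close>. As \<open>\<lambda>\<zeta>. star \<zeta> \<xi>\<close> is an invertible linear map,
  \<open>\<phi>\<close> vanishes almost everywhere, and so does every member of \<open>V\<close>.
\<close>

theorem quasi_regular_irreducible_unit_group: "quasi_regular_irreducible unit_group"
  unfolding quasi_regular_irreducible_def
proof (intro allI impI, elim conjE)
  fix V :: "((real, 'n) vec \<Rightarrow> complex) set"
  assume V: "closed_L2_subspace V" and invariant: "\<forall>p\<in>UNIV \<times> unit_group. \<forall>f\<in>V. quasi_regular p f \<in> V"
  have V0: "(\<lambda>_. 0) \<in> V" and VL: "V \<subseteq> L2" using V by (auto simp: closed_L2_subspace_def)
  have "V = L2_null" if ne: "V \<noteq> L2"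
  proof
    show "L2_null \<subseteq> V"
    proof
      fix f :: "(real, 'n) vec \<Rightarrow> complex" assume f: "f \<in> L2_null"
      then have fL: "f \<in> L2" by (simp add: L2_null_def)
      have "L2_seminorm (\<lambda>x. f x - 0) = 0" using f L2_null_iff[OF fL] by simp
      then have "\<exists>g\<in>V. L2_seminorm (\<lambda>x. f x - g x) < \<epsilon>" if "0 < \<epsilon>" for \<epsilon>
        using V0 that by (intro bexI[of _ "\<lambda>_. 0"]) auto
      then show "f \<in> V" using V fL by (simp add: closed_L2_subspace_def)
    qed
    obtain g where g: "g \<in> L2" "g \<notin> L2_null" "\<And>v. v \<in> V \<Longrightarrow> L2_inner g v = 0"
      using closed_L2_subspace_orthogonal[OF V ne] by blast
    obtain \<gamma> where \<gamma>: "plancherel_pair g \<gamma>" using plancherel_pair_exists[OF g(1)] by blast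
    have \<gamma>L: "\<gamma> \<in> L2" using \<gamma> by (simp add: plancherel_pair_def)
    have \<gamma>m [measurable]: "\<gamma> \<in> borel_measurable borel" using \<gamma>L by (rule L2_measurable)
    have \<gamma>0: "\<not> (AE \<xi> in lborel. \<gamma> \<xi> = 0)"
      using g(1,2) \<gamma>L plancherel_pair_norm[OF \<gamma>] L2_null_iff[OF g(1)] L2_null_iff[OF \<gamma>L]
      by (auto simp: L2_null_def)
    show "V \<subseteq> L2_null"
    proof
      fix f assume f: "f \<in> V"
      have fL: "f \<in> L2" using f VL by auto
      obtain \<phi> where \<phi>: "plancherel_pair f \<phi>" using plancherel_pair_exists[OF fL] by blast
      have \<phi>L: "\<phi> \<in> L2" using \<phi> by (simp add: plancherel_pair_def)
      have \<phi>m [measurable]: "\<phi> \<in> borel_measurable borel" using \<phi>L by (rule L2_measurable)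
      have "AE \<zeta> in lborel. AE \<xi> in lborel. \<gamma> \<xi> * cnj (\<phi> (star \<zeta> \<xi>)) = 0"
        using AE_first_neq_0
      proof eventually_elim
        case (elim \<zeta>)
        have "L2_inner g (quasi_regular (x, M \<zeta>) f) = 0" for x
          using invariant f elim by (intro g(3)) (auto simp: unit_group_def)
        then show ?case by (rule orthogonal_orbit_product[OF \<phi> \<gamma> elim])
      qed
      then have "AE \<xi> in lborel. AE \<zeta> in lborel. \<gamma> \<xi> * cnj (\<phi> (star \<zeta> \<xi>)) = 0"
        by (subst lborel_pair.AE_commute) measurable
      moreover have "AE \<xi> in lborel. \<gamma> \<xi> = 0"
        if "\<And>\<xi>. \<xi> $ first_index \<noteq> 0 \<Longrightarrow> AE \<zeta> in lborel. \<gamma> \<xi> * cnj (\<phi> (star \<zeta> \<xi>)) = 0 \<Longrightarrow> \<gamma> \<xi> = 0"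
        using calculation AE_first_neq_0 by eventually_elim (rule that)
      ultimately obtain \<xi> where \<xi>: "\<xi> $ first_index \<noteq> 0" "AE \<zeta> in lborel. \<gamma> \<xi> * cnj (\<phi> (star \<zeta> \<xi>)) = 0" "\<gamma> \<xi> \<noteq> 0"
        using \<gamma>0 by blast
      have "AE \<zeta> in lborel. \<phi> (star \<xi> \<zeta>) = 0"
        using \<xi>(2) by eventually_elim (use \<xi>(3) in \<open>simp add: star_commute\<close>)
      then have "AE \<zeta> in lborel. \<phi> \<zeta> = 0"
        by (subst (asm) AE_star[OF \<xi>(1)]) measurable
      then have "L2_seminorm \<phi> = 0"
        using \<phi>L L2_null_iff[OF \<phi>L] by (simp add: L2_null_def)
      then show "f \<in> L2_null"
        using L2_null_iff[OF fL] plancherel_pair_norm[OF \<phi>] by simp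
    qed
  qed
  then show "V = L2_null \<or> V = L2" by blast
qed

section \<open>Haar measure\<close>

text \<open>
  A chart of the semidirect product. Its value for a vanishing first coordinate is immaterial, since
  that happens on a null set; the identity matrix keeps the value inside the group.
\<close>

definition group_point :: "(real, 'n) vec \<times> (real, 'n) vec \<Rightarrow> (real, 'n) vec \<times> 'n sqmat" where
  "group_point p = (fst p, if snd p $ first_index = 0 then mat 1 else M (snd p))"

text \<open>
  One factor \<open>1 / \<bar>det (M \<xi>)\<bar>\<close> turns Lebesgue measure into Haar measure of the unit group, and the other
  one compensates for the action on the translations.
\<close>

definition haar_density :: "(real, 'n) vec \<Rightarrow> real" where
  "haar_density \<xi> = 1 / (det (M \<xi>))\<^sup>2"

definition haar :: "((real, 'n) vec \<times> 'n sqmat) measure" where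
  "haar = distr (density lborel (\<lambda>p. ennreal (haar_density (snd p)))) (restrict_space borel (UNIV \<times> unit_group)) group_point"

lemma nth_measurable [measurable (raw)]:
  assumes "f \<in> borel_measurable N"
  shows "(\<lambda>x. (f x :: (real, 'n) vec) $ i) \<in> borel_measurable N"
proof -
  have "(\<lambda>v :: (real, 'n) vec. v $ i) \<in> borel_measurable borel"
    by (intro borel_measurable_continuous_onI continuous_on_component continuous_on_id)
  then show ?thesis using assms by (rule measurable_compose[rotated])
qed

lemma M_measurable [measurable (raw)]:
  assumes "f \<in> borel_measurable N"
  shows "(\<lambda>x. M (f x)) \<in> borel_measurable N"
proof -
  have "M \<in> borel_measurable borel"
    by (intro borel_measurable_continuous_onI linear_continuous_on linear_conv_bounded_linear[THEN iffD1] linear_M)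
  then show ?thesis using assms by (rule measurable_compose[rotated])
qed

lemma haar_density_measurable [measurable]: "haar_density \<in> borel_measurable borel"
  unfolding haar_density_def[abs_def] det_M by measurable

lemma haar_density_pos: "\<xi> $ first_index \<noteq> 0 \<Longrightarrow> 0 < haar_density \<xi>"
  by (simp add: haar_density_def det_M)

lemma haar_density_star:
  assumes "\<zeta> $ first_index \<noteq> 0"
  shows "(det (M \<zeta>))\<^sup>2 * haar_density (star \<zeta> \<xi>) = haar_density \<xi>"
  using assms by (simp add: haar_density_def det_M star_first power_mult_distrib)

lemma unit_group_first: "g \<in> unit_group \<Longrightarrow> g $ first_index $ first_index \<noteq> 0"
  by (auto simp: unit_group_def M_diagonal)

lemma group_point_in: "group_point p \<in> UNIV \<times> unit_group"
proof -
  have "mat 1 \<in> unit_group"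
    using closed_matrix_group_unit_group by (simp add: closed_matrix_group_def)
  then show ?thesis by (auto simp: group_point_def unit_group_def)
qed

lemma group_point_measurable: "group_point \<in> borel_measurable borel"
  unfolding group_point_def[abs_def] borel_prod[symmetric] by measurable

lemma group_point_measurable_restrict:
  "group_point \<in> density lborel f \<rightarrow>\<^sub>M restrict_space borel (UNIV \<times> unit_group)"
  using group_point_measurable group_point_in by (intro measurable_restrict_space2) auto

lemma space_haar: "space haar = UNIV \<times> unit_group"
  by (simp add: haar_def space_restrict_space)

lemma sets_haar: "sets haar = sets (restrict_space borel (UNIV \<times> unit_group))"
  by (simp add: haar_def)

lemma nn_integral_haar:
  assumes f: "f \<in> borel_measurable (restrict_space borel (UNIV \<times> unit_group))"
  shows "(\<integral>\<^sup>+p. f p \<partial>haar) = (\<integral>\<^sup>+\<xi>. ennreal (haar_density \<xi>) * (\<integral>\<^sup>+x. f (group_point (x, \<xi>)) \<partial>lborel) \<partial>lborel)"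
proof -
  have m: "(\<lambda>p. f (group_point p)) \<in> borel_measurable borel"
    by (rule measurable_compose[OF _ f])
      (use group_point_measurable group_point_in in \<open>auto intro!: measurable_restrict_space2\<close>)
  then have [measurable]: "(\<lambda>p. f (group_point p)) \<in> borel_measurable (lborel \<Otimes>\<^sub>M lborel)"
    by (simp add: lborel_prod)
  have "(\<integral>\<^sup>+p. f p \<partial>haar) = (\<integral>\<^sup>+p. ennreal (haar_density (snd p)) * f (group_point p) \<partial>lborel)"
    unfolding haar_def using m
    by (subst nn_integral_distr[OF group_point_measurable_restrict], use f in simp, subst nn_integral_density)
      (auto simp: lborel_prod[symmetric])
  also have "\<dots> = (\<integral>\<^sup>+p. ennreal (haar_density (snd p)) * f (group_point p) \<partial>(lborel \<Otimes>\<^sub>M lborel))"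
    by (simp add: lborel_prod)
  also have "\<dots> = (\<integral>\<^sup>+\<xi>. \<integral>\<^sup>+x. ennreal (haar_density \<xi>) * f (group_point (x, \<xi>)) \<partial>lborel \<partial>lborel)"
    by (subst lborel_pair.nn_integral_snd[symmetric]) (auto simp: case_prod_beta)
  also have "\<dots> = (\<integral>\<^sup>+\<xi>. ennreal (haar_density \<xi>) * (\<integral>\<^sup>+x. f (group_point (x, \<xi>)) \<partial>lborel) \<partial>lborel)"
    by (intro nn_integral_cong nn_integral_cmult) measurable
  finally show ?thesis .
qed

lemma emeasure_haar:
  assumes A: "A \<in> sets haar"
  shows "emeasure haar A = (\<integral>\<^sup>+\<xi>. ennreal (haar_density \<xi>) * (\<integral>\<^sup>+x. indicator A (x, M \<xi>) \<partial>lborel) \<partial>lborel)"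
proof -
  have "emeasure haar A = (\<integral>\<^sup>+p. indicator A p \<partial>haar)"
    using A by simp
  also have "\<dots> = (\<integral>\<^sup>+\<xi>. ennreal (haar_density \<xi>) * (\<integral>\<^sup>+x. indicator A (group_point (x, \<xi>)) \<partial>lborel) \<partial>lborel)"
    using A by (intro nn_integral_haar borel_measurable_indicator) (simp add: sets_haar)
  also have "\<dots> = (\<integral>\<^sup>+\<xi>. ennreal (haar_density \<xi>) * (\<integral>\<^sup>+x. indicator A (x, M \<xi>) \<partial>lborel) \<partial>lborel)"
    using AE_first_neq_0 by (intro nn_integral_cong_AE) (auto simp: group_point_def)
  finally show ?thesis .
qed

lemma sets_haar_image:
  assumes A: "A \<in> sets haar" and p: "p \<in> UNIV \<times> unit_group"
  shows "affine_mult p ` A \<in> sets haar"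
proof -
  obtain x h where xh: "p = (x, h)" "h \<in> unit_group" using p by auto
  obtain B where B: "B \<in> sets borel" "A = (UNIV \<times> unit_group) \<inter> B"
    using A by (auto simp: sets_haar sets_restrict_space)
  define k where "k = matrix_inv h"
  have k: "k \<in> unit_group"
    using closed_matrix_group_unit_group xh by (simp add: closed_matrix_group_def k_def)
  have inv: "invertible h" using xh invertible_unit_group by blast
  have kv: "k *v (h *v v) = v" "h *v (k *v v) = v" for v
    using matrix_inv_mult_vec[OF inv] by (simp_all add: k_def)
  have kh: "k ** (h ** g) = g" "h ** (k ** g) = g" for g :: "'n sqmat"
    by (simp_all add: matrix_eq matrix_vector_mul_assoc[symmetric] kv)
  define q where "q z = (k *v (fst z - x), k ** snd z)" for z :: "(real, 'n) vec \<times> 'n sqmat"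
  have mult_mem: "g ** g' \<in> unit_group" if "g \<in> unit_group" "g' \<in> unit_group" for g g'
    using that closed_matrix_group_unit_group by (simp add: closed_matrix_group_def)
  have "affine_mult p ` A = (UNIV \<times> unit_group) \<inter> q -` B"
  proof (intro equalityI subsetI)
    fix z assume "z \<in> affine_mult p ` A"
    then obtain y g where yg: "z = (x + h *v y, h ** g)" "(y, g) \<in> B" "g \<in> unit_group"
      by (auto simp: affine_mult_def xh B)
    then show "z \<in> (UNIV \<times> unit_group) \<inter> q -` B"
      using mult_mem xh by (auto simp: q_def kv kh)
  next
    fix z assume z: "z \<in> (UNIV \<times> unit_group) \<inter> q -` B"
    then have "q z \<in> A" using mult_mem[OF k] by (auto simp: B q_def)
    moreover have "affine_mult p (q z) = z"
      by (simp add: affine_mult_def xh q_def kv kh)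
    ultimately show "z \<in> affine_mult p ` A" by (metis imageI)
  qed
  moreover have "q -` B \<in> sets borel"
  proof -
    have "continuous_on UNIV (\<lambda>z. k *v (fst z - x))"
      by (intro bounded_linear.continuous_on[OF matrix_vector_mul_bounded_linear] continuous_intros)
    moreover have "continuous_on UNIV (\<lambda>z :: (real, 'n) vec \<times> 'n sqmat. k ** snd z)"
      by (rule bounded_bilinear.continuous_on[OF bounded_bilinear_matrix_mult]) (intro continuous_intros)+
    ultimately have "q \<in> borel_measurable borel"
      unfolding q_def[abs_def] by (intro borel_measurable_continuous_onI continuous_on_Pair)
    from measurable_sets[OF this B(1)] show ?thesis by simp
  qed
  ultimately show ?thesis
    by (auto simp: sets_haar sets_restrict_space)
qed

text \<open>
  The substitutions \<open>y \<mapsto> x0 + M \<zeta> *v y\<close> and \<open>\<eta> \<mapsto> star \<zeta> \<eta>\<close> undo the left translation. Each contributes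
  the factor \<open>\<bar>det (M \<zeta>)\<bar>\<close>, and the density absorbs both (\<open>haar_density_star\<close>).
\<close>

lemma haar_left_invariant:
  assumes A: "A \<in> sets haar" and p: "p \<in> UNIV \<times> unit_group"
  shows "emeasure haar (affine_mult p ` A) = emeasure haar A"
proof -
  obtain x0 \<zeta> where xh: "p = (x0, M \<zeta>)" "\<zeta> $ first_index \<noteq> 0" using p by (auto simp: unit_group_def)
  define A' where "A' = affine_mult p ` A"
  have A': "A' \<in> sets haar" unfolding A'_def by (rule sets_haar_image[OF A p])
  have invM: "invertible (M \<zeta>)" and invT: "invertible (transpose (M \<zeta>))"
    using xh(2) by (simp_all add: invertible_M invertible_transpose)
  define D where "D = \<bar>det (M \<zeta>)\<bar>"
  have D: "0 < D" using invM by (simp add: D_def invertible_det_nz)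
  have [measurable]: "(\<lambda>z. (indicator A' (fst z, M (snd z)) :: ennreal)) \<in> borel_measurable (borel \<Otimes>\<^sub>M borel)"
  proof -
    obtain B where B: "B \<in> sets borel" "A' = (UNIV \<times> unit_group) \<inter> B"
      using A' by (auto simp: sets_haar sets_restrict_space)
    have [measurable]: "B \<in> sets (borel \<Otimes>\<^sub>M borel)" using B(1) unfolding borel_prod .
    have eq: "indicator A' (fst z, M (snd z)) = (if snd z $ first_index \<noteq> 0 then indicator B (fst z, M (snd z)) else (0::ennreal))" for z
    proof -
      have "M (snd z) \<in> unit_group \<longleftrightarrow> snd z $ first_index \<noteq> 0"
        using unit_group_first[of "M (snd z)"] by (auto simp: M_diagonal) (auto simp: unit_group_def)
      then show ?thesis by (auto simp: B(2) indicator_def)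
    qed
    show ?thesis unfolding eq by measurable
  qed
  have mA: "(\<lambda>y. (indicator A' (y, M \<eta>) :: ennreal)) \<in> borel_measurable borel" for \<eta>
  proof -
    have "(\<lambda>y. indicator A' (fst (y, \<eta>), M (snd (y, \<eta>))) :: ennreal) \<in> borel_measurable borel"
      by measurable
    then show ?thesis by simp
  qed
  have inner: "(\<integral>\<^sup>+y. indicator A' (y, M (star \<zeta> \<eta>)) \<partial>lborel) = ennreal D * (\<integral>\<^sup>+y. indicator A (y, M \<eta>) \<partial>lborel)" for \<eta>
  proof -
    define F where "F y = (indicator A' (x0 + y, M (star \<zeta> \<eta>)) :: ennreal)" for y
    have Fm: "F \<in> borel_measurable borel"
      unfolding F_def by (rule measurable_compose[OF _ mA]) measurable
    have "(\<integral>\<^sup>+y. indicator A' (y, M (star \<zeta> \<eta>)) \<partial>lborel) = (\<integral>\<^sup>+y. F y \<partial>lborel)"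
      unfolding F_def using mA by (subst lborel_distr_plus[of x0, symmetric]) (simp add: nn_integral_distr)
    also have "\<dots> = ennreal D * (\<integral>\<^sup>+y. F (M \<zeta> *v y) \<partial>lborel)"
      unfolding nn_integral_matrix[OF invM Fm] D_def[symmetric] using D
      by (simp add: mult.assoc[symmetric] flip: ennreal_mult)
    also have "(\<lambda>y. F (M \<zeta> *v y)) = (\<lambda>y. indicator A (y, M \<eta>))"
    proof
      fix y
      have "affine_mult p (y, M \<eta>) = (x0 + M \<zeta> *v y, M (star \<zeta> \<eta>))"
        by (simp add: affine_mult_def xh M_star)
      moreover have "inj (affine_mult p)"
      proof (rule injI)
        fix a b assume "affine_mult p a = affine_mult p b"
        then have "M \<zeta> *v fst a = M \<zeta> *v fst b" "M \<zeta> ** snd a = M \<zeta> ** snd b"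
          by (auto simp: affine_mult_def xh)
        then have "fst a = fst b" "snd a = snd b"
          using matrix_inv_mult_vec(1)[OF invM]
          by (metis, metis matrix_eq matrix_vector_mul_assoc)
        then show "a = b" by (rule prod_eqI)
      qed
      ultimately have "(x0 + M \<zeta> *v y, M (star \<zeta> \<eta>)) \<in> A' \<longleftrightarrow> (y, M \<eta>) \<in> A"
        unfolding A'_def by (metis inj_image_mem_iff)
      then show "F (M \<zeta> *v y) = indicator A (y, M \<eta>)"
        by (simp add: F_def indicator_def)
    qed
    finally show ?thesis .
  qed
  define G where "G \<eta> = ennreal (haar_density \<eta>) * (\<integral>\<^sup>+y. indicator A' (y, M \<eta>) \<partial>lborel)" for \<eta>
  have Gm: "G \<in> borel_measurable borel"
  proof -
    have "(\<lambda>\<eta>. \<integral>\<^sup>+y. indicator A' (fst (y, \<eta>), M (snd (y, \<eta>))) \<partial>lborel) \<in> borel_measurable borel"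
      by measurable
    then show ?thesis unfolding G_def[abs_def] by simp
  qed
  have "emeasure haar A' = (\<integral>\<^sup>+\<eta>. G \<eta> \<partial>lborel)"
    unfolding emeasure_haar[OF A'] G_def ..
  also have "\<dots> = ennreal D * (\<integral>\<^sup>+\<eta>. G (star \<zeta> \<eta>) \<partial>lborel)"
    unfolding transpose_M[symmetric] nn_integral_matrix[OF invT Gm] det_transpose D_def[symmetric] using D
    by (simp add: mult.assoc[symmetric] flip: ennreal_mult)
  also have "\<dots> = (\<integral>\<^sup>+\<eta>. ennreal D * G (star \<zeta> \<eta>) \<partial>lborel)"
  proof (rule nn_integral_cmult[symmetric])
    note [measurable] = Gm
    show "(\<lambda>\<eta>. G (star \<zeta> \<eta>)) \<in> borel_measurable lborel" by measurable
  qed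
  also have "\<dots> = (\<integral>\<^sup>+\<eta>. ennreal (haar_density \<eta>) * (\<integral>\<^sup>+y. indicator A (y, M \<eta>) \<partial>lborel) \<partial>lborel)"
  proof (intro nn_integral_cong)
    fix \<eta>
    have "ennreal (haar_density \<eta>) = ennreal D * ennreal (haar_density (star \<zeta> \<eta>)) * ennreal D"
      using D haar_density_star[OF xh(2), of \<eta>]
      by (simp add: D_def power2_eq_square ennreal_mult[symmetric] haar_density_def abs_mult_self_eq mult_ac flip: abs_mult)
    then show "ennreal D * G (star \<zeta> \<eta>) = ennreal (haar_density \<eta>) * (\<integral>\<^sup>+y. indicator A (y, M \<eta>) \<partial>lborel)"
      unfolding G_def inner by (simp only: mult.assoc)
  qed
  also have "\<dots> = emeasure haar A" by (rule emeasure_haar[OF A, symmetric])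
  finally show ?thesis by (simp add: A'_def)
qed

text \<open>
  On a compact subset of the group the chart is bounded and the first coordinate stays away from \<open>0\<close>,
  so the density is bounded there.
\<close>

lemma haar_compact:
  assumes K: "K \<subseteq> UNIV \<times> unit_group" "compact K"
  shows "emeasure haar K < \<infinity>"
proof (cases "K = {}")
  case False
  have Kb: "K \<in> sets borel" using K(2) by (simp add: compact_imp_closed)
  have Ks: "K \<in> sets haar"
    using K(1) Kb by (auto simp: sets_haar sets_restrict_space intro!: image_eqI[of _ _ K])
  have cont: "continuous_on K (\<lambda>z. \<bar>snd z $ first_index $ first_index\<bar>)"
    by (intro continuous_on_rabs continuous_on_component continuous_on_snd continuous_on_id)
  obtain z0 where z0: "z0 \<in> K" "\<And>z. z \<in> K \<Longrightarrow> \<bar>snd z0 $ first_index $ first_index\<bar> \<le> \<bar>snd z $ first_index $ first_index\<bar>"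
    using continuous_attains_inf[OF K(2) False cont] by blast
  define \<delta> where "\<delta> = \<bar>snd z0 $ first_index $ first_index\<bar>"
  have \<delta>: "0 < \<delta>" using z0(1) K(1) unit_group_first[of "snd z0"] by (auto simp: \<delta>_def)
  obtain R where R: "\<And>z. z \<in> K \<Longrightarrow> norm z \<le> R"
    using compact_imp_bounded[OF K(2)] by (auto simp: bounded_iff)
  define c where "c = 1 / (\<delta> ^ CARD('n))\<^sup>2"
  have bound: "ennreal (haar_density \<xi>) * indicator K (x, M \<xi>) \<le> ennreal c * (indicator (cball 0 R) x * indicator (cball 0 R) \<xi>)" for x \<xi>
  proof (cases "(x, M \<xi>) \<in> K")
    case True
    have "norm x \<le> R" using R[OF True] norm_fst_le[of x "M \<xi>"] by simp
    moreover have "norm \<xi> \<le> R"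
      using R[OF True] norm_snd_le[of "M \<xi>" x] Finite_Cartesian_Product.norm_nth_le[of "M \<xi>" first_index] by (simp add: M_row)
    moreover have "haar_density \<xi> \<le> c"
    proof -
      have "\<delta> \<le> \<bar>\<xi> $ first_index\<bar>" using z0(2)[OF True] by (simp add: \<delta>_def M_diagonal)
      then have "(\<delta> ^ CARD('n))\<^sup>2 \<le> (\<bar>\<xi> $ first_index\<bar> ^ CARD('n))\<^sup>2"
        using \<delta> by (intro power_mono) auto
      then show ?thesis
        using \<delta> by (simp add: c_def haar_density_def det_M power_abs[symmetric] frac_le)
    qed
    ultimately show ?thesis using True by (simp add: ennreal_leI)
  qed simp
  have "emeasure haar K = (\<integral>\<^sup>+\<xi>. ennreal (haar_density \<xi>) * (\<integral>\<^sup>+x. indicator K (x, M \<xi>) \<partial>lborel) \<partial>lborel)"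
    by (rule emeasure_haar[OF Ks])
  also have "\<dots> = (\<integral>\<^sup>+\<xi>. (\<integral>\<^sup>+x. ennreal (haar_density \<xi>) * indicator K (x, M \<xi>) \<partial>lborel) \<partial>lborel)"
  proof (intro nn_integral_cong nn_integral_cmult[symmetric])
    fix \<xi>
    have [measurable]: "K \<in> sets (borel \<Otimes>\<^sub>M borel)" using Kb unfolding borel_prod .
    show "(\<lambda>x. indicator K (x, M \<xi>)) \<in> borel_measurable lborel" by measurable
  qed
  also have "\<dots> \<le> (\<integral>\<^sup>+\<xi>. (\<integral>\<^sup>+x. ennreal c * (indicator (cball (0 :: (real, 'n) vec) R) x * indicator (cball (0 :: (real, 'n) vec) R) \<xi>) \<partial>lborel) \<partial>lborel)"
    by (intro nn_integral_mono bound)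
  also have "\<dots> = ennreal c * (emeasure lborel (cball (0 :: (real, 'n) vec) R) * emeasure lborel (cball (0 :: (real, 'n) vec) R))"
  proof -
    define B where "B = cball (0 :: (real, 'n) vec) R"
    have [measurable]: "B \<in> sets borel" by (simp add: B_def)
    have "(\<integral>\<^sup>+x. ennreal c * (indicator B x * indicator B \<xi>) \<partial>lborel) = ennreal c * (emeasure lborel B * indicator B \<xi>)" for \<xi>
      by (subst nn_integral_cmult, measurable, subst nn_integral_multc) auto
    moreover have "(\<integral>\<^sup>+\<xi>. ennreal c * (emeasure lborel B * indicator B \<xi>) \<partial>lborel) = ennreal c * (emeasure lborel B * emeasure lborel B)"
      by (subst nn_integral_cmult, measurable, subst nn_integral_cmult) auto
    ultimately show ?thesis by (simp add: B_def)
  qed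
  also have "\<dots> < \<infinity>"
    using emeasure_lborel_cball_finite[of "0 :: (real, 'n) vec" R] by (simp add: ennreal_mult_less_top)
  finally show ?thesis .
qed simp

theorem left_Haar_measure_haar: "left_Haar_measure unit_group haar"
  unfolding left_Haar_measure_def
proof (intro conjI ballI allI impI)
  show "emeasure haar (space haar) \<noteq> 0"
  proof
    assume "emeasure haar (space haar) = 0"
    then have "(\<integral>\<^sup>+p. 1 \<partial>haar) = 0" by simp
    then have "(\<integral>\<^sup>+\<xi>. ennreal (haar_density \<xi>) * (\<integral>\<^sup>+x. 1 \<partial>(lborel :: (real, 'n) vec measure)) \<partial>lborel) = 0"
      by (subst (asm) nn_integral_haar) auto
    then have "AE \<xi> in lborel. ennreal (haar_density \<xi>) * (\<integral>\<^sup>+x. 1 \<partial>(lborel :: (real, 'n) vec measure)) = 0"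
      by (subst (asm) nn_integral_0_iff_AE) auto
    then have "AE \<xi> in (lborel :: (real, 'n) vec measure). False"
      using AE_first_neq_0 by eventually_elim (auto simp: ennreal_eq_0_iff dest: haar_density_pos)
    then have "emeasure lborel (UNIV :: (real, 'n) vec set) = 0"
      by (subst (asm) AE_iff_measurable[of UNIV]) auto
    then show False by simp
  qed
  show "emeasure haar K < \<infinity>" if "K \<subseteq> UNIV \<times> unit_group" "compact K" for K
    using that by (rule haar_compact)
qed (simp_all add: space_haar sets_haar haar_left_invariant[unfolded sets_haar])

end

section \<open>Square integrability\<close>

lemma fourier_translate: "fourier (\<lambda>x. f (x + v)) \<xi> = cis (2 * pi * (v \<bullet> \<xi>)) * fourier f \<xi>"
proof -
  have "fourier (\<lambda>x. f (x + v)) \<xi> = (\<integral>x. f (x + v) * cis (- 2 * pi * (((x + v) - v) \<bullet> \<xi>)) \<partial>lborel)"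
    by (simp add: fourier_def)
  also have "\<dots> = (\<integral>x. f x * cis (- 2 * pi * ((x - v) \<bullet> \<xi>)) \<partial>lborel)"
    by (rule integral_translate[of "\<lambda>x. f x * cis (- 2 * pi * ((x - v) \<bullet> \<xi>))"])
  also have "\<dots> = (\<integral>x. cis (2 * pi * (v \<bullet> \<xi>)) * (f x * cis (- 2 * pi * (x \<bullet> \<xi>))) \<partial>lborel)"
  proof (rule Bochner_Integration.integral_cong)
    fix x
    have "cis (- 2 * pi * ((x - v) \<bullet> \<xi>)) = cis (2 * pi * (v \<bullet> \<xi>)) * cis (- 2 * pi * (x \<bullet> \<xi>))"
      unfolding cis_mult by (simp add: inner_diff_left algebra_simps)
    then show "f x * cis (- 2 * pi * ((x - v) \<bullet> \<xi>)) = cis (2 * pi * (v \<bullet> \<xi>)) * (f x * cis (- 2 * pi * (x \<bullet> \<xi>)))"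
      by simp
  qed simp
  finally show ?thesis by (simp add: fourier_def)
qed

lemma fourier_gauss: "fourier (\<lambda>x. of_real (gauss x)) \<xi> = of_real (gauss \<xi>)"
proof -
  have "cis (2 * pi * (x \<bullet> - \<xi>)) = cis (- 2 * pi * (x \<bullet> \<xi>))" for x by simp
  then show ?thesis
    using gauss_fourier[of "- \<xi>"] unfolding fourier_def has_bochner_integral_iff by (simp only:) simp
qed

lemma norm_cis_minus_one_le: "norm (cis t - 1) \<le> \<bar>t\<bar>"
  using iexp_approx1[of t 0] by (simp add: cis_conv_exp)

text \<open>
  With \<open>t = \<bar>\<xi> $ i\<bar>\<close>, the power is at most \<open>exp (m * t)\<close>, and \<open>m * t - t\<^sup>2 \<le> m\<^sup>2\<close>.
\<close>

lemma power_times_gauss_bound: "\<bar>\<xi> $ i\<bar> ^ m * gauss \<xi> \<le> exp ((real m)\<^sup>2)" for \<xi> :: "real^'n"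
proof -
  define t where "t = \<bar>\<xi> $ i\<bar>"
  have "t \<le> exp t" using exp_ge_add_one_self[of t] by linarith
  then have "t ^ m \<le> (exp t) ^ m" by (intro power_mono) (auto simp: t_def)
  also have "\<dots> = exp (real m * t)" by (simp add: exp_of_nat_mult)
  finally have 1: "t ^ m \<le> exp (real m * t)" .
  have "t\<^sup>2 \<le> pi * (norm \<xi>)\<^sup>2"
  proof -
    have "t\<^sup>2 \<le> (norm \<xi>)\<^sup>2" unfolding t_def using component_le_norm_cart[of \<xi> i] by (intro power_mono) auto
    also have "\<dots> \<le> pi * (norm \<xi>)\<^sup>2" using mult_right_mono[of 1 pi "(norm \<xi>)\<^sup>2"] pi_gt3 by simp
    finally show ?thesis .
  qed
  then have "gauss \<xi> \<le> exp (- t\<^sup>2)" by (simp add: gauss_def)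
  with 1 have "t ^ m * gauss \<xi> \<le> exp (real m * t) * exp (- t\<^sup>2)"
    by (intro mult_mono) (auto simp: less_imp_le[OF gauss_pos])
  also have "\<dots> = exp (real m * t - t\<^sup>2)" by (simp add: exp_diff exp_minus divide_inverse)
  also have "\<dots> \<le> exp ((real m)\<^sup>2)"
  proof -
    have "2 * real m * t \<le> (real m)\<^sup>2 + t\<^sup>2" by (rule sum_squares_bound)
    moreover have "0 \<le> (real m)\<^sup>2" "0 \<le> t\<^sup>2" by simp_all
    ultimately have "real m * t - t\<^sup>2 \<le> (real m)\<^sup>2" by linarith
    then show ?thesis by simp
  qed
  finally show ?thesis by (simp add: t_def)
qed

context jordan_hoelder_algebra
begin

text \<open>
  Iterated differences of a Gaussian in the direction of the first coordinate: each difference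
  contributes a factor to the Fourier transform that vanishes on the complement of the open orbit.
\<close>

fun wavelet :: "nat \<Rightarrow> (real, 'n) vec \<Rightarrow> complex" where
  "wavelet 0 x = of_real (gauss x)"
| "wavelet (Suc m) x = wavelet m (x + axis first_index 1) - wavelet m x"

lemma bounded_integrable_wavelet: "bounded_integrable (wavelet m)"
proof (induction m)
  case 0
  have "integrable lborel (\<lambda>x :: (real, 'n) vec. complex_of_real (gauss x))"
    using integrable_gauss[where 'a="(real, 'n) vec"] by (simp add: complex_of_real_integrable_eq)
  moreover have "norm (complex_of_real (gauss x)) \<le> 1" for x :: "(real, 'n) vec"
    using gauss_le_one[of x] gauss_pos[of x] by simp
  ultimately show ?case
    by (auto simp: bounded_integrable_def bounded_iff wavelet.simps(1)[abs_def])
next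
  case (Suc m)
  then obtain B where B: "\<And>x. norm (wavelet m x) \<le> B"
    by (auto simp: bounded_integrable_def bounded_iff)
  have "norm (wavelet (Suc m) x) \<le> B + B" for x
    unfolding wavelet.simps using norm_triangle_ineq4 B add_mono order_trans by meson
  moreover have "integrable lborel (wavelet (Suc m))"
    unfolding wavelet.simps(2)[abs_def] using Suc integrable_translate[of "wavelet m" "axis first_index 1"]
    by (simp add: bounded_integrable_def)
  ultimately show ?case unfolding bounded_integrable_def bounded_iff by blast
qed

lemma fourier_wavelet: "fourier (wavelet m) \<xi> = (cis (2 * pi * \<xi> $ first_index) - 1) ^ m * of_real (gauss \<xi>)"
proof (induction m)
  case 0
  then show ?case by (simp add: wavelet.simps(1)[abs_def] fourier_gauss)
next
  case (Suc m)
  have i: "integrable lborel (wavelet m)" using bounded_integrable_wavelet by (simp add: bounded_integrable_def)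
  have "fourier (wavelet (Suc m)) \<xi> = fourier (\<lambda>x. wavelet m (x + axis first_index 1) + (- 1) * wavelet m x) \<xi>"
    by (simp add: wavelet.simps(2)[abs_def])
  also have "\<dots> = cis (2 * pi * (axis first_index 1 \<bullet> \<xi>)) * fourier (wavelet m) \<xi> + (- 1) * fourier (wavelet m) \<xi>"
    by (subst fourier_add_scale[OF integrable_translate[OF i] i]) (simp add: fourier_translate)
  finally show ?case
    unfolding Suc.IH by (simp add: inner_axis' algebra_simps del: wavelet.simps)
qed

text \<open>
  As many differences as the dimension suffice: the square of \<open>wavelet_hat \<xi>\<close> then vanishes to twice the
  order of \<open>det (M \<xi>)\<close>.
\<close>

definition wavelet_hat :: "(real, 'n) vec \<Rightarrow> complex" where "wavelet_hat = fourier (wavelet CARD('n))"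

lemma wavelet_hat_measurable [measurable]: "wavelet_hat \<in> borel_measurable borel"
  unfolding wavelet_hat_def using bounded_integrable_wavelet[of "CARD('n)"]
  by (intro fourier_measurable) (auto simp: bounded_integrable_def)

lemma norm_wavelet_hat_le: "norm (wavelet_hat \<xi>) \<le> (2 * pi * \<bar>\<xi> $ first_index\<bar>) ^ CARD('n) * gauss \<xi>"
proof -
  have "norm (cis (2 * pi * \<xi> $ first_index) - 1) ^ CARD('n) \<le> (2 * pi * \<bar>\<xi> $ first_index\<bar>) ^ CARD('n)"
    using norm_cis_minus_one_le[of "2 * pi * \<xi> $ first_index"] by (intro power_mono) (auto simp: abs_mult)
  then show ?thesis
    unfolding wavelet_hat_def fourier_wavelet norm_mult norm_power
    by (simp add: less_imp_le[OF gauss_pos] mult_right_mono)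
qed

lemma norm_wavelet_hat_le_gauss: "norm (wavelet_hat \<xi>) \<le> 2 ^ CARD('n) * gauss \<xi>"
proof -
  have "norm (cis (2 * pi * \<xi> $ first_index) - 1) \<le> 2"
    using norm_triangle_ineq4[of "cis (2 * pi * \<xi> $ first_index)" 1] by simp
  then have "norm (cis (2 * pi * \<xi> $ first_index) - 1) ^ CARD('n) \<le> 2 ^ CARD('n)"
    by (intro power_mono) auto
  then show ?thesis
    unfolding wavelet_hat_def fourier_wavelet norm_mult norm_power
    by (simp add: less_imp_le[OF gauss_pos] mult_right_mono)
qed

lemma wavelet_hat_bounded: "norm (wavelet_hat \<xi>) \<le> 2 ^ CARD('n)"
  using norm_wavelet_hat_le_gauss[of \<xi>] gauss_le_one[of \<xi>] by (meson mult_left_le order_trans zero_le_numeral zero_le_power)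

lemma integrable_wavelet_hat: "integrable lborel wavelet_hat"
proof (rule Bochner_Integration.integrable_bound)
  show "integrable lborel (\<lambda>\<xi> :: (real, 'n) vec. 2 ^ CARD('n) * gauss \<xi>)"
    by (rule integrable_mult_right) (rule integrable_gauss)
  show "AE \<xi> in lborel. norm (wavelet_hat \<xi>) \<le> norm (2 ^ CARD('n) * gauss \<xi>)"
    unfolding real_norm_def by (rule AE_I2, rule order_trans[OF norm_wavelet_hat_le_gauss abs_ge_self])
qed simp

text \<open>
  The Fourier transform vanishes only where the first coordinate is an integer.
\<close>

lemma wavelet_nonzero: "wavelet CARD('n) \<in> L2 - L2_null"
proof -
  have L: "wavelet CARD('n) \<in> L2" by (rule bounded_integrable_L2[OF bounded_integrable_wavelet])
  have wavelet_hat_L2: "wavelet_hat \<in> L2" unfolding wavelet_hat_def by (rule fourier_bounded_integrable_L2[OF bounded_integrable_wavelet])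
  have "wavelet CARD('n) \<notin> L2_null"
  proof
    assume "wavelet CARD('n) \<in> L2_null"
    then have "L2_seminorm wavelet_hat = 0"
      using fourier_bounded_integrable_L2(2)[OF bounded_integrable_wavelet, of "CARD('n)"] L2_null_iff[OF L]
      by (simp add: wavelet_hat_def)
    then have "AE \<xi> in lborel. wavelet_hat \<xi> = 0"
      using L2_null_iff[OF wavelet_hat_L2] by (simp add: L2_null_def)
    moreover have "AE \<xi> in lborel. \<forall>k :: int. (\<xi> :: (real, 'n) vec) $ first_index \<noteq> of_int k"
    proof -
      have "axis first_index 1 \<in> (Basis :: (real, 'n) vec set)" by (simp add: axis_in_Basis_iff)
      then have "AE \<xi> in lborel. (\<xi> :: (real, 'n) vec) $ first_index \<noteq> of_int k" for k :: int
        using AE_lborel_inner_neq[of "axis first_index 1 :: (real, 'n) vec" "of_int k"] by (simp add: inner_axis)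
      then show ?thesis by (simp add: AE_all_countable)
    qed
    ultimately have "AE \<xi> in (lborel :: (real, 'n) vec measure). False"
    proof eventually_elim
      case (elim \<xi>)
      have "cis (2 * pi * \<xi> $ first_index) = 1"
        using elim(1) gauss_pos[of \<xi>] by (auto simp: wavelet_hat_def fourier_wavelet)
      then have "\<exists>k :: int. 2 * pi * \<xi> $ first_index = of_int (2 * k) * pi"
        unfolding cis_conv_exp exp_eq_1 by simp
      then show ?case using elim(2) by auto
    qed
    then have "emeasure lborel (UNIV :: (real, 'n) vec set) = 0"
      by (subst (asm) AE_iff_measurable[of UNIV]) auto
    then show False by simp
  qed
  with L show ?thesis by simp
qed

definition matrix_coefficient :: "(real, 'n) vec \<Rightarrow> (real, 'n) vec \<Rightarrow> complex" where
  "matrix_coefficient x \<zeta> = (\<integral>\<xi>. (cnj (wavelet_hat \<xi>) * wavelet_hat (star \<zeta> \<xi>)) * cis (- 2 * pi * (\<xi> \<bullet> x)) \<partial>lborel)"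

lemma matrix_coefficient_fourier: "matrix_coefficient x \<zeta> = fourier (\<lambda>\<xi>. cnj (wavelet_hat \<xi>) * wavelet_hat (star \<zeta> \<xi>)) x"
  by (simp add: matrix_coefficient_def fourier_def)

lemma matrix_coefficient_measurable [measurable]:
  "(\<lambda>p. matrix_coefficient (fst p) (snd p)) \<in> borel_measurable (borel \<Otimes>\<^sub>M borel)"
  unfolding matrix_coefficient_def by measurable

text \<open>
  On the Fourier side, the matrix coefficient is itself a Fourier transform as a function of \<open>x\<close>.
\<close>

lemma wavelet_coefficient:
  assumes "\<zeta> $ first_index \<noteq> 0"
  shows "(norm (L2_inner (wavelet CARD('n)) (quasi_regular (x, M \<zeta>) (wavelet CARD('n)))))\<^sup>2
    = \<bar>det (M \<zeta>)\<bar> * (norm (matrix_coefficient x \<zeta>))\<^sup>2"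
proof -
  define c where "c = \<bar>det (M \<zeta>)\<bar> powr (1 / 2)"
  have inv: "invertible (M \<zeta>)" using assms by (simp add: invertible_M)
  then have c: "c\<^sup>2 = \<bar>det (M \<zeta>)\<bar>" unfolding c_def by (intro powr_half_squared) (simp add: invertible_det_nz)
  have pair: "plancherel_pair (wavelet CARD('n)) wavelet_hat"
    unfolding wavelet_hat_def by (rule plancherel_pair_bounded_integrable[OF bounded_integrable_wavelet])
  have "L2_inner (wavelet CARD('n)) (quasi_regular (x, M \<zeta>) (wavelet CARD('n))) = L2_inner wavelet_hat (dual_regular (x, M \<zeta>) wavelet_hat)"
    using inv by (intro plancherel_pair_inner plancherel_pair_quasi_regular pair) simp
  also have "\<dots> = cnj (of_real c * matrix_coefficient x \<zeta>)"
    unfolding L2_inner_def matrix_coefficient_def integral_mult_right_zero[symmetric] Bochner_Integration.integral_cnj[symmetric]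
    by (intro Bochner_Integration.integral_cong) (simp_all add: dual_regular_M c_def cis_cnj inner_commute mult_ac)
  finally show ?thesis
    by (simp add: norm_mult power_mult_distrib c)
qed

lemma nn_integral_matrix_coefficient:
  "(\<integral>\<^sup>+x. ennreal ((norm (matrix_coefficient x \<zeta>))\<^sup>2) \<partial>lborel) = (\<integral>\<^sup>+\<xi>. ennreal ((norm (wavelet_hat \<xi>))\<^sup>2 * (norm (wavelet_hat (star \<zeta> \<xi>)))\<^sup>2) \<partial>lborel)"
proof -
  have "integrable lborel (\<lambda>\<xi>. cnj (wavelet_hat \<xi>) * wavelet_hat (star \<zeta> \<xi>))"
    using integrable_wavelet_hat wavelet_hat_bounded by (intro integrable_bounded_mult(2)[where B="2 ^ CARD('n)"]) auto
  moreover have "norm (cnj (wavelet_hat \<xi>) * wavelet_hat (star \<zeta> \<xi>)) \<le> 2 ^ CARD('n) * 2 ^ CARD('n)" for \<xi>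
    unfolding norm_mult complex_mod_cnj by (intro mult_mono wavelet_hat_bounded) auto
  ultimately have bi: "bounded_integrable (\<lambda>\<xi>. cnj (wavelet_hat \<xi>) * wavelet_hat (star \<zeta> \<xi>))"
    unfolding bounded_integrable_def bounded_iff by blast
  show ?thesis
    unfolding matrix_coefficient_fourier
    using nn_integral_L2[OF fourier_bounded_integrable_L2(1)[OF bi]] nn_integral_L2[OF bounded_integrable_L2[OF bi]]
      fourier_bounded_integrable_L2(2)[OF bi]
    by (simp add: norm_mult power_mult_distrib)
qed

text \<open>
  The integrand of the admissibility condition for the wavelet.
\<close>

definition calderon :: "(real, 'n) vec \<Rightarrow> real" where
  "calderon \<eta> = (norm (wavelet_hat \<eta>))\<^sup>2 / \<bar>det (M \<eta>)\<bar>"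

lemma calderon_measurable [measurable]: "calderon \<in> borel_measurable borel"
  unfolding calderon_def[abs_def] det_M by measurable

lemma calderon_le: "calderon \<eta> \<le> (2 * pi) ^ (2 * CARD('n)) * exp ((real CARD('n))\<^sup>2) * gauss \<eta>"
proof (cases "\<eta> $ first_index = 0")
  case True
  then show ?thesis by (simp add: calderon_def det_M power_0_left less_imp_le[OF gauss_pos])
next
  case False
  define t where "t = \<bar>\<eta> $ first_index\<bar>"
  have t: "0 < t" using False by (simp add: t_def)
  have "(norm (wavelet_hat \<eta>))\<^sup>2 \<le> ((2 * pi * t) ^ CARD('n) * gauss \<eta>)\<^sup>2"
    unfolding t_def by (intro power_mono norm_wavelet_hat_le) simp
  also have "\<dots> = (2 * pi) ^ (2 * CARD('n)) * (t ^ CARD('n) * gauss \<eta>) * gauss \<eta> * t ^ CARD('n)"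
  proof -
    have 1: "(2 * pi * t) ^ CARD('n) = (2 * pi) ^ CARD('n) * t ^ CARD('n)"
      by (simp only: power_mult_distrib)
    have 2: "(2 * pi) ^ (2 * CARD('n)) = (2 * pi) ^ CARD('n) * (2 * pi) ^ CARD('n)"
      by (simp only: mult_2 power_add)
    show ?thesis unfolding 1 2 by (simp only: power2_eq_square mult_ac)
  qed
  also have "\<dots> \<le> (2 * pi) ^ (2 * CARD('n)) * exp ((real CARD('n))\<^sup>2) * gauss \<eta> * t ^ CARD('n)"
    using power_times_gauss_bound[of \<eta> first_index "CARD('n)"] t
    by (intro mult_right_mono mult_left_mono) (auto simp: t_def less_imp_le[OF gauss_pos])
  finally have "(norm (wavelet_hat \<eta>))\<^sup>2 \<le> (2 * pi) ^ (2 * CARD('n)) * exp ((real CARD('n))\<^sup>2) * gauss \<eta> * t ^ CARD('n)" .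
  moreover have "\<bar>det (M \<eta>)\<bar> = t ^ CARD('n)" by (simp add: det_M t_def power_abs)
  ultimately show ?thesis
    using t by (simp add: calderon_def divide_le_eq)
qed

lemma nn_integral_calderon_finite: "(\<integral>\<^sup>+\<eta>. ennreal (calderon \<eta>) \<partial>lborel) < \<infinity>"
proof -
  have i: "integrable lborel (\<lambda>\<eta> :: (real, 'n) vec. (2 * pi) ^ (2 * CARD('n)) * exp ((real CARD('n))\<^sup>2) * gauss \<eta>)"
    by (rule integrable_mult_right) (rule integrable_gauss)
  have "(\<integral>\<^sup>+\<eta>. ennreal (calderon \<eta>) \<partial>lborel) \<le> (\<integral>\<^sup>+\<eta>. ennreal ((2 * pi) ^ (2 * CARD('n)) * exp ((real CARD('n))\<^sup>2) * gauss \<eta>) \<partial>(lborel :: (real, 'n) vec measure))"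
    by (intro nn_integral_mono ennreal_leI calderon_le)
  also have "\<dots> < \<infinity>"
    using nn_integral_eq_integral[OF i] by (simp add: less_imp_le[OF gauss_pos])
  finally show ?thesis .
qed

text \<open>
  The substitution \<open>\<eta> = star \<xi> \<zeta>\<close> shows that the integral over the orbit of \<open>\<xi>\<close> does not depend on \<open>\<xi>\<close>.
\<close>

lemma nn_integral_orbit:
  assumes "\<xi> $ first_index \<noteq> 0"
  shows "(\<integral>\<^sup>+\<zeta>. ennreal (1 / \<bar>det (M \<zeta>)\<bar>) * ennreal ((norm (wavelet_hat (star \<xi> \<zeta>)))\<^sup>2) \<partial>lborel) = (\<integral>\<^sup>+\<eta>. ennreal (calderon \<eta>) \<partial>lborel)"
proof -
  define D where "D = \<bar>det (M \<xi>)\<bar>"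
  have inv: "invertible (transpose (M \<xi>))" using assms by (simp add: invertible_M invertible_transpose)
  have D: "0 < D" using assms by (simp add: D_def det_M)
  have "ennreal (1 / \<bar>det (M \<zeta>)\<bar>) * ennreal ((norm (wavelet_hat (star \<xi> \<zeta>)))\<^sup>2) = ennreal D * ennreal (calderon (star \<xi> \<zeta>))" for \<zeta>
    using D by (simp add: calderon_def det_M star_first power_mult_distrib abs_mult D_def flip: ennreal_mult)
  then have "(\<integral>\<^sup>+\<zeta>. ennreal (1 / \<bar>det (M \<zeta>)\<bar>) * ennreal ((norm (wavelet_hat (star \<xi> \<zeta>)))\<^sup>2) \<partial>lborel)
      = ennreal D * (\<integral>\<^sup>+\<zeta>. ennreal (calderon (star \<xi> \<zeta>)) \<partial>lborel)"
    by (simp add: nn_integral_cmult)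
  also have "(\<integral>\<^sup>+\<zeta>. ennreal (calderon (star \<xi> \<zeta>)) \<partial>lborel) = ennreal (1 / D) * (\<integral>\<^sup>+\<eta>. ennreal (calderon \<eta>) \<partial>lborel)"
    using nn_integral_matrix[OF inv, of "\<lambda>\<eta>. ennreal (calderon \<eta>)"] unfolding transpose_M det_transpose D_def by simp
  finally show ?thesis
    using D by (simp add: mult.assoc[symmetric] flip: ennreal_mult)
qed

text \<open>
  Plancherel evaluates the integral over the translations, Tonelli exchanges the two remaining
  integrals, and \<open>nn_integral_orbit\<close> evaluates the inner one.
\<close>

theorem quasi_regular_square_integrable_unit_group: "quasi_regular_square_integrable unit_group"
  unfolding quasi_regular_square_integrable_def
proof (intro exI conjI bexI)
  let ?f = "wavelet CARD('n)"
  define k where "k p = \<bar>det (M (snd p))\<bar> * (norm (matrix_coefficient (fst p) (snd p)))\<^sup>2" for p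
  define W where "W p = (norm (L2_inner ?f (quasi_regular p ?f)))\<^sup>2" for p
  have Wk: "W (x, M \<zeta>) = k (x, \<zeta>)" if "\<zeta> $ first_index \<noteq> 0" for x \<zeta>
    using wavelet_coefficient[OF that] by (simp add: W_def k_def)
  have km [measurable]: "k \<in> borel_measurable (borel \<Otimes>\<^sub>M borel)"
    unfolding k_def det_M by measurable
  have Wm: "W \<in> borel_measurable (restrict_space borel (UNIV \<times> unit_group))"
  proof -
    have "(\<lambda>p :: (real, 'n) vec \<times> 'n sqmat. snd p $ first_index) \<in> borel_measurable borel"
      by (intro borel_measurable_continuous_onI continuous_on_component continuous_on_snd continuous_on_id)
    moreover have "(\<lambda>p :: (real, 'n) vec \<times> 'n sqmat. fst p) \<in> borel_measurable borel"
      by (intro borel_measurable_continuous_onI continuous_on_fst continuous_on_id)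
    ultimately have "(\<lambda>p :: (real, 'n) vec \<times> 'n sqmat. (fst p, snd p $ first_index)) \<in> borel \<rightarrow>\<^sub>M borel \<Otimes>\<^sub>M borel"
      by (intro measurable_Pair) simp_all
    then have "(\<lambda>p :: (real, 'n) vec \<times> 'n sqmat. k (fst p, snd p $ first_index)) \<in> borel_measurable borel"
      by (rule measurable_compose[OF _ km])
    then have "(\<lambda>p. k (fst p, snd p $ first_index)) \<in> borel_measurable (restrict_space borel (UNIV \<times> unit_group))"
      by (rule measurable_restrict_space1)
    moreover have "W p = k (fst p, snd p $ first_index)" if "p \<in> UNIV \<times> unit_group" for p
      using that Wk by (auto simp: unit_group_def M_row)
    ultimately show ?thesis
      by (subst measurable_cong[of _ W "\<lambda>p. k (fst p, snd p $ first_index)"]) (auto simp: space_restrict_space)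
  qed
  have "(\<integral>\<^sup>+p. ennreal (W p) \<partial>haar) = (\<integral>\<^sup>+\<zeta>. ennreal (haar_density \<zeta>) * (\<integral>\<^sup>+x. ennreal (W (group_point (x, \<zeta>))) \<partial>lborel) \<partial>lborel)"
    using Wm by (intro nn_integral_haar) measurable
  also have "\<dots> = (\<integral>\<^sup>+\<zeta>. (\<integral>\<^sup>+\<xi>. ennreal (1 / \<bar>det (M \<zeta>)\<bar>) * ennreal ((norm (wavelet_hat \<xi>))\<^sup>2 * (norm (wavelet_hat (star \<zeta> \<xi>)))\<^sup>2) \<partial>lborel) \<partial>lborel)"
  proof (rule nn_integral_cong_AE)
    show "AE \<zeta> in lborel. ennreal (haar_density \<zeta>) * (\<integral>\<^sup>+x. ennreal (W (group_point (x, \<zeta>))) \<partial>lborel)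
        = (\<integral>\<^sup>+\<xi>. ennreal (1 / \<bar>det (M \<zeta>)\<bar>) * ennreal ((norm (wavelet_hat \<xi>))\<^sup>2 * (norm (wavelet_hat (star \<zeta> \<xi>)))\<^sup>2) \<partial>lborel)"
      using AE_first_neq_0
    proof eventually_elim
      case (elim \<zeta>)
      define D where "D = \<bar>det (M \<zeta>)\<bar>"
      have D: "0 < D" using elim by (simp add: D_def det_M)
      have mc: "(\<lambda>x. matrix_coefficient x \<zeta>) \<in> borel_measurable borel"
        using measurable_compose[OF measurable_Pair1' matrix_coefficient_measurable] unfolding matrix_coefficient_def by measurable
      have "ennreal (W (group_point (x, \<zeta>))) = ennreal D * ennreal ((norm (matrix_coefficient x \<zeta>))\<^sup>2)" for x
        using elim Wk[OF elim, of x] D by (simp add: group_point_def k_def D_def ennreal_mult)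
      then have "(\<integral>\<^sup>+x. ennreal (W (group_point (x, \<zeta>))) \<partial>lborel) = ennreal D * (\<integral>\<^sup>+x. ennreal ((norm (matrix_coefficient x \<zeta>))\<^sup>2) \<partial>lborel)"
        using mc by (simp add: nn_integral_cmult)
      moreover have "ennreal (haar_density \<zeta>) * ennreal D = ennreal (1 / D)"
      proof -
        have "(det (M \<zeta>))\<^sup>2 = D * D" by (simp add: D_def power2_eq_square)
        then have "haar_density \<zeta> * D = 1 / D" using D by (simp add: haar_density_def)
        then show ?thesis using D haar_density_pos[OF elim] by (simp flip: ennreal_mult)
      qed
      ultimately have "ennreal (haar_density \<zeta>) * (\<integral>\<^sup>+x. ennreal (W (group_point (x, \<zeta>))) \<partial>lborel)
          = ennreal (1 / D) * (\<integral>\<^sup>+\<xi>. ennreal ((norm (wavelet_hat \<xi>))\<^sup>2 * (norm (wavelet_hat (star \<zeta> \<xi>)))\<^sup>2) \<partial>lborel)"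
        by (simp add: mult.assoc[symmetric] nn_integral_matrix_coefficient)
      also have "\<dots> = (\<integral>\<^sup>+\<xi>. ennreal (1 / D) * ennreal ((norm (wavelet_hat \<xi>))\<^sup>2 * (norm (wavelet_hat (star \<zeta> \<xi>)))\<^sup>2) \<partial>lborel)"
        by (rule nn_integral_cmult[symmetric]) measurable
      finally show ?case by (simp add: D_def)
    qed
  qed
  also have "\<dots> = (\<integral>\<^sup>+\<xi>. (\<integral>\<^sup>+\<zeta>. ennreal (1 / \<bar>det (M \<zeta>)\<bar>) * ennreal ((norm (wavelet_hat \<xi>))\<^sup>2 * (norm (wavelet_hat (star \<zeta> \<xi>)))\<^sup>2) \<partial>lborel) \<partial>lborel)"
    unfolding det_M by (rule lborel_pair.Fubini') measurable
  also have "\<dots> = (\<integral>\<^sup>+\<xi>. ennreal ((norm (wavelet_hat \<xi>))\<^sup>2) * (\<integral>\<^sup>+\<eta>. ennreal (calderon \<eta>) \<partial>lborel) \<partial>lborel)"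
  proof (rule nn_integral_cong_AE)
    show "AE \<xi> in lborel. (\<integral>\<^sup>+\<zeta>. ennreal (1 / \<bar>det (M \<zeta>)\<bar>) * ennreal ((norm (wavelet_hat \<xi>))\<^sup>2 * (norm (wavelet_hat (star \<zeta> \<xi>)))\<^sup>2) \<partial>lborel)
        = ennreal ((norm (wavelet_hat \<xi>))\<^sup>2) * (\<integral>\<^sup>+\<eta>. ennreal (calderon \<eta>) \<partial>lborel)"
      using AE_first_neq_0
    proof eventually_elim
      case (elim \<xi>)
      have "(\<integral>\<^sup>+\<zeta>. ennreal (1 / \<bar>det (M \<zeta>)\<bar>) * ennreal ((norm (wavelet_hat \<xi>))\<^sup>2 * (norm (wavelet_hat (star \<zeta> \<xi>)))\<^sup>2) \<partial>lborel)
          = (\<integral>\<^sup>+\<zeta>. ennreal ((norm (wavelet_hat \<xi>))\<^sup>2) * (ennreal (1 / \<bar>det (M \<zeta>)\<bar>) * ennreal ((norm (wavelet_hat (star \<xi> \<zeta>)))\<^sup>2)) \<partial>lborel)"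
        by (intro nn_integral_cong) (simp add: star_commute[of _ \<xi>] ennreal_mult mult_ac)
      also have "\<dots> = ennreal ((norm (wavelet_hat \<xi>))\<^sup>2) * (\<integral>\<^sup>+\<zeta>. ennreal (1 / \<bar>det (M \<zeta>)\<bar>) * ennreal ((norm (wavelet_hat (star \<xi> \<zeta>)))\<^sup>2) \<partial>lborel)"
        unfolding det_M by (rule nn_integral_cmult) measurable
      finally show ?case unfolding nn_integral_orbit[OF elim] .
    qed
  qed
  also have "\<dots> = ennreal ((L2_seminorm wavelet_hat)\<^sup>2) * (\<integral>\<^sup>+\<eta>. ennreal (calderon \<eta>) \<partial>lborel)"
  proof -
    have "wavelet_hat \<in> L2" unfolding wavelet_hat_def by (rule fourier_bounded_integrable_L2[OF bounded_integrable_wavelet])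
    then show ?thesis by (simp add: nn_integral_multc nn_integral_L2)
  qed
  also have "\<dots> < \<infinity>"
    using nn_integral_calderon_finite by (simp add: ennreal_mult_less_top)
  finally have fin: "(\<integral>\<^sup>+p. ennreal (W p) \<partial>haar) < \<infinity>" .
  show "integrable haar (\<lambda>p. (norm (L2_inner ?f (quasi_regular p ?f)))\<^sup>2)"
    unfolding W_def[symmetric]
  proof (rule integrableI_bounded)
    show "W \<in> borel_measurable haar"
      using Wm by (simp add: haar_def)
    show "(\<integral>\<^sup>+p. ennreal (norm (W p)) \<partial>haar) < \<infinity>"
      using fin by (simp add: W_def)
  qed
  show "?f \<in> L2 - L2_null" by (rule wavelet_nonzero)
qed (rule left_Haar_measure_haar)

text \<open>
  The identity matrix generates the dilations; then the dilation group is the whole unit group.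
\<close>

theorem shearing_subgroup_shear_group: "shearing_subgroup shear_group"
proof -
  have "shear_group \<subseteq> unit_group" by (auto simp: shear_group_def unit_group_def)
  moreover have "irreducibly_admissible unit_group"
    unfolding irreducibly_admissible_def
    by (intro conjI closed_matrix_group_unit_group quasi_regular_irreducible_unit_group
        quasi_regular_square_integrable_unit_group)
  moreover have "\<exists>Y :: 'n sqmat. (\<forall>i j. i \<noteq> j \<longrightarrow> Y $ i $ j = 0) \<and> dilations = range (\<lambda>r. mat_exp (r *\<^sub>R Y))"
    by (rule exI[of _ "mat 1"]) (simp add: mat_def dilations_def mat_exp_scaleR_one[unfolded mat_def])
  ultimately have "generalized_shearlet_dilation_group unit_group shear_group dilations"
    unfolding generalized_shearlet_dilation_group_def
    by (intro conjI closed_matrix_group_shear_group closed_matrix_group_dilations dilations_subset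
        shear_group_unitriangular connected_shear_group ballI shear_group_commute unit_group_decomposition)
  then show ?thesis unfolding shearing_subgroup_def by blast
qed

end

theorem lemma13:
  fixes a :: "'n::{finite,linorder} \<Rightarrow> 'a::{real_algebra_1,comm_ring_1}"
    and \<psi> :: "real^('n::{finite,linorder}) \<Rightarrow> 'a"
    and \<Psi> :: "'a \<Rightarrow> 'n sqmat"
    and S \<ss> :: "'n sqmat set"
    and X :: "'n \<Rightarrow> 'n sqmat"
    and d :: "'n \<Rightarrow> 'n \<Rightarrow> 'n \<Rightarrow> real"
  assumes "irreducible_algebra TYPE('a)"
    and "dim (UNIV :: 'a set) = CARD('n)"
    and "Jordan_Hoelder_basis a"
    and "\<psi> = (\<lambda>x. \<Sum>i\<in>UNIV. x $ i *\<^sub>R a i)"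
    and "linear \<Psi>"
    and "\<And>b x. inv \<psi> (b * \<psi> x) = \<Psi> b *v x"
    and "S = {mat 1 + transpose (\<Psi> b) |b. b \<in> nilradical}"
    and "\<ss> = {transpose (\<Psi> b) |b. b \<in> nilradical}"
    and "X = (\<lambda>i. transpose (\<Psi> (a i)))"
    and "\<And>i j. a i * a j = (\<Sum>k\<in>UNIV. d i j k *\<^sub>R a k)"
  shows "(shearing_subgroup S \<and> matrix_lie_algebra S = \<ss>) \<and>
    (X first_index = mat 1 \<and> canonical_basis \<ss> X) \<and>
    (\<forall>i j k. X i $ j $ k = d i j k) \<and>
    ((\<forall>i j k. d i j k = d j i k) \<and>
     (\<forall>j k. d first_index j k = (if j = k then 1 else 0)) \<and>
     (\<forall>i j k. i \<noteq> first_index \<and> j \<noteq> first_index \<and> k \<le> max i j \<longrightarrow> d i j k = 0) \<and>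
     (\<forall>i. i \<noteq> first_index \<longrightarrow>
        X i = matrix_unit first_index i +
          (\<Sum>j | first_index < j. \<Sum>k | j < k. d i j k *\<^sub>R matrix_unit j k)))"
proof -
  interpret jordan_hoelder_algebra a \<psi> \<Psi>
    using assms(1,3,4,6) by unfold_locales
  have S: "S = shear_group" and \<ss>: "\<ss> = T ` nilradical" and X: "X = (\<lambda>i. T (a i))"
    using assms(7-9) by (auto simp: shear_group_eq T_def)
  note d = assms(10)
  have "shearing_subgroup S \<and> matrix_lie_algebra S = \<ss>"
    unfolding S \<ss> using shearing_subgroup_shear_group lie_algebra_shear_group by blast
  moreover have "X first_index = mat 1 \<and> canonical_basis \<ss> X"
    unfolding X \<ss> using canonical_basis_T by (simp add: a_first T_one)
  moreover have "\<forall>i j k. X i $ j $ k = d i j k"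
    unfolding X by (simp add: structure_constants_T[OF d])
  moreover have "\<forall>i j k. d i j k = d j i k"
    using structure_constants_commute[OF d] by blast
  moreover have "\<forall>j k. d first_index j k = (if j = k then 1 else 0)"
    using structure_constants_first[OF d] by blast
  moreover have "\<forall>i j k. i \<noteq> first_index \<and> j \<noteq> first_index \<and> k \<le> max i j \<longrightarrow> d i j k = 0"
    using structure_constants_zero[OF d] by blast
  moreover have "\<forall>i. i \<noteq> first_index \<longrightarrow> X i = matrix_unit first_index i +
      (\<Sum>j | first_index < j. \<Sum>k | j < k. d i j k *\<^sub>R matrix_unit j k)"
    unfolding X using structure_constants_expansion[OF d] by blast
  ultimately show ?thesis by blast
qed

end
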